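(* Suppose that every $f(s)\in K^n(s)$ is Hurwitz stable, let $$\gamma_0=\min\Big\{ \inf_{\omega\in\mathbb{R}} \Re \frac{g_{i_1 j_1}(j\omega)}{f_{i_2 j_2}(j\omega)} : (i_1\, j_1\, i_2\, j_2) \in I_3 \Big\},$$ and suppose $$0<k<-\frac{1}{\gamma_0}\ \text{ if } \gamma_0<0,\qquad 0<k<+\infty\ \text{ if } \gamma_0\ge 0 .$$ Then, for any $g(s)\in K^m(s)$, $f(s)\in K^n(s)$, $\Phi\in \mathrm{sect}[0,k]$, the closed loop Lur'e system with forward path $\frac{g(s)}{f(s)}$ and feedback nonlinearity $\Phi$ is absolutely stable.
   Context: $j$ (not as a subscript) is the imaginary unit. A polynomial is Hurwitz stable if all its zeros lie in the open left half plane. Let $m\le n$, and let real numbers $a_i^-\le a_i^+$ ($0\le i\le m$), $b_i^-\le b_i^+$ ($0\le i\le n$) be given. The $m$-th and $n$-th order real interval polynomials are $$K^m(s)=\Big\{\sum_{i=0}^m a_i s^i : a_i\in[a_i^-,a_i^+]\Big\},\qquad K^n(s)=\Big\{\sum_{i=0}^n b_i s^i : b_i\in[b_i^-,b_i^+]\Big\},$$ where all members of $K^n(s)$ have order exactly $n$, i.e. $0\notin[b_n^-,b_n^+]$. Define (sums truncated at degree $m$) $\alpha_g^{(1)}(s^2)=a_0^-+a_2^+s^2+a_4^-s^4+a_6^+s^6+\cdots$, $\alpha_g^{(2)}(s^2)=a_0^++a_2^-s^2+a_4^+s^4+a_6^-s^6+\cdots$, $\beta_g^{(1)}(s^2)=a_1^-+a_3^+s^2+a_5^-s^4+a_7^+s^6+\cdots$,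 $\beta_g^{(2)}(s^2)=a_1^++a_3^-s^2+a_5^+s^4+a_7^-s^6+\cdots$, and $g_{ik}(s)=\alpha_g^{(i)}(s^2)+s\,\beta_g^{(k)}(s^2)\in K^m(s)$ for $i,k\in\{1,2\}$. The polynomials $f_{ik}(s)\in K^n(s)$ are defined in the same way from the bounds $b_i^\pm$. The index set is $I_3=\{(1111),(1212),(2222),(2121),(1112),(1222),(2221),(2111),(1211),(2212),(2122),(1121)\}$, where $(i_1\,j_1\,i_2\,j_2)$ is a 4-tuple with entries in $\{1,2\}$. Lur'e system: the forward path is a linear time-invariant stable component with transfer function $\frac{g(s)}{f(s)}$, with (minimal) state-space realization $\dot x=Ax+Bu$, $\sigma=Cx+Du$; the feedback path is a memoryless, possibly nonlinear and time-varying component $\Phi(t,\sigma)$ connected in negative feedback, $u=-\Phi(t,\sigma)$ (with the usual regularity making the closed loop well-posed). $\Phi\in\mathrm{sect}[0,k]$ means $\Phi(t,0)=0$ for all $t\ge 0$ and $0\le\sigma\Phi(t,\sigma)\le k\sigma^2$ for all $t\ge0$, $\sigma\in\mathbb{R}$. The system is called absolutely stable (for the sector $[0,k]$) if the closed loop system is stable for all nonlinearities in $\mathrm{sect}[0,k]$, stability being understood in the usual sense of the circle criterion: the origin $x=0$ is globally uniformly asymptotically stable. *)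

theory Defs
  imports
    "HOL-Analysis.Analysis"
    "Jordan_Normal_Form.Gauss_Jordan_Elimination"
    "Jordan_Normal_Form.Determinant"
begin

section \<open>Interval polynomials\<close>

definition cpoly :: "real poly \<Rightarrow> complex poly" where
  "cpoly p = map_poly complex_of_real p"

definition hurwitz_stable :: "real poly \<Rightarrow> bool" where
  "hurwitz_stable p \<longleftrightarrow> (\<forall>z. poly (cpoly p) z = 0 \<longrightarrow> Re z < 0)"

definition interval_poly :: "nat \<Rightarrow> (nat \<Rightarrow> real) \<Rightarrow> (nat \<Rightarrow> real) \<Rightarrow> real poly set" where
  "interval_poly m lo hi =
    {(\<Sum>i\<le>m. monom (a i) i) | a. \<forall>i\<le>m. a i \<in> {lo i..hi i}}"

text \<open>\<open>kh_even m lo hi i\<close> and \<open>kh_odd m lo hi i\<close> are the polynomials \<open>\<alpha>\<^sup>(\<^sup>i\<^sup>)(z)\<close> and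
  \<open>\<beta>\<^sup>(\<^sup>i\<^sup>)(z)\<close> in the variable \<open>z = s\<^sup>2\<close>, for \<open>i \<in> {1, 2}\<close>: for \<open>i = 1\<close> the bounds alternate
  lower, upper, lower, ...; for \<open>i = 2\<close> they alternate upper, lower, upper, ....\<close>

definition kh_even :: "nat \<Rightarrow> (nat \<Rightarrow> real) \<Rightarrow> (nat \<Rightarrow> real) \<Rightarrow> nat \<Rightarrow> real poly" where
  "kh_even m lo hi i =
    (\<Sum>l | 2 * l \<le> m. monom (if (i = 1) = even l then lo (2 * l) else hi (2 * l)) l)"

definition kh_odd :: "nat \<Rightarrow> (nat \<Rightarrow> real) \<Rightarrow> (nat \<Rightarrow> real) \<Rightarrow> nat \<Rightarrow> real poly" where
  "kh_odd m lo hi i =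
    (\<Sum>l | 2 * l + 1 \<le> m. monom (if (i = 1) = even l then lo (2 * l + 1) else hi (2 * l + 1)) l)"

text \<open>\<open>\<alpha>\<^sup>(\<^sup>i\<^sup>)(s\<^sup>2) + s \<beta>\<^sup>(\<^sup>k\<^sup>)(s\<^sup>2)\<close>\<close>

definition kharitonov :: "nat \<Rightarrow> (nat \<Rightarrow> real) \<Rightarrow> (nat \<Rightarrow> real) \<Rightarrow> nat \<Rightarrow> nat \<Rightarrow> real poly" where
  "kharitonov m lo hi i k =
    pcompose (kh_even m lo hi i) (monom 1 2) + monom 1 1 * pcompose (kh_odd m lo hi k) (monom 1 2)"

definition I3 :: "(nat \<times> nat \<times> nat \<times> nat) set" where
  "I3 = {(1,1,1,1), (1,2,1,2), (2,2,2,2), (2,1,2,1),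
         (1,1,1,2), (1,2,2,2), (2,2,2,1), (2,1,1,1),
         (1,2,1,1), (2,2,1,2), (2,1,2,2), (1,1,2,1)}"

text \<open>The infimum is a real one. It is the true infimum in the intended use: if the denominator is
  Hurwitz stable of exact order \<open>n \<ge> m\<close>, the real part is bounded on the imaginary axis.\<close>

definition gamma0 ::
  "nat \<Rightarrow> (nat \<Rightarrow> real) \<Rightarrow> (nat \<Rightarrow> real) \<Rightarrow> nat \<Rightarrow> (nat \<Rightarrow> real) \<Rightarrow> (nat \<Rightarrow> real) \<Rightarrow> real" where
  "gamma0 m a_lo a_hi n b_lo b_hi =
    Min ((\<lambda>(i1, j1, i2, j2).
            INF \<omega>::real. Re (poly (cpoly (kharitonov m a_lo a_hi i1 j1)) (\<i> * complex_of_real \<omega>) /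
                             poly (cpoly (kharitonov n b_lo b_hi i2 j2)) (\<i> * complex_of_real \<omega>))) ` I3)"


section \<open>State-space realizations\<close>

text \<open>Single-input single-output systems \<open>x' = A x + B u\<close>, \<open>\<sigma> = C x + D u\<close> with state dimension
  \<open>N\<close> (possibly 0, which is the minimal dimension of a constant transfer function). The column
  \<open>B\<close> and the row \<open>C\<close> are vectors and \<open>D\<close> is a scalar.\<close>

definition state_space :: "nat \<Rightarrow> real mat \<Rightarrow> real Matrix.vec \<Rightarrow> real Matrix.vec \<Rightarrow> bool" where
  "state_space N A B C \<longleftrightarrow> A \<in> carrier_mat N N \<and> B \<in> carrier_vec N \<and> C \<in> carrier_vec N"

definition resolvent_mat :: "nat \<Rightarrow> real mat \<Rightarrow> complex \<Rightarrow> complex mat" where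
  "resolvent_mat N A s = s \<cdot>\<^sub>m 1\<^sub>m N - map_mat complex_of_real A"

definition transfer_function ::
  "nat \<Rightarrow> real mat \<Rightarrow> real Matrix.vec \<Rightarrow> real Matrix.vec \<Rightarrow> real \<Rightarrow> complex \<Rightarrow> complex" where
  "transfer_function N A B C D s =
    scalar_prod (map_vec complex_of_real C)
      (the (mat_inverse (resolvent_mat N A s)) *\<^sub>v map_vec complex_of_real B) + complex_of_real D"

text \<open>The transfer functions agree as rational functions, i.e. wherever both are defined.\<close>

definition realizes ::
  "nat \<Rightarrow> real mat \<Rightarrow> real Matrix.vec \<Rightarrow> real Matrix.vec \<Rightarrow> real \<Rightarrow> real poly \<Rightarrow> real poly \<Rightarrow> bool" where
  "realizes N A B C D g f \<longleftrightarrow> state_space N A B C \<and>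
    (\<forall>s. Determinant.det (resolvent_mat N A s) \<noteq> 0 \<and> poly (cpoly f) s \<noteq> 0 \<longrightarrow>
         transfer_function N A B C D s = poly (cpoly g) s / poly (cpoly f) s)"

definition minimal_realization ::
  "nat \<Rightarrow> real mat \<Rightarrow> real Matrix.vec \<Rightarrow> real Matrix.vec \<Rightarrow> real \<Rightarrow> real poly \<Rightarrow> real poly \<Rightarrow> bool" where
  "minimal_realization N A B C D g f \<longleftrightarrow> realizes N A B C D g f \<and>
    (\<forall>N' A' B' C' D'. realizes N' A' B' C' D' g f \<longrightarrow> N \<le> N')"


section \<open>Lur'e systems and absolute stability\<close>

definition sect :: "real \<Rightarrow> (real \<Rightarrow> real \<Rightarrow> real) set" where
  "sect k = {\<Phi>. \<forall>t\<ge>0. \<Phi> t 0 = 0 \<and> (\<forall>\<sigma>. 0 \<le> \<sigma> * \<Phi> t \<sigma> \<and> \<sigma> * \<Phi> t \<sigma> \<le> k * \<sigma>\<^sup>2)}"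

definition vnorm :: "real Matrix.vec \<Rightarrow> real" where
  "vnorm v = sqrt (scalar_prod v v)"

text \<open>\<open>x\<close> is a Caratheodory solution on the interval \<open>J\<close> with left endpoint \<open>t0 \<in> J\<close> of
  \<open>x' = A x + B u\<close>, \<open>\<sigma> = C x + D u\<close>, \<open>u = -\<Phi>(t, \<sigma>)\<close>: the differential equation is
  required in integrated form, since \<open>\<Phi>\<close> may be discontinuous in time.\<close>

definition lure_solution ::
  "nat \<Rightarrow> real mat \<Rightarrow> real Matrix.vec \<Rightarrow> real Matrix.vec \<Rightarrow> real \<Rightarrow> (real \<Rightarrow> real \<Rightarrow> real) \<Rightarrow>
   real \<Rightarrow> real set \<Rightarrow> (real \<Rightarrow> real Matrix.vec) \<Rightarrow> bool" where
  "lure_solution N A B C D \<Phi> t0 J x \<longleftrightarrow>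
    (\<forall>t\<in>J. x t \<in> carrier_vec N) \<and>
    (\<exists>\<sigma> u. (\<forall>t\<in>J. \<sigma> t = scalar_prod C (x t) + D * u t \<and> u t = - \<Phi> t (\<sigma> t)) \<and>
       (\<forall>t\<in>J. \<forall>i<N.
          (\<lambda>\<tau>. vec_index (A *\<^sub>v x \<tau> + u \<tau> \<cdot>\<^sub>v B) i) absolutely_integrable_on {t0..t} \<and>
          ((\<lambda>\<tau>. vec_index (A *\<^sub>v x \<tau> + u \<tau> \<cdot>\<^sub>v B) i) has_integral
             (vec_index (x t) i - vec_index (x t0) i)) {t0..t}))"

text \<open>Well-posedness is local solvability of the closed loop (including the algebraic loop that is
  present for \<open>D \<noteq> 0\<close>) from every initial time and state. The usual regularity conditions, e.g.
  \<open>\<Phi>\<close> piecewise continuous in \<open>t\<close> and locally Lipschitz in \<open>\<sigma>\<close> with a Lipschitz-solvable algebraic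
  loop, imply it. Uniqueness is not demanded; stability refers to all solutions.\<close>

definition lure_well_posed ::
  "nat \<Rightarrow> real mat \<Rightarrow> real Matrix.vec \<Rightarrow> real Matrix.vec \<Rightarrow> real \<Rightarrow> (real \<Rightarrow> real \<Rightarrow> real) \<Rightarrow> bool" where
  "lure_well_posed N A B C D \<Phi> \<longleftrightarrow>
    (\<forall>t0\<ge>0. \<forall>x0\<in>carrier_vec N. \<exists>h>0. \<exists>x. lure_solution N A B C D \<Phi> t0 {t0..t0 + h} x \<and> x t0 = x0)"

definition lure_forward_complete ::
  "nat \<Rightarrow> real mat \<Rightarrow> real Matrix.vec \<Rightarrow> real Matrix.vec \<Rightarrow> real \<Rightarrow> (real \<Rightarrow> real \<Rightarrow> real) \<Rightarrow> bool" where
  "lure_forward_complete N A B C D \<Phi> \<longleftrightarrow>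
    (\<forall>t0\<ge>0. \<forall>x0\<in>carrier_vec N. \<exists>x. lure_solution N A B C D \<Phi> t0 {t0..} x \<and> x t0 = x0) \<and>
    (\<forall>t0\<ge>0. \<forall>T>t0. \<forall>x. lure_solution N A B C D \<Phi> t0 {t0..<T} x \<longrightarrow>
       (\<exists>y. lure_solution N A B C D \<Phi> t0 {t0..} y \<and> (\<forall>t\<in>{t0..<T}. y t = x t)))"

text \<open>Global uniform asymptotic stability of the origin: uniform stability with a
  \<open>\<delta>(\<epsilon>)\<close> that tends to infinity with \<open>\<epsilon>\<close>, and uniform attraction from every ball. Forward
  completeness makes the conditions on global solutions speak about all solutions.\<close>

definition lure_guas ::
  "nat \<Rightarrow> real mat \<Rightarrow> real Matrix.vec \<Rightarrow> real Matrix.vec \<Rightarrow> real \<Rightarrow> (real \<Rightarrow> real \<Rightarrow> real) \<Rightarrow> bool" where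
  "lure_guas N A B C D \<Phi> \<longleftrightarrow>
    lure_forward_complete N A B C D \<Phi> \<and>
    (\<exists>\<delta>. filterlim \<delta> at_top at_top \<and>
      (\<forall>\<epsilon>>0. \<delta> \<epsilon> > (0::real) \<and>
        (\<forall>t0\<ge>0. \<forall>x. lure_solution N A B C D \<Phi> t0 {t0..} x \<and> vnorm (x t0) < \<delta> \<epsilon> \<longrightarrow>
           (\<forall>t\<ge>t0. vnorm (x t) < \<epsilon>)))) \<and>
    (\<forall>r>0. \<forall>\<eta>>0. \<exists>T\<ge>0.
      (\<forall>t0\<ge>0. \<forall>x. lure_solution N A B C D \<Phi> t0 {t0..} x \<and> vnorm (x t0) < r \<longrightarrow>
         (\<forall>t\<ge>t0 + T. vnorm (x t) < \<eta>)))"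

definition absolutely_stable ::
  "nat \<Rightarrow> real mat \<Rightarrow> real Matrix.vec \<Rightarrow> real Matrix.vec \<Rightarrow> real \<Rightarrow> real \<Rightarrow> bool" where
  "absolutely_stable N A B C D k \<longleftrightarrow>
    (\<forall>\<Phi>\<in>sect k. lure_well_posed N A B C D \<Phi> \<longrightarrow> lure_guas N A B C D \<Phi>)"

end

theory Submission
  imports
    Defs
    "HOL-Complex_Analysis.Conformal_Mappings"
    "HOL-Computational_Algebra.Fundamental_Theorem_Algebra"
    "Jordan_Normal_Form.Char_Poly"
begin

text \<open>
  The theorem follows from a lower bound for \<open>Re (g / f)\<close> on the imaginary axis, valid for the whole
  interval plant, and from the circle criterion.

  Frequency bound (\<open>interval_plant_real_part_bound\<close>). At a fixed frequency \<open>\<omega>\<close> the values of the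
  members of an interval family fill a rectangle with sides parallel to the axes, whose corners are
  the values of the four Kharitonov polynomials. Suppose that \<open>Re (g / f)\<close> falls below
  \<open>min \<gamma>\<^sub>0 0\<close> at \<open>i \<omega>\<close>. Minimise it over the product of the two rectangles and put
  \<open>\<kappa> = - g / f\<close> at the minimum, so that \<open>g + \<kappa> f = 0\<close>, \<open>Re \<kappa> > 0\<close> and \<open>Re \<kappa> + \<gamma>\<^sub>0 > 0\<close>.
  First-order optimality (\<open>rectangle_quotient_minimum\<close>) pins every coordinate of \<open>f = u + i v\<close>
  and \<open>g\<close> to an end of its interval according to the signs of \<open>u\<close>, \<open>v\<close> (for \<open>g\<close>) and of
  \<open>P\<close>, \<open>Q\<close> (for \<open>f\<close>), where \<open>P + i Q = cnj \<kappa> f\<close>. Since \<open>u P + v Q = Re \<kappa> |f|\<^sup>2 > 0\<close>, at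
  least one of \<open>u P\<close>, \<open>v Q\<close> is positive, hence \<open>g\<close> and \<open>f\<close> share their real or their imaginary
  index. Eight corner combinations share the first, eight the second, four share both: these are the
  twelve elements of \<open>I3\<close>. When a sign vanishes, the coordinate is free, but then \<open>0\<close> lies on a segment
  between two of the twelve vertices \<open>H = g\<^sub>v + \<kappa> f\<^sub>v\<close>. Both situations are impossible. A vertex
  is stable because \<open>Re (H / f\<^sub>v) \<ge> Re \<kappa> + \<gamma>\<^sub>0 > 0\<close> on the imaginary axis, hence on the closed
  right half plane by the minimum principle (\<open>stable_of_positive_real_quotient\<close>). On an edge the
  difference of the two end polynomials has a constant direction; as the argument of a stable polynomial
  strictly increases along the imaginary axis, the segment can never pass through \<open>0\<close>
  (\<open>stable_edge_excludes_zero\<close>).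

  Circle criterion (\<open>circle_criterion\<close>). The bound gives
  \<open>1 / k + Re (g / f) \<ge> 1 / k + min \<gamma>\<^sub>0 0 > 0\<close>. A minimal realization is, in suitable coordinates
  \<open>z\<close>, a chain of integrators \<open>z\<^sub>i' = z\<^sub>i\<^sub>+\<^sub>1\<close> with \<open>u = c(d/dt) z\<^sub>0\<close> and
  \<open>\<sigma> = q(d/dt) z\<^sub>0\<close>, where \<open>q / c = g / f\<close> and \<open>c\<close> is stable
  (\<open>minimal_companion_coordinates\<close>). With \<open>h = q + c / k\<close> the polynomial \<open>2 Re (h cnj c)\<close> is
  strictly positive on the imaginary axis, even after subtracting a small multiple of
  \<open>\<Sum>i\<le>N. \<omega> ^ (2 * i)\<close>; a nonnegative real polynomial is a sum of two squares, and this
  spectral factorization turns the frequency inequality into a quadratic form \<open>P\<close> whose derivative along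
  the chain is at most \<open>2 (c \<cdot> z) (h \<cdot> z) - \<eta> |z|\<^sup>2\<close>. This is the Kalman-Yakubovich-Popov lemma
  for companion systems (\<open>companion_kyp\<close>). Along the closed loop \<open>c \<cdot> z = u\<close> and
  \<open>h \<cdot> z = \<sigma> + u / k\<close>, and the sector condition says precisely that their product is nonpositive.
  So \<open>P\<close> decays exponentially, uniformly in the initial time (\<open>circle_criterion_estimate\<close>). The same
  estimate bounds the right hand side of the differential equation on every solution; hence no solution
  can stop in finite time (\<open>lure_extend_to_infinity\<close>), and all conditions of global uniform asymptotic
  stability follow.
\<close>

section \<open>Stable polynomials on the closed right half plane\<close>

text \<open>Combinations \<open>g + \<kappa> f\<close> of real polynomials with a complex factor \<open>\<kappa>\<close> have to be tested for
  stability, hence complex coefficients. The zero polynomial does not satisfy the predicate.\<close>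

definition stable :: "complex poly \<Rightarrow> bool" where
  "stable p \<longleftrightarrow> (\<forall>z. poly p z = 0 \<longrightarrow> Re z < 0)"

lemma stable_nonzero: "stable p \<Longrightarrow> 0 \<le> Re s \<Longrightarrow> poly p s \<noteq> 0"
  unfolding stable_def by force

text \<open>Stable polynomials are the products of linear factors with roots in the open left half plane;
  estimates on the closed right half plane are therefore proved factor by factor.\<close>

lemma stable_induct [consumes 1, case_names const root]:
  assumes "stable p"
    and const: "\<And>c. c \<noteq> 0 \<Longrightarrow> P [:c:]"
    and root: "\<And>z q. Re z < 0 \<Longrightarrow> stable q \<Longrightarrow> P q \<Longrightarrow> P ([:-z, 1:] * q)"
  shows "P p"
  using assms(1)
proof (induction "degree p" arbitrary: p)
  case 0
  then obtain c where c: "p = [:c:]" by (metis degree_eq_zeroE)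
  with 0 have "c \<noteq> 0" by (auto simp: stable_def dest: spec[of _ 0])
  with c const show ?case by simp
next
  case (Suc d)
  then obtain z where z: "poly p z = 0" using alg_closed_imp_poly_has_root[of p] by auto
  then obtain q where q: "p = [:-z, 1:] * q" by (auto simp: poly_eq_0_iff_dvd elim: dvdE)
  have "q \<noteq> 0" using q Suc by auto
  then have "degree p = Suc (degree q)" unfolding q by (subst degree_mult_eq) auto
  moreover have "stable q" "Re z < 0" using Suc.prems z unfolding stable_def q by auto
  ultimately show ?case using Suc.hyps q root by auto
qed

text \<open>Every factor \<open>s - z\<close> with \<open>Re z < 0\<close> is bounded below by a multiple of \<open>1 + |s|\<close>: it is at
  least \<open>- Re z\<close> near the origin and comparable to \<open>|s|\<close> far away.\<close>

lemma stable_lower_bound: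
  assumes "stable p"
  shows "\<exists>c>0. \<forall>s. 0 \<le> Re s \<longrightarrow> c * (1 + cmod s) ^ degree p \<le> cmod (poly p s)"
  using assms
proof (induction rule: stable_induct)
  case (const c)
  then show ?case by (intro exI[of _ "cmod c"]) auto
next
  case (root z q)
  then obtain c where c: "c > 0" "\<And>s. 0 \<le> Re s \<Longrightarrow> c * (1 + cmod s) ^ degree q \<le> cmod (poly q s)"
    by blast
  define a where "a = - Re z"
  define b where "b = a / (a + 1 + cmod z)"
  have a: "a > 0" and b: "b > 0" using root by (auto simp: a_def b_def intro!: divide_pos_pos add_pos_nonneg simp del: divide_minus_left)
  have lin: "b * (1 + cmod s) \<le> cmod (s - z)" if "0 \<le> Re s" for s
  proof -
    have "a \<le> cmod (s - z)" using complex_Re_le_cmod[of "s - z"] that by (simp add: a_def)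
    moreover have "cmod s \<le> cmod (s - z) + cmod z" by (metis diff_add_cancel norm_triangle_ineq)
    ultimately have "a * (1 + cmod s) \<le> a * (cmod (s - z)) + (1 + cmod z) * cmod (s - z)"
      using a mult_left_mono[of a "cmod (s - z)" "1 + cmod z"]
        mult_left_mono[of "cmod s" "cmod (s - z) + cmod z" a] by (simp add: algebra_simps)
    then show ?thesis using a by (simp add: b_def field_simps add_pos_nonneg)
  qed
  have "q \<noteq> 0" using root(2) by (auto simp: stable_def dest: spec[of _ 0])
  then have deg: "degree ([:-z, 1:] * q) = Suc (degree q)" by (subst degree_mult_eq) auto
  show ?case
  proof (intro exI[of _ "b * c"] conjI allI impI)
    show "b * c > 0" using b c by simp
    fix s :: complex assume s: "0 \<le> Re s"
    have "b * c * (1 + cmod s) ^ degree ([:-z, 1:] * q) = (b * (1 + cmod s)) * (c * (1 + cmod s) ^ degree q)"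
      unfolding deg by simp
    also have "\<dots> \<le> cmod (s - z) * cmod (poly q s)"
      using lin[OF s] c(2)[OF s] c(1) b by (intro mult_mono) auto
    also have "\<dots> = cmod (poly ([:-z, 1:] * q) s)" by (simp add: norm_mult[symmetric] algebra_simps)
    finally show "b * c * (1 + cmod s) ^ degree ([:-z, 1:] * q) \<le> cmod (poly ([:-z, 1:] * q) s)" .
  qed
qed

text \<open>The logarithmic derivative is the sum of the \<open>1 / (s - z)\<close> over the roots, each with positive
  real part. On the imaginary axis this says that the argument increases with the frequency.\<close>

lemma stable_log_deriv:
  assumes "stable p" "0 \<le> Re s"
  shows "0 \<le> Re (poly (pderiv p) s / poly p s) \<and>
    (0 < degree p \<longrightarrow> 0 < Re (poly (pderiv p) s / poly p s))"
  using assms(1)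
proof (induction rule: stable_induct)
  case (root z q)
  have nz: "s - z \<noteq> 0" "poly q s \<noteq> 0" using root stable_nonzero[OF root(2) assms(2)] assms(2) by auto
  have "poly (pderiv ([:-z, 1:] * q)) s / poly ([:-z, 1:] * q) s
      = 1 / (s - z) + poly (pderiv q) s / poly q s"
    unfolding pderiv_mult using nz by (simp add: pderiv_pCons field_simps del: mult_pCons_left)
  moreover have "0 < Re (1 / (s - z))"
    using root(1) assms(2) nz
    using complex_neq_0[of "s - z"] by (simp add: Re_divide)
  ultimately show ?case using root by simp
qed (auto simp: pderiv_pCons)

lemma poly_upper_bound:
  fixes p :: "complex poly"
  assumes "degree p \<le> d"
  shows "\<exists>K\<ge>0. \<forall>s. cmod (poly p s) \<le> K * (1 + cmod s) ^ d"
proof (intro exI[of _ "\<Sum>i\<le>degree p. cmod (coeff p i)"] conjI allI)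
  fix s
  have "cmod (poly p s) \<le> (\<Sum>i\<le>degree p. cmod (coeff p i * s ^ i))"
    unfolding poly_altdef by (rule norm_sum)
  also have "\<dots> \<le> (\<Sum>i\<le>degree p. cmod (coeff p i) * (1 + cmod s) ^ d)"
  proof (intro sum_mono)
    fix i assume i: "i \<in> {..degree p}"
    have "cmod s ^ i \<le> (1 + cmod s) ^ i" by (intro power_mono) auto
    also have "\<dots> \<le> (1 + cmod s) ^ d" using i assms by (intro power_increasing) auto
    finally show "cmod (coeff p i * s ^ i) \<le> cmod (coeff p i) * (1 + cmod s) ^ d"
      by (auto simp: norm_mult norm_power intro!: mult_left_mono)
  qed
  finally show "cmod (poly p s) \<le> (\<Sum>i\<le>degree p. cmod (coeff p i)) * (1 + cmod s) ^ d"
    by (simp add: sum_distrib_right)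
qed (simp add: sum_nonneg)

lemma stable_quotient_bounded:
  assumes "stable f" "degree g \<le> degree f"
  shows "\<exists>K\<ge>0. \<forall>s. 0 \<le> Re s \<longrightarrow> cmod (poly g s / poly f s) \<le> K"
proof -
  obtain c where c: "c > 0" "\<And>s. 0 \<le> Re s \<Longrightarrow> c * (1 + cmod s) ^ degree f \<le> cmod (poly f s)"
    using stable_lower_bound[OF assms(1)] by blast
  obtain K where K: "K \<ge> 0" "\<And>s. cmod (poly g s) \<le> K * (1 + cmod s) ^ degree f"
    using poly_upper_bound[OF assms(2)] by blast
  have "cmod (poly g s / poly f s) \<le> K / c" if s: "0 \<le> Re s" for s
  proof -
    have p: "(1 + cmod s) ^ degree f > 0" by (intro zero_less_power add_pos_nonneg) auto
    have "cmod (poly g s / poly f s) = cmod (poly g s) / cmod (poly f s)" by (simp add: norm_divide)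
    also have "\<dots> \<le> (K * (1 + cmod s) ^ degree f) / (c * (1 + cmod s) ^ degree f)"
      using c(2)[OF s] K c(1) p by (intro frac_le) auto
    also have "\<dots> = K / c" using p by (simp del: power_eq_0_iff)
    finally show ?thesis .
  qed
  then show ?thesis using K c by (intro exI[of _ "K / c"]) auto
qed

lemma stable_quotient_at_infinity:
  assumes "stable f" "degree H \<le> degree f" "e > 0"
  shows "\<exists>R. \<forall>s. 0 \<le> Re s \<longrightarrow> R \<le> cmod s \<longrightarrow>
    cmod (poly H s / poly f s - coeff H (degree f) / lead_coeff f) \<le> e"
proof -
  define l where "l = coeff H (degree f) / lead_coeff f"
  define r where "r = [:0, 1:] * (H - Polynomial.smult l f)"
  have f0: "f \<noteq> 0" using assms(1) by (auto simp: stable_def dest: spec[of _ 0])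
  have "degree (H - Polynomial.smult l f) < degree f \<or> H - Polynomial.smult l f = 0"
  proof -
    have "coeff (H - Polynomial.smult l f) i = 0" if "degree f \<le> i" for i
      using that assms(2) f0 by (cases "i = degree f") (auto simp: l_def coeff_eq_0)
    then show ?thesis by (metis leading_coeff_0_iff not_less)
  qed
  then have "degree r \<le> degree f" unfolding r_def by (auto simp: degree_mult_eq)
  then obtain K where K: "K \<ge> 0" "\<And>s. 0 \<le> Re s \<Longrightarrow> cmod (poly r s / poly f s) \<le> K"
    using stable_quotient_bounded[OF assms(1)] by blast
  have "cmod (poly H s / poly f s - l) \<le> e" if s: "0 \<le> Re s" "1 + K / e \<le> cmod s" for s
  proof -
    have "K / e \<ge> 0" using K assms(3) by simp
    then have s0: "s \<noteq> 0" "cmod s > 0" using s(2) by auto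
    have "poly H s / poly f s - l = poly r s / poly f s / s"
      using stable_nonzero[OF assms(1) s(1)] s0 by (simp add: r_def field_simps)
    then have "cmod (poly H s / poly f s - l) \<le> K / cmod s"
      using K(2)[OF s(1)] s0 by (metis divide_right_mono norm_divide norm_ge_zero)
    also have "\<dots> \<le> e" using s(2) s0 assms(3) by (simp add: field_simps)
    finally show ?thesis .
  qed
  then show ?thesis unfolding l_def by blast
qed

text \<open>\<open>H / f\<close> is holomorphic on the closed right half plane and has a limit at infinity, so its real
  part attains its infimum on the boundary. The minimum principle is used in the form of the maximum
  modulus principle for \<open>exp (- H / f)\<close> on a large half disc. A drop of the degree of \<open>H\<close> would make
  the limit, and hence the lower bound, equal to zero.\<close>

lemma stable_of_positive_real_quotient:
  assumes f: "stable f" and deg: "degree H \<le> degree f" and e: "e > 0"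
    and pos: "\<And>\<omega>::real. e \<le> Re (poly H (\<i> * \<omega>) / poly f (\<i> * \<omega>))"
  shows "stable H" "degree H = degree f"
proof -
  define l where "l = coeff H (degree f) / lead_coeff f"
  obtain R where R: "\<And>s. 0 \<le> Re s \<Longrightarrow> R \<le> cmod s \<Longrightarrow> cmod (poly H s / poly f s - l) \<le> e / 4"
    using stable_quotient_at_infinity[OF f deg, of "e / 4"] e unfolding l_def by auto
  have Rel: "3 * e / 4 \<le> Re l"
  proof -
    have "Re (poly H (\<i> * \<bar>R\<bar>) / poly f (\<i> * \<bar>R\<bar>)) - Re l \<le> e / 4"
      using R[of "\<i> * \<bar>R\<bar>"] abs_ge_self[of R] complex_Re_le_cmod[of "poly H (\<i> * \<bar>R\<bar>) / poly f (\<i> * \<bar>R\<bar>) - l"]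
      by (simp add: norm_mult)
    then show ?thesis using pos[of "\<bar>R\<bar>"] by simp
  qed
  then have "coeff H (degree f) \<noteq> 0" using e by (auto simp: l_def)
  then show "degree H = degree f" using deg by (simp add: le_degree antisym)
  show "stable H" unfolding stable_def
  proof (intro allI impI, rule ccontr)
    fix z assume z: "poly H z = 0" "\<not> Re z < 0"
    have "poly f z \<noteq> 0" using z stable_nonzero[OF f] by auto
    have "Re z \<noteq> 0"
    proof
      assume "Re z = 0"
      then have "\<i> * complex_of_real (Im z) = z" by (simp add: complex_eq_iff)
      then show False using pos[of "Im z"] z e by simp
    qed
    then have zpos: "Re z > 0" using z by simp
    define M where "M = max R (cmod z + 1)"
    define S where "S = {s. 0 < Re s} \<inter> ball 0 M"
    have opS: "open S" unfolding S_def by (intro open_Int open_halfspace_Re_gt) auto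
    have clS: "closure S \<subseteq> {s. 0 \<le> Re s} \<inter> cball 0 M"
      unfolding S_def by (rule closure_minimal) (auto intro!: closed_Int closed_halfspace_Re_ge)
    have nz: "poly f s \<noteq> 0" if "s \<in> closure S" for s using clS that stable_nonzero[OF f] by auto
    have "cmod (exp (- (poly H z / poly f z))) \<le> exp (- (e / 2))"
    proof (rule maximum_modulus_frontier[of "\<lambda>s. exp (- (poly H s / poly f s))" S])
      show "(\<lambda>s. exp (- (poly H s / poly f s))) holomorphic_on interior S"
        using nz interior_subset[of S] closure_subset[of S]
        by (intro holomorphic_intros) auto
      show "continuous_on (closure S) (\<lambda>s. exp (- (poly H s / poly f s)))"
        using nz by (intro continuous_intros) auto
      show "bounded S" unfolding S_def by (intro bounded_Int) auto
      show "z \<in> S" using zpos by (auto simp: S_def M_def)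
      fix s assume "s \<in> frontier S"
      then have s: "s \<in> closure S" "s \<notin> S" using opS by (auto simp: frontier_def interior_open)
      then have s': "0 \<le> Re s" "cmod s \<le> M" using clS by auto
      have "e / 2 \<le> Re (poly H s / poly f s)"
      proof (cases "Re s = 0")
        case True
        then have "\<i> * complex_of_real (Im s) = s" by (simp add: complex_eq_iff)
        then show ?thesis using pos[of "Im s"] e by (simp del: Re_divide)
      next
        case False
        then have "cmod s = M" using s s' by (auto simp: S_def)
        then have "cmod (poly H s / poly f s - l) \<le> e / 4" using R s' by (auto simp: M_def)
        then show ?thesis using Rel abs_Re_le_cmod[of "poly H s / poly f s - l"] by (simp del: Re_divide)
      qed
      then show "cmod (exp (- (poly H s / poly f s))) \<le> exp (- (e / 2))" by simp
    qed
    then show False using z e by simp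
  qed
qed

text \<open>The difference of the two polynomials is a real multiple of \<open>e\<close> at every frequency, so their
  components transverse to \<open>e\<close> are the same function of \<open>\<omega>\<close>. If \<open>0\<close> were on the segment at some
  frequency, both values would lie on the line spanned by \<open>e\<close>, on opposite sides of the origin; as both
  arguments increase there, the transverse components would have derivatives of opposite signs.\<close>

lemma stable_edge_excludes_zero:
  assumes L: "stable HL" "0 < degree HL" and R: "stable HR" and e: "e \<noteq> 0"
    and dir: "\<And>\<omega>::real. Im ((poly HR (\<i> * \<omega>) - poly HL (\<i> * \<omega>)) / e) = 0"
    and t: "0 \<le> t" "t \<le> 1"
  shows "(1 - of_real t) * poly HL (\<i> * of_real \<omega>) + of_real t * poly HR (\<i> * of_real \<omega>) \<noteq> 0"
proof
  assume zero: "(1 - of_real t) * poly HL (\<i> * of_real \<omega>) + of_real t * poly HR (\<i> * of_real \<omega>) = 0"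
  let ?s = "\<i> * complex_of_real \<omega>"
  have der: "((\<lambda>x. Im ((poly HR (\<i> * complex_of_real x) - poly HL (\<i> * complex_of_real x)) / e)) has_real_derivative
      Im (\<i> * (poly (pderiv HR) ?s - poly (pderiv HL) ?s) / e)) (at \<omega>)"
  proof -
    have "((\<lambda>x. (poly HR (\<i> * x) - poly HL (\<i> * x)) / e) has_field_derivative
      \<i> * (poly (pderiv HR) ?s - poly (pderiv HL) ?s) / e) (at (complex_of_real \<omega>))"
    proof -
      have lin: "((\<lambda>x. \<i> * x) has_field_derivative \<i>) (at (complex_of_real \<omega>))"
        by (auto intro!: derivative_eq_intros)
      have "((\<lambda>x. poly p (\<i> * x)) has_field_derivative poly (pderiv p) ?s * \<i>) (at (complex_of_real \<omega>))" for p
        by (rule DERIV_chain2[OF poly_DERIV lin])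
      from DERIV_cdivide[OF DERIV_diff[OF this[of HR] this[of HL]], of e]
      show ?thesis by (simp add: algebra_simps)
    qed
    then have "((\<lambda>x. (poly HR (\<i> * complex_of_real x) - poly HL (\<i> * complex_of_real x)) / e) has_vector_derivative
      \<i> * (poly (pderiv HR) ?s - poly (pderiv HL) ?s) / e) (at \<omega>)"
      using has_vector_derivative_real_field by blast
    then show ?thesis
      unfolding has_real_derivative_iff_has_vector_derivative
      by (rule bounded_linear.has_vector_derivative[OF bounded_linear_Im])
  qed
  \<comment> \<open>the transverse component of \<open>HR - HL\<close> vanishes identically, hence so does its derivative\<close>
  have "((\<lambda>x. 0) has_real_derivative Im (\<i> * (poly (pderiv HR) ?s - poly (pderiv HL) ?s) / e)) (at \<omega>)"
    using der unfolding dir .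
  then have D: "Im (\<i> * (poly (pderiv HR) ?s - poly (pderiv HL) ?s) / e) = 0"
    using DERIV_unique[OF _ DERIV_const] by blast
  define d where "d = Re ((poly HR ?s - poly HL ?s) / e)"
  have d: "poly HR ?s - poly HL ?s = of_real d * e"
    using dir[of \<omega>] e by (metis complex_is_Real_iff d_def nonzero_divide_eq_eq of_real_Re)
  have vL: "poly HL ?s = - of_real (t * d) * e"
  proof -
    have "poly HL ?s + of_real t * (poly HR ?s - poly HL ?s) = 0" using zero by (simp add: algebra_simps)
    then show ?thesis unfolding d by (simp add: eq_neg_iff_add_eq_0 mult.assoc)
  qed
  have vR: "poly HR ?s = of_real ((1 - t) * d) * e" using d vL by (simp add: algebra_simps)
  have n: "poly HL ?s \<noteq> 0" "poly HR ?s \<noteq> 0" using L R stable_nonzero by auto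
  define rL where "rL = Re (poly (pderiv HL) ?s / poly HL ?s)"
  define rR where "rR = Re (poly (pderiv HR) ?s / poly HR ?s)"
  have r: "rL > 0" "rR \<ge> 0"
    using stable_log_deriv[OF L(1), of ?s] stable_log_deriv[OF R, of ?s] L(2) by (auto simp: rL_def rR_def)
  have Im_real_i: "Im (of_real r * (\<i> * w)) = r * Re w" for r w by simp
  have 1: "Im (\<i> * poly (pderiv HL) ?s / e) = - t * d * rL"
  proof -
    have "\<i> * poly (pderiv HL) ?s / e = \<i> * (poly (pderiv HL) ?s / poly HL ?s) * (poly HL ?s / e)" using n e by simp
    also have "poly HL ?s / e = - of_real (t * d)" unfolding vL using e by simp
    finally have "\<i> * poly (pderiv HL) ?s / e = of_real (- (t * d)) * (\<i> * (poly (pderiv HL) ?s / poly HL ?s))"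
      by (simp add: mult.commute)
    then show ?thesis unfolding rL_def by (simp only: Im_real_i mult_minus_left)
  qed
  have 2: "Im (\<i> * poly (pderiv HR) ?s / e) = (1 - t) * d * rR"
  proof -
    have "\<i> * poly (pderiv HR) ?s / e = \<i> * (poly (pderiv HR) ?s / poly HR ?s) * (poly HR ?s / e)" using n e by simp
    also have "poly HR ?s / e = of_real ((1 - t) * d)" unfolding vR using e by simp
    finally have "\<i> * poly (pderiv HR) ?s / e = of_real ((1 - t) * d) * (\<i> * (poly (pderiv HR) ?s / poly HR ?s))"
      by (simp add: mult.commute)
    then show ?thesis unfolding rR_def by (simp only: Im_real_i)
  qed
  have "d \<noteq> 0" "t \<noteq> 0" using n vL by auto
  have "(1 - t) * d * rR = - t * d * rL"
    using D 1 2 by (simp add: right_diff_distrib diff_divide_distrib)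
  then have "(1 - t) * rR + t * rL = 0"
  proof -
    have "d * ((1 - t) * rR + t * rL) = 0" using \<open>(1 - t) * d * rR = - t * d * rL\<close> by (simp add: algebra_simps)
    then show ?thesis using \<open>d \<noteq> 0\<close> by simp
  qed
  moreover have "t * rL > 0" using r t \<open>t \<noteq> 0\<close> by simp
  ultimately show False using r t by (smt (verit) mult_nonneg_nonneg)
qed

section \<open>Value sets of interval polynomials\<close>

lemma sum_even_odd_split:
  fixes F :: "nat \<Rightarrow> 'a::comm_monoid_add"
  shows "(\<Sum>r\<le>m. F r) = (\<Sum>l | 2 * l \<le> m. F (2 * l)) + (\<Sum>l | 2 * l + 1 \<le> m. F (2 * l + 1))"
proof -
  have "{..m} = (*) 2 ` {l. 2 * l \<le> m} \<union> (\<lambda>l. 2 * l + 1) ` {l. 2 * l + 1 \<le> m}"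
    by (auto simp: image_iff) presburger
  moreover have "(*) 2 ` {l. 2 * l \<le> m} \<inter> (\<lambda>l. 2 * l + 1) ` {l. 2 * l + 1 \<le> m} = {}"
    by auto presburger
  moreover have "finite {l. 2 * l \<le> m}" "finite {l. 2 * l + 1 \<le> m}"
    by (rule finite_subset[of _ "{..m}"]; auto)+
  ultimately have "(\<Sum>r\<le>m. F r) = sum F ((*) 2 ` {l. 2 * l \<le> m}) + sum F ((\<lambda>l. 2 * l + 1) ` {l. 2 * l + 1 \<le> m})"
    by (simp add: sum.union_disjoint)
  then show ?thesis by (simp add: sum.reindex inj_on_def)
qed

definition even_part :: "nat \<Rightarrow> (nat \<Rightarrow> real) \<Rightarrow> real \<Rightarrow> real" where
  "even_part m a \<omega> = (\<Sum>l | 2 * l \<le> m. a (2 * l) * (- (\<omega>\<^sup>2)) ^ l)"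

definition odd_part :: "nat \<Rightarrow> (nat \<Rightarrow> real) \<Rightarrow> real \<Rightarrow> real" where
  "odd_part m a \<omega> = \<omega> * (\<Sum>l | 2 * l + 1 \<le> m. a (2 * l + 1) * (- (\<omega>\<^sup>2)) ^ l)"

lemma degree_cpoly: "degree (cpoly p) = degree p"
  by (simp add: cpoly_def degree_map_poly)

lemma poly_cpoly_sum_monom: "poly (cpoly (\<Sum>i\<le>m. monom (a i) i)) s = (\<Sum>i\<le>m. of_real (a i) * s ^ i)"
proof -
  have "cpoly (\<Sum>i\<le>m. monom (a i) i) = (\<Sum>i\<le>m. monom (of_real (a i)) i)"
    by (intro poly_eqI) (simp add: cpoly_def coeff_map_poly coeff_sum if_distrib[of of_real] cong: if_cong)
  then show ?thesis by (simp add: poly_sum poly_monom)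
qed

text \<open>Even and odd coefficients influence only the real and only the imaginary part on the imaginary
  axis; this decoupling is what makes the value set of an interval family a rectangle.\<close>

lemma poly_imaginary_axis:
  "poly (cpoly (\<Sum>i\<le>m. monom (a i) i)) (\<i> * of_real \<omega>) = Complex (even_part m a \<omega>) (odd_part m a \<omega>)"
proof -
  have sq: "(\<i> * complex_of_real \<omega>) ^ (2 * l) = of_real ((- (\<omega>\<^sup>2)) ^ l)" for l
    by (simp add: power_mult power_mult_distrib)
  then have "(\<i> * complex_of_real \<omega>) ^ (2 * l + 1) = \<i> * of_real (\<omega> * (- (\<omega>\<^sup>2)) ^ l)" for l
    by (simp add: power_add)
  with sq have "poly (cpoly (\<Sum>i\<le>m. monom (a i) i)) (\<i> * of_real \<omega>) =
     (\<Sum>l | 2 * l \<le> m. of_real (a (2 * l) * (- (\<omega>\<^sup>2)) ^ l)) +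
     (\<Sum>l | 2 * l + 1 \<le> m. \<i> * of_real (\<omega> * (a (2 * l + 1) * (- (\<omega>\<^sup>2)) ^ l)))"
    unfolding poly_cpoly_sum_monom sum_even_odd_split[of "\<lambda>i. of_real (a i) * (\<i> * of_real \<omega>) ^ i"]
    by (simp only: of_real_mult mult_ac)
  also have "\<dots> = Complex (even_part m a \<omega>) (odd_part m a \<omega>)"
    unfolding even_part_def odd_part_def sum_distrib_left
    by (simp add: complex_eq_iff Re_sum Im_sum)
  finally show ?thesis .
qed

text \<open>Coefficient \<open>r\<close> of the Kharitonov polynomial with indices \<open>i\<close> and \<open>k\<close>; the first index governs the
  even and the second the odd coefficients.\<close>

definition kharitonov_coeff :: "(nat \<Rightarrow> real) \<Rightarrow> (nat \<Rightarrow> real) \<Rightarrow> nat \<Rightarrow> nat \<Rightarrow> nat \<Rightarrow> real" where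
  "kharitonov_coeff lo hi i k r = (if ((if even r then i else k) = 1) = even (r div 2) then lo r else hi r)"

lemma kharitonov_eq: "kharitonov m lo hi i k = (\<Sum>r\<le>m. monom (kharitonov_coeff lo hi i k r) r)"
proof -
  have pc: "pcompose (monom c l) (monom 1 2) = monom c (2 * l)" for c :: real and l
  proof -
    have "pcompose (monom c l) (monom 1 2) = Polynomial.smult c (pcompose ([:0, 1:] ^ l) (monom 1 2))"
      by (metis monom_altdef pcompose_smult)
    also have "pcompose ([:0, 1:] ^ l) (monom 1 2) = (monom 1 2 :: real poly) ^ l"
      by (induction l) (simp_all add: pcompose_mult pcompose_1 pcompose_pCons)
    finally show ?thesis by (simp add: monom_power smult_monom)
  qed
  show ?thesis
    unfolding kharitonov_def kh_even_def kh_odd_def sum_even_odd_split pcompose_sum pc sum_distrib_left mult_monom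
      add.commute[of 1] mult_1
    by (simp add: kharitonov_coeff_def cong: if_cong)
qed

lemma even_part_kharitonov_coeff: "even_part m (kharitonov_coeff lo hi i k) \<omega> = even_part m (kharitonov_coeff lo hi i 1) \<omega>"
  unfolding even_part_def by (simp add: kharitonov_coeff_def)

lemma odd_part_kharitonov_coeff: "odd_part m (kharitonov_coeff lo hi i k) \<omega> = odd_part m (kharitonov_coeff lo hi 1 k) \<omega>"
  unfolding odd_part_def by (simp add: kharitonov_coeff_def)

text \<open>Multiplication with the negative number \<open>(- \<omega>\<^sup>2) ^ l\<close>, \<open>l\<close> odd, exchanges lower and upper
  bounds; this is the reason for the alternation of the bounds in the Kharitonov polynomials.\<close>

lemma alternating_power_bounds:
  assumes "lo \<le> a" "a \<le> (hi::real)"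
  shows "(if even l then lo else hi) * (- (\<omega>\<^sup>2)) ^ l \<le> a * (- (\<omega>\<^sup>2)) ^ l"
    "a * (- (\<omega>\<^sup>2)) ^ l \<le> (if even l then hi else lo) * (- (\<omega>\<^sup>2)) ^ l"
  using assms by (auto simp: power_minus[of "\<omega>\<^sup>2"] intro!: mult_right_mono)

lemma even_part_bounds:
  assumes "\<And>i. i \<le> m \<Longrightarrow> a i \<in> {lo i..hi i}"
  shows "even_part m (kharitonov_coeff lo hi 1 1) \<omega> \<le> even_part m a \<omega>"
    "even_part m a \<omega> \<le> even_part m (kharitonov_coeff lo hi 2 1) \<omega>"
proof -
  have k1: "kharitonov_coeff lo hi 1 1 (2 * l) = (if even l then lo (2 * l) else hi (2 * l))"
    and k2: "kharitonov_coeff lo hi 2 1 (2 * l) = (if even l then hi (2 * l) else lo (2 * l))" for l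
    by (simp_all add: kharitonov_coeff_def)
  have b: "lo (2 * l) \<le> a (2 * l)" "a (2 * l) \<le> hi (2 * l)" if "l \<in> {l. 2 * l \<le> m}" for l
    using assms[of "2 * l"] that by auto
  show "even_part m (kharitonov_coeff lo hi 1 1) \<omega> \<le> even_part m a \<omega>"
    unfolding even_part_def k1 by (intro sum_mono alternating_power_bounds b)
  show "even_part m a \<omega> \<le> even_part m (kharitonov_coeff lo hi 2 1) \<omega>"
    unfolding even_part_def k2 by (intro sum_mono alternating_power_bounds b)
qed

lemma odd_part_bounds:
  assumes "\<And>i. i \<le> m \<Longrightarrow> a i \<in> {lo i..hi i}" "0 \<le> \<omega>"
  shows "odd_part m (kharitonov_coeff lo hi 1 1) \<omega> \<le> odd_part m a \<omega>"
    "odd_part m a \<omega> \<le> odd_part m (kharitonov_coeff lo hi 1 2) \<omega>"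
proof -
  have k1: "kharitonov_coeff lo hi 1 1 (2 * l + 1) = (if even l then lo (2 * l + 1) else hi (2 * l + 1))"
    and k2: "kharitonov_coeff lo hi 1 2 (2 * l + 1) = (if even l then hi (2 * l + 1) else lo (2 * l + 1))" for l
    by (simp_all add: kharitonov_coeff_def)
  have b: "lo (2 * l + 1) \<le> a (2 * l + 1)" "a (2 * l + 1) \<le> hi (2 * l + 1)"
    if "l \<in> {l. 2 * l + 1 \<le> m}" for l
    using assms(1)[of "2 * l + 1"] that by auto
  show "odd_part m (kharitonov_coeff lo hi 1 1) \<omega> \<le> odd_part m a \<omega>"
    unfolding odd_part_def k1 by (intro mult_left_mono[OF _ assms(2)] sum_mono alternating_power_bounds b)
  show "odd_part m a \<omega> \<le> odd_part m (kharitonov_coeff lo hi 1 2) \<omega>"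
    unfolding odd_part_def k2 by (intro mult_left_mono[OF _ assms(2)] sum_mono alternating_power_bounds b)
qed

lemma between_convex_combination:
  fixes x y z :: real
  assumes "z \<in> {x..y}"
  shows "\<exists>t\<in>{0..1}. z = (1 - t) * x + t * y"
proof (cases "x = y")
  case True
  then show ?thesis using assms by (intro bexI[of _ 0]) auto
next
  case False
  then have "x < y" using assms by auto
  define t where "t = (z - x) / (y - x)"
  have "z = x + t * (y - x)" using \<open>x < y\<close> by (simp add: t_def)
  then show ?thesis using assms \<open>x < y\<close>
    by (intro bexI[of _ t]) (simp add: algebra_simps, simp add: t_def)
qed

text \<open>The coefficients can be interpolated with one parameter for the even and another one for the odd
  part, so no point of the rectangle is lost.\<close>

lemma interval_rectangle_attained:
  assumes le: "\<And>i. i \<le> m \<Longrightarrow> lo i \<le> hi i"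
    and u: "u \<in> {even_part m (kharitonov_coeff lo hi 1 1) \<omega>..even_part m (kharitonov_coeff lo hi 2 1) \<omega>}"
    and v: "v \<in> {odd_part m (kharitonov_coeff lo hi 1 1) \<omega>..odd_part m (kharitonov_coeff lo hi 1 2) \<omega>}"
  shows "\<exists>f \<in> interval_poly m lo hi. poly (cpoly f) (\<i> * of_real \<omega>) = Complex u v"
proof -
  obtain s where s: "s \<in> {0..1}" "u = (1 - s) * even_part m (kharitonov_coeff lo hi 1 1) \<omega> + s * even_part m (kharitonov_coeff lo hi 2 1) \<omega>"
    using between_convex_combination[OF u] by blast
  obtain t where t: "t \<in> {0..1}" "v = (1 - t) * odd_part m (kharitonov_coeff lo hi 1 1) \<omega> + t * odd_part m (kharitonov_coeff lo hi 1 2) \<omega>"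
    using between_convex_combination[OF v] by blast
  define a where "a r = (if even r then (1 - s) * kharitonov_coeff lo hi 1 1 r + s * kharitonov_coeff lo hi 2 1 r
    else (1 - t) * kharitonov_coeff lo hi 1 1 r + t * kharitonov_coeff lo hi 1 2 r)" for r
  have cvx: "(1 - q) * x + q * y \<in> {l..h}" if "q \<in> {0..1}" "x \<in> {l..h}" "y \<in> {l..h}" for q x y l h :: real
    using that convex_real_interval(5)[of l h, unfolded convex_alt] by auto
  have k: "kharitonov_coeff lo hi i k r \<in> {lo r..hi r}" if "r \<le> m" for i k r
    using le[OF that] by (auto simp: kharitonov_coeff_def)
  have "a r \<in> {lo r..hi r}" if "r \<le> m" for r
    unfolding a_def using cvx[OF s(1) k k] cvx[OF t(1) k k] that by auto
  then have "(\<Sum>i\<le>m. monom (a i) i) \<in> interval_poly m lo hi" unfolding interval_poly_def by blast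
  moreover have "even_part m a \<omega> = u"
    unfolding s(2) even_part_def sum_distrib_left sum.distrib[symmetric] by (simp add: a_def algebra_simps)
  moreover have "odd_part m a \<omega> = v"
    unfolding t(2) odd_part_def sum_distrib_left sum.distrib[symmetric] by (simp add: a_def algebra_simps)
  ultimately show ?thesis using poly_imaginary_axis by metis
qed

section \<open>The real part of an interval plant\<close>

text \<open>First-order optimality for the minimum of \<open>Re (g / f)\<close> over two rectangles. Let \<open>- \<rho>\<close> be
  the minimum, so that \<open>\<rho> = Re \<kappa>\<close>. The function \<open>Re (g cnj f) + \<rho> |f|\<^sup>2\<close> is nonnegative on the
  product of the rectangles and zero at the minimum, and it is a polynomial of degree at most two in each
  coordinate. Its partial derivatives there are \<open>u\<close> and \<open>v\<close> with respect to \<open>g\<close>, and the real and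
  imaginary part of \<open>cnj \<kappa> f\<close> with respect to \<open>f\<close>.\<close>

lemma rectangle_quotient_minimum:
  fixes x1 x2 y1 y2 u1 u2 v1 v2 :: real
  assumes nz: "\<forall>u\<in>{u1..u2}. \<forall>v\<in>{v1..v2}. Complex u v \<noteq> 0"
    and pt: "x0 \<in> {x1..x2}" "y0 \<in> {y1..y2}" "u0 \<in> {u1..u2}" "v0 \<in> {v1..v2}"
    and neg: "Re (Complex x0 y0 / Complex u0 v0) < 0"
  obtains x y u v \<kappa> where
    "x \<in> {x1..x2}" "y \<in> {y1..y2}" "u \<in> {u1..u2}" "v \<in> {v1..v2}"
    "Complex x y + \<kappa> * Complex u v = 0"
    "- Re (Complex x0 y0 / Complex u0 v0) \<le> Re \<kappa>"
    "0 < u \<longrightarrow> x = x1" "u < 0 \<longrightarrow> x = x2" "0 < v \<longrightarrow> y = y1" "v < 0 \<longrightarrow> y = y2"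
    "0 < Re \<kappa> * u + Im \<kappa> * v \<longrightarrow> u = u1" "Re \<kappa> * u + Im \<kappa> * v < 0 \<longrightarrow> u = u2"
    "0 < Re \<kappa> * v - Im \<kappa> * u \<longrightarrow> v = v1" "Re \<kappa> * v - Im \<kappa> * u < 0 \<longrightarrow> v = v2"
proof -
  define h where "h = (\<lambda>(x, y, u, v). (x * u + y * v) / (u\<^sup>2 + v\<^sup>2) :: real)"
  define K where "K = {x1..x2} \<times> {y1..y2} \<times> {u1..u2} \<times> {v1..v2}"
  have nz': "u\<^sup>2 + v\<^sup>2 > 0" if "u \<in> {u1..u2}" "v \<in> {v1..v2}" for u v
    using nz that by (metis complex.sel complex_neq_0)
  have hRe: "Re (Complex x y / Complex u v) = h (x, y, u, v)" for x y u v
    by (simp add: h_def Re_divide)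
  have "continuous_on K h" unfolding h_def case_prod_unfold
    by (intro continuous_intros) (use nz' in \<open>fastforce simp: K_def\<close>)
  moreover have "compact K" unfolding K_def by (intro compact_Times compact_Icc)
  moreover have "(x0, y0, u0, v0) \<in> K" using pt by (simp add: K_def)
  ultimately obtain p where p: "p \<in> K" "\<And>q. q \<in> K \<Longrightarrow> h p \<le> h q"
    using continuous_attains_inf[of K h] by blast
  obtain x y u v where pe: "p = (x, y, u, v)" by (cases p)
  have mem: "x \<in> {x1..x2}" "y \<in> {y1..y2}" "u \<in> {u1..u2}" "v \<in> {v1..v2}"
    using p(1) by (auto simp: pe K_def)
  define \<kappa> where "\<kappa> = - (Complex x y / Complex u v)"
  define \<rho> where "\<rho> = Re \<kappa>"
  define \<alpha> where "\<alpha> = Im \<kappa>"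
  have zero: "Complex x y + \<kappa> * Complex u v = 0" using nz mem by (simp add: \<kappa>_def)
  have xy: "x = \<alpha> * v - \<rho> * u" "y = - (\<rho> * v) - \<alpha> * u"
    using zero by (auto simp: complex_eq_iff \<rho>_def \<alpha>_def)
  have h\<rho>: "h p = - \<rho>" unfolding pe hRe[symmetric] \<rho>_def \<kappa>_def by simp
  have \<rho>: "- Re (Complex x0 y0 / Complex u0 v0) \<le> \<rho>"
    using p(2)[of "(x0, y0, u0, v0)"] pt h\<rho> unfolding hRe by (simp add: K_def)
  then have \<rho>0: "\<rho> > 0" using neg by simp
  have opt: "0 \<le> x' * u' + y' * v' + \<rho> * (u'\<^sup>2 + v'\<^sup>2)"
    if "x' \<in> {x1..x2}" "y' \<in> {y1..y2}" "u' \<in> {u1..u2}" "v' \<in> {v1..v2}" for x' y' u' v'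
  proof -
    have "- \<rho> \<le> (x' * u' + y' * v') / (u'\<^sup>2 + v'\<^sup>2)"
      using p(2)[of "(x', y', u', v')"] that h\<rho> by (simp add: K_def h_def)
    then show ?thesis using nz'[OF that(3,4)] by (simp add: field_simps)
  qed
  have gx: "0 \<le> (x' - x) * u" if "x' \<in> {x1..x2}" for x'
    using opt[OF that mem(2-4)] unfolding xy by (simp add: algebra_simps power2_eq_square)
  have gy: "0 \<le> (y' - y) * v" if "y' \<in> {y1..y2}" for y'
    using opt[OF mem(1) that mem(3-4)] unfolding xy by (simp add: algebra_simps power2_eq_square)
  have gu: "0 \<le> (u' - u) * ((\<rho> * u + \<alpha> * v) + \<rho> * (u' - u))" if "u' \<in> {u1..u2}" for u'
    using opt[OF mem(1,2) that mem(4)] unfolding xy by (simp add: algebra_simps power2_eq_square)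
  have gv: "0 \<le> (v' - v) * ((\<rho> * v - \<alpha> * u) + \<rho> * (v' - v))" if "v' \<in> {v1..v2}" for v'
    using opt[OF mem(1-3) that] unfolding xy by (simp add: algebra_simps power2_eq_square)
  \<comment> \<open>\<open>D\<close> is the derivative at \<open>w\<close>; a step of length at most \<open>|D| / (2 \<rho>)\<close> keeps it dominant\<close>
  have first: "(0 < D \<longrightarrow> w = w1) \<and> (D < 0 \<longrightarrow> w = w2)"
    if w: "w \<in> {w1..w2}" and D: "\<And>w'. w' \<in> {w1..w2} \<Longrightarrow> 0 \<le> (w' - w) * (D + \<rho> * (w' - w))" for w w1 w2 D
  proof (intro conjI impI; rule ccontr)
    assume "0 < D" "w \<noteq> w1"
    define \<delta> where "\<delta> = min (w - w1) (D / (2 * \<rho>))"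
    have \<delta>: "\<delta> > 0" "\<delta> \<le> w - w1" "\<delta> \<le> D / (2 * \<rho>)"
      using w \<open>0 < D\<close> \<open>w \<noteq> w1\<close> \<rho>0 by (auto simp: \<delta>_def)
    have "0 \<le> (- \<delta>) * (D - \<rho> * \<delta>)" using D[of "w - \<delta>"] \<delta> w by simp
    moreover have "\<rho> * \<delta> \<le> D / 2" using \<delta>(3) \<rho>0 by (simp add: field_simps)
    ultimately show False using \<delta>(1) \<open>0 < D\<close> by (smt (verit) mult_minus_left mult_pos_pos field_sum_of_halves)
  next
    assume "D < 0" "w \<noteq> w2"
    define \<delta> where "\<delta> = min (w2 - w) (- D / (2 * \<rho>))"
    have \<delta>: "\<delta> > 0" "\<delta> \<le> w2 - w" "\<delta> \<le> - D / (2 * \<rho>)"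
      using w \<open>D < 0\<close> \<open>w \<noteq> w2\<close> \<rho>0 by (auto simp: \<delta>_def divide_neg_pos)
    have "0 \<le> \<delta> * (D + \<rho> * \<delta>)" using D[of "w + \<delta>"] \<delta> w by simp
    moreover have "\<rho> * \<delta> \<le> - D / 2" using \<delta>(3) \<rho>0 by (simp add: field_simps)
    ultimately show False using \<delta>(1) \<open>D < 0\<close> by (smt (verit) mult_pos_neg field_sum_of_halves)
  qed
  have fx: "(0 < u \<longrightarrow> x = x1) \<and> (u < 0 \<longrightarrow> x = x2)"
    using gx[of x1] gx[of x2] mem(1) by (auto simp: zero_le_mult_iff)
  have fy: "(0 < v \<longrightarrow> y = y1) \<and> (v < 0 \<longrightarrow> y = y2)"
    using gy[of y1] gy[of y2] mem(2) by (auto simp: zero_le_mult_iff)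
  from first[OF mem(3) gu] first[OF mem(4) gv] fx fy \<rho> mem zero show ?thesis
    by (intro that[of x y u v \<kappa>]) (auto simp: \<rho>_def \<alpha>_def)
qed

text \<open>The twelve vertex plants suffice: a value below their common bound would give a vertex or an edge of
  the family \<open>g + \<kappa> f\<close>, for a suitable constant \<open>\<kappa>\<close>, that passes through \<open>0\<close>.\<close>

theorem interval_plant_real_part_bound:
  assumes mn: "m \<le> n"
    and a: "\<And>i. i \<le> m \<Longrightarrow> a_lo i \<le> a_hi i"
    and b: "\<And>i. i \<le> n \<Longrightarrow> b_lo i \<le> b_hi i"
    and b0: "0 \<notin> {b_lo n..b_hi n}"
    and hurwitz: "\<And>f. f \<in> interval_poly n b_lo b_hi \<Longrightarrow> hurwitz_stable f"
    and g: "g \<in> interval_poly m a_lo a_hi" and f: "f \<in> interval_poly n b_lo b_hi"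
  shows "min (gamma0 m a_lo a_hi n b_lo b_hi) 0
    \<le> Re (poly (cpoly g) (\<i> * of_real \<omega>) / poly (cpoly f) (\<i> * of_real \<omega>))"
proof (rule ccontr)
  define \<gamma> where "\<gamma> = gamma0 m a_lo a_hi n b_lo b_hi"
  define G where "G i j = cpoly (kharitonov m a_lo a_hi i j)" for i j
  define F where "F i j = cpoly (kharitonov n b_lo b_hi i j)" for i j
  define ge where "ge i = even_part m (kharitonov_coeff a_lo a_hi i 1)" for i
  define go where "go j = odd_part m (kharitonov_coeff a_lo a_hi 1 j)" for j
  define fe where "fe i = even_part n (kharitonov_coeff b_lo b_hi i 1)" for i
  define fo where "fo j = odd_part n (kharitonov_coeff b_lo b_hi 1 j)" for j
  have G: "poly (G i j) (\<i> * of_real w) = Complex (ge i w) (go j w)" for i j w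
    unfolding G_def kharitonov_eq poly_imaginary_axis ge_def go_def
    by (metis even_part_kharitonov_coeff odd_part_kharitonov_coeff)
  have F: "poly (F i j) (\<i> * of_real w) = Complex (fe i w) (fo j w)" for i j w
    unfolding F_def kharitonov_eq poly_imaginary_axis fe_def fo_def
    by (metis even_part_kharitonov_coeff odd_part_kharitonov_coeff)
  have degG: "degree (G i j) \<le> m" for i j
    unfolding G_def kharitonov_eq degree_cpoly
    by (intro degree_sum_le) (auto intro: order.trans[OF degree_monom_le])
  have kF: "kharitonov n b_lo b_hi i j \<in> interval_poly n b_lo b_hi" for i j
    unfolding kharitonov_eq interval_poly_def using b by (auto simp: kharitonov_coeff_def)
  have stF: "stable (F i j)" for i j
    using hurwitz[OF kF] unfolding hurwitz_stable_def stable_def F_def .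
  have degF: "degree (F i j) = n" for i j
  proof (rule antisym)
    show "degree (F i j) \<le> n"
      unfolding F_def kharitonov_eq degree_cpoly
      by (intro degree_sum_le) (auto intro: order.trans[OF degree_monom_le])
    have "coeff (F i j) n = of_real (kharitonov_coeff b_lo b_hi i j n)"
      unfolding F_def kharitonov_eq cpoly_def by (simp add: coeff_map_poly coeff_sum)
    moreover have "kharitonov_coeff b_lo b_hi i j n \<noteq> 0" using b0 b[of n] by (auto simp: kharitonov_coeff_def)
    ultimately show "n \<le> degree (F i j)" by (intro le_degree) simp
  qed
  \<comment> \<open>boundedness of the quotient makes the real infimum in \<open>gamma0\<close> an actual lower bound\<close>
  have vertex: "\<gamma> \<le> Re (poly (G i1 j1) (\<i> * of_real w) / poly (F i2 j2) (\<i> * of_real w))"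
    if I3: "(i1, j1, i2, j2) \<in> I3" for i1 j1 i2 j2 w
  proof -
    obtain K where K: "\<And>s. 0 \<le> Re s \<Longrightarrow> cmod (poly (G i1 j1) s / poly (F i2 j2) s) \<le> K"
      using stable_quotient_bounded[OF stF[of i2 j2], of "G i1 j1"] degG[of i1 j1] mn degF by auto
    have "bdd_below (range (\<lambda>w::real. Re (poly (G i1 j1) (\<i> * of_real w) / poly (F i2 j2) (\<i> * of_real w))))"
    proof (rule bdd_belowI2[of _ "- K"])
      fix w :: real
      show "- K \<le> Re (poly (G i1 j1) (\<i> * of_real w) / poly (F i2 j2) (\<i> * of_real w))"
        using K[of "\<i> * of_real w"] abs_Re_le_cmod[of "poly (G i1 j1) (\<i> * of_real w) / poly (F i2 j2) (\<i> * of_real w)"]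
        by (simp del: Re_divide)
    qed
    then have "(INF w::real. Re (poly (G i1 j1) (\<i> * of_real w) / poly (F i2 j2) (\<i> * of_real w)))
      \<le> Re (poly (G i1 j1) (\<i> * of_real w) / poly (F i2 j2) (\<i> * of_real w))"
      by (rule cINF_lower) simp
    moreover have "\<gamma> \<le> (INF w::real. Re (poly (G i1 j1) (\<i> * of_real w) / poly (F i2 j2) (\<i> * of_real w)))"
      unfolding \<gamma>_def gamma0_def G_def F_def
      by (rule Min_le) (use I3 in \<open>force simp: I3_def\<close>)+
    ultimately show ?thesis by linarith
  qed
  assume "\<not> ?thesis"
  then have bad0: "Re (poly (cpoly g) (\<i> * of_real \<omega>) / poly (cpoly f) (\<i> * of_real \<omega>)) < min \<gamma> 0"
    by (simp only: \<gamma>_def not_le)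
  obtain ca where ca: "g = (\<Sum>i\<le>m. monom (ca i) i)" "\<And>i. i \<le> m \<Longrightarrow> ca i \<in> {a_lo i..a_hi i}"
    using g unfolding interval_poly_def by blast
  obtain cb where cb: "f = (\<Sum>i\<le>n. monom (cb i) i)" "\<And>i. i \<le> n \<Longrightarrow> cb i \<in> {b_lo i..b_hi i}"
    using f unfolding interval_poly_def by blast
  \<comment> \<open>the order of the corners on the imaginary side is right only for \<open>\<omega> \<ge> 0\<close>; negative frequencies
    give conjugate values with the same real part\<close>
  define w where "w = \<bar>\<omega>\<bar>"
  have w: "w \<ge> 0" by (simp add: w_def)
  have bad: "Re (Complex (even_part m ca w) (odd_part m ca w) / Complex (even_part n cb w) (odd_part n cb w)) < min \<gamma> 0"
  proof -
    have "even_part m c (- \<omega>) = even_part m c \<omega>" "odd_part m c (- \<omega>) = - odd_part m c \<omega>" for m c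
      by (simp_all add: even_part_def odd_part_def)
    then show ?thesis using bad0 unfolding ca(1) cb(1) poly_imaginary_axis w_def
      by (cases "\<omega> \<ge> 0") (auto simp: Re_divide)
  qed
  have nz: "Complex u v \<noteq> 0" if uv: "u \<in> {fe 1 w..fe 2 w}" "v \<in> {fo 1 w..fo 2 w}" for u v
  proof -
    obtain f' where f': "f' \<in> interval_poly n b_lo b_hi" "poly (cpoly f') (\<i> * of_real w) = Complex u v"
      using interval_rectangle_attained[of n b_lo b_hi, OF b] uv unfolding fe_def fo_def by blast
    have "stable (cpoly f')" using hurwitz[OF f'(1)] by (simp add: hurwitz_stable_def stable_def)
    then show "Complex u v \<noteq> 0" using stable_nonzero[of "cpoly f'" "\<i> * of_real w"] f'(2) by simp
  qed
  have mem: "even_part m ca w \<in> {ge 1 w..ge 2 w}" "even_part n cb w \<in> {fe 1 w..fe 2 w}"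
    "odd_part m ca w \<in> {go 1 w..go 2 w}" "odd_part n cb w \<in> {fo 1 w..fo 2 w}"
    unfolding ge_def fe_def go_def fo_def atLeastAtMost_iff
    by (intro conjI even_part_bounds odd_part_bounds ca(2) cb(2) w; assumption)+
  have nz': "\<forall>u\<in>{fe 1 w..fe 2 w}. \<forall>v\<in>{fo 1 w..fo 2 w}. Complex u v \<noteq> 0" using nz by blast
  have bad': "Re (Complex (even_part m ca w) (odd_part m ca w) / Complex (even_part n cb w) (odd_part n cb w)) < 0"
    using bad by (simp del: Re_divide)
  obtain x y u v \<kappa> where
    rng: "x \<in> {ge 1 w..ge 2 w}" "y \<in> {go 1 w..go 2 w}" "u \<in> {fe 1 w..fe 2 w}" "v \<in> {fo 1 w..fo 2 w}" and
    zero: "Complex x y + \<kappa> * Complex u v = 0" and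
    \<kappa>: "- Re (Complex (even_part m ca w) (odd_part m ca w) / Complex (even_part n cb w) (odd_part n cb w)) \<le> Re \<kappa>" and
    x: "0 < u \<longrightarrow> x = ge 1 w" "u < 0 \<longrightarrow> x = ge 2 w" and
    y: "0 < v \<longrightarrow> y = go 1 w" "v < 0 \<longrightarrow> y = go 2 w" and
    u: "0 < Re \<kappa> * u + Im \<kappa> * v \<longrightarrow> u = fe 1 w" "Re \<kappa> * u + Im \<kappa> * v < 0 \<longrightarrow> u = fe 2 w" and
    v: "0 < Re \<kappa> * v - Im \<kappa> * u \<longrightarrow> v = fo 1 w" "Re \<kappa> * v - Im \<kappa> * u < 0 \<longrightarrow> v = fo 2 w"
    by (rule rectangle_quotient_minimum[OF nz' mem(1) mem(3) mem(2) mem(4) bad'])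
  define \<epsilon> where "\<epsilon> = Re \<kappa> + \<gamma>"
  have \<epsilon>: "\<epsilon> > 0" and \<kappa>0: "Re \<kappa> > 0" using bad \<kappa> by (auto simp: \<epsilon>_def simp del: Re_divide)
  define H where "H i1 j1 i2 j2 = G i1 j1 + Polynomial.smult \<kappa> (F i2 j2)" for i1 j1 i2 j2
  have H: "poly (H i1 j1 i2 j2) (\<i> * of_real w) = Complex (ge i1 w) (go j1 w) + \<kappa> * Complex (fe i2 w) (fo j2 w)"
    for i1 j1 i2 j2 w by (simp add: H_def G F)
  have H_stable: "stable (H i1 j1 i2 j2)" "degree (H i1 j1 i2 j2) = n"
    if I3: "(i1, j1, i2, j2) \<in> I3" for i1 j1 i2 j2
  proof -
    have "degree (H i1 j1 i2 j2) \<le> degree (F i2 j2)"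
      unfolding H_def using degG[of i1 j1] mn degF[of i2 j2]
      by (intro degree_add_le) (auto intro: order.trans[OF degree_smult_le])
    moreover have "\<epsilon> \<le> Re (poly (H i1 j1 i2 j2) (\<i> * of_real w) / poly (F i2 j2) (\<i> * of_real w))" for w
    proof -
      have "poly (F i2 j2) (\<i> * of_real w) \<noteq> 0" using stable_nonzero[OF stF] by simp
      then have "poly (H i1 j1 i2 j2) (\<i> * of_real w) / poly (F i2 j2) (\<i> * of_real w)
        = poly (G i1 j1) (\<i> * of_real w) / poly (F i2 j2) (\<i> * of_real w) + \<kappa>"
        by (simp add: H_def field_simps)
      then show ?thesis using vertex[OF I3, of w] by (simp add: \<epsilon>_def del: Re_divide)
    qed
    ultimately show "stable (H i1 j1 i2 j2)" "degree (H i1 j1 i2 j2) = n"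
      using stable_of_positive_real_quotient[OF stF _ \<epsilon>] degF by metis+
  qed
  have no_vertex: False
    if "(i1, j1, i2, j2) \<in> I3" "x = ge i1 w" "y = go j1 w" "u = fe i2 w" "v = fo j2 w" for i1 j1 i2 j2
    using stable_nonzero[OF H_stable(1)[OF that(1)], of "\<i> * of_real w"] zero unfolding H that(2-5) by simp
  have no_edge: False
    if "0 < n" "(i1, j1, i2, j2) \<in> I3" "(i1', j1', i2', j2') \<in> I3" "e \<noteq> 0" "t \<in> {0..1}"
      and dir: "\<And>w. Im ((Complex (ge i1' w - ge i1 w) (go j1' w - go j1 w)
        + \<kappa> * Complex (fe i2' w - fe i2 w) (fo j2' w - fo j2 w)) / e) = 0"
      and seg: "x + Re \<kappa> * u - Im \<kappa> * v = (1 - t) * (ge i1 w + Re \<kappa> * fe i2 w - Im \<kappa> * fo j2 w)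
          + t * (ge i1' w + Re \<kappa> * fe i2' w - Im \<kappa> * fo j2' w)"
        "y + Re \<kappa> * v + Im \<kappa> * u = (1 - t) * (go j1 w + Re \<kappa> * fo j2 w + Im \<kappa> * fe i2 w)
          + t * (go j1' w + Re \<kappa> * fo j2' w + Im \<kappa> * fe i2' w)"
    for i1 j1 i2 j2 i1' j1' i2' j2' e t
  proof -
    have "(1 - of_real t) * poly (H i1 j1 i2 j2) (\<i> * of_real w) + of_real t * poly (H i1' j1' i2' j2') (\<i> * of_real w)
      = Complex x y + \<kappa> * Complex u v"
      unfolding H complex_eq_iff using seg by (simp add: algebra_simps)
    moreover have "(1 - of_real t) * poly (H i1 j1 i2 j2) (\<i> * of_real w) + of_real t * poly (H i1' j1' i2' j2') (\<i> * of_real w) \<noteq> 0"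
    proof (rule stable_edge_excludes_zero[OF _ _ _ that(4)])
      show "stable (H i1 j1 i2 j2)" "0 < degree (H i1 j1 i2 j2)" "stable (H i1' j1' i2' j2')"
        using H_stable that by auto
      show "0 \<le> t" "t \<le> 1" using that by auto
      fix w
      have "poly (H i1' j1' i2' j2') (\<i> * of_real w) - poly (H i1 j1 i2 j2) (\<i> * of_real w)
        = Complex (ge i1' w - ge i1 w) (go j1' w - go j1 w)
        + \<kappa> * Complex (fe i2' w - fe i2 w) (fo j2' w - fo j2 w)"
        unfolding H by (simp add: complex_eq_iff algebra_simps)
      then show "Im ((poly (H i1' j1' i2' j2') (\<i> * of_real w) - poly (H i1 j1 i2 j2) (\<i> * of_real w)) / e) = 0"
        using dir by simp
    qed
    ultimately show False using zero by simp
  qed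
  \<comment> \<open>\<open>P + i Q = cnj \<kappa> (u + i v)\<close>, whose signs decide the corner of the denominator\<close>
  define P where "P = Re \<kappa> * u + Im \<kappa> * v"
  define Q where "Q = Re \<kappa> * v - Im \<kappa> * u"
  have \<kappa>ne: "\<kappa> \<noteq> 0" using \<kappa>0 by auto
  have "0 < Re \<kappa> * (u\<^sup>2 + v\<^sup>2)"
    using nz[OF rng(3,4)] \<kappa>0 by (simp add: complex_neq_0)
  also have "\<dots> = u * P + v * Q" by (simp add: P_def Q_def algebra_simps power2_eq_square)
  finally have "0 < u * P \<or> 0 < v * Q" by linarith
  then show False
  proof
    assume uP: "0 < u * P"
    define i :: nat where "i = (if 0 < u then 1 else 2)"
    have "0 < u \<and> 0 < P \<or> u < 0 \<and> P < 0" using uP by (simp only: zero_less_mult_iff)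
    then have xi: "x = ge i w" and ui: "u = fe i w"
      using x u unfolding i_def P_def[symmetric] by (elim disjE conjE; simp)+
    have i12: "i = 1 \<or> i = 2" by (simp add: i_def)
    \<comment> \<open>numerator and denominator have the common even index \<open>i\<close>; the odd indices are arbitrary\<close>
    have inI3: "(i, jg, i, jf) \<in> I3" if "jg \<in> {1, 2}" "jf \<in> {1, 2}" for jg jf
      using that i12 by (auto simp: I3_def)
    define jg :: nat where "jg = (if 0 < v then 1 else 2)"
    define jf :: nat where "jf = (if 0 < Q then 1 else 2)"
    have j12: "jg \<in> {1, 2}" "jf \<in> {1, 2}" by (simp_all add: jg_def jf_def)
    have yj: "v \<noteq> 0 \<Longrightarrow> y = go jg w" and vj: "Q \<noteq> 0 \<Longrightarrow> v = fo jf w"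
      using y v unfolding jg_def jf_def Q_def by auto
    \<comment> \<open>for \<open>n = 0\<close> there are no odd parts and the rectangles are segments; otherwise the odd
      coordinate of \<open>f\<close> is free if \<open>Q = 0\<close>, giving an edge in direction \<open>i \<kappa>\<close>, and that of \<open>g\<close> is free if
      \<open>v = 0\<close>, giving an edge in direction \<open>i\<close>\<close>
    consider "n = 0" | "0 < n" "v \<noteq> 0" "Q \<noteq> 0" | "0 < n" "v \<noteq> 0" "Q = 0" | "0 < n" "v = 0" "Q \<noteq> 0" | "0 < n" "v = 0" "Q = 0"
      by blast
    then show False
    proof cases
      case 1
      then have "go j w = 0" "fo j w = 0" for j using mn by (simp_all add: go_def fo_def odd_part_def)
      then show False using no_vertex[OF inI3[of 1 1]] xi ui rng by simp
    next
      case 2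
      then show False using no_vertex[OF inI3[OF j12]] xi ui yj vj by blast
    next
      case 3
      obtain t where t: "t \<in> {0..1}" "v = (1 - t) * fo 1 w + t * fo 2 w"
        using between_convex_combination[OF rng(4)] by blast
      show False
      proof (rule no_edge[OF \<open>0 < n\<close> inI3[OF j12(1), of 1] inI3[OF j12(1), of 2] _ t(1), of "\<i> * \<kappa>"])
        show "Im ((Complex (ge i w - ge i w) (go jg w - go jg w) + \<kappa> * Complex (fe i w - fe i w) (fo 2 w - fo 1 w)) / (\<i> * \<kappa>)) = 0" for w
          using \<kappa>ne by (simp add: Complex_eq)
        show "x + Re \<kappa> * u - Im \<kappa> * v = (1 - t) * (ge i w + Re \<kappa> * fe i w - Im \<kappa> * fo 1 w)
          + t * (ge i w + Re \<kappa> * fe i w - Im \<kappa> * fo 2 w)"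
          by (simp only: xi ui t(2)) (simp add: algebra_simps)
        show "y + Re \<kappa> * v + Im \<kappa> * u = (1 - t) * (go jg w + Re \<kappa> * fo 1 w + Im \<kappa> * fe i w)
          + t * (go jg w + Re \<kappa> * fo 2 w + Im \<kappa> * fe i w)"
          by (simp only: yj[OF 3(2)] ui t(2)) (simp add: algebra_simps)
      qed (use \<kappa>ne in auto)
    next
      case 4
      obtain t where t: "t \<in> {0..1}" "y = (1 - t) * go 1 w + t * go 2 w"
        using between_convex_combination[OF rng(2)] by blast
      show False
      proof (rule no_edge[OF \<open>0 < n\<close> inI3[OF _ j12(2), of 1] inI3[OF _ j12(2), of 2] _ t(1), of "\<i>"])
        show "Im ((Complex (ge i w - ge i w) (go 2 w - go 1 w) + \<kappa> * Complex (fe i w - fe i w) (fo jf w - fo jf w)) / \<i>) = 0" for w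
          by (simp add: Complex_eq)
        show "x + Re \<kappa> * u - Im \<kappa> * v = (1 - t) * (ge i w + Re \<kappa> * fe i w - Im \<kappa> * fo jf w)
          + t * (ge i w + Re \<kappa> * fe i w - Im \<kappa> * fo jf w)"
          using xi ui vj[OF 4(3)] by (simp add: algebra_simps)
        show "y + Re \<kappa> * v + Im \<kappa> * u = (1 - t) * (go 1 w + Re \<kappa> * fo jf w + Im \<kappa> * fe i w)
          + t * (go 2 w + Re \<kappa> * fo jf w + Im \<kappa> * fe i w)"
          using vj[OF 4(3)] ui t(2) by (simp add: algebra_simps)
      qed auto
    next
      case 5
      \<comment> \<open>with both odd coordinates free, \<open>\<kappa>\<close> is real, so the two edges are parallel and combine to the
        edge between the corners that are both lowest and both highest\<close>
      have im: "Im \<kappa> = 0" using 5 uP by (auto simp: Q_def)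
      have "y + Re \<kappa> * v \<in> {go 1 w + Re \<kappa> * fo 1 w..go 2 w + Re \<kappa> * fo 2 w}"
        using rng \<kappa>0 by (auto intro!: add_mono mult_left_mono)
      then obtain t where t: "t \<in> {0..1}"
        "y + Re \<kappa> * v = (1 - t) * (go 1 w + Re \<kappa> * fo 1 w) + t * (go 2 w + Re \<kappa> * fo 2 w)"
        using between_convex_combination by blast
      show False
      proof (rule no_edge[OF \<open>0 < n\<close> inI3[of 1 1] inI3[of 2 2] _ t(1), of "\<i>"])
        show "Im ((Complex (ge i w - ge i w) (go 2 w - go 1 w) + \<kappa> * Complex (fe i w - fe i w) (fo 2 w - fo 1 w)) / \<i>) = 0" for w
          using im by (simp add: Complex_eq)
        show "x + Re \<kappa> * u - Im \<kappa> * v = (1 - t) * (ge i w + Re \<kappa> * fe i w - Im \<kappa> * fo 1 w)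
          + t * (ge i w + Re \<kappa> * fe i w - Im \<kappa> * fo 2 w)"
          using xi ui im by (simp add: algebra_simps)
        show "y + Re \<kappa> * v + Im \<kappa> * u = (1 - t) * (go 1 w + Re \<kappa> * fo 1 w + Im \<kappa> * fe i w)
          + t * (go 2 w + Re \<kappa> * fo 2 w + Im \<kappa> * fe i w)"
          using im t(2) by (simp add: algebra_simps)
      qed auto
    qed
  next
    assume vQ: "0 < v * Q"
    define j :: nat where "j = (if 0 < v then 1 else 2)"
    have "0 < v \<and> 0 < Q \<or> v < 0 \<and> Q < 0" using vQ by (simp only: zero_less_mult_iff)
    then have yj: "y = go j w" and vj: "v = fo j w"
      using y v unfolding j_def Q_def[symmetric] by (elim disjE conjE; simp)+
    have j12: "j = 1 \<or> j = 2" by (simp add: j_def)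
    \<comment> \<open>numerator and denominator have the common odd index \<open>j\<close>; the even indices are arbitrary\<close>
    have inI3: "(ig, j, if', j) \<in> I3" if "ig \<in> {1, 2}" "if' \<in> {1, 2}" for ig if'
      using that j12 by (auto simp: I3_def)
    define ig :: nat where "ig = (if 0 < u then 1 else 2)"
    define if' :: nat where "if' = (if 0 < P then 1 else 2)"
    have i12: "ig \<in> {1, 2}" "if' \<in> {1, 2}" by (simp_all add: ig_def if'_def)
    have xi: "u \<noteq> 0 \<Longrightarrow> x = ge ig w" and ui: "P \<noteq> 0 \<Longrightarrow> u = fe if' w"
      using x u unfolding ig_def if'_def P_def by auto
    have "0 < n"
    proof (rule ccontr)
      assume "\<not> 0 < n"
      then have "fo j w = 0" for j by (simp add: fo_def odd_part_def)
      then show False using vj vQ by simp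
    qed
    \<comment> \<open>the same cases with even and odd coordinates exchanged; the edge directions are \<open>\<kappa>\<close> and \<open>1\<close>\<close>
    consider "u \<noteq> 0" "P \<noteq> 0" | "u \<noteq> 0" "P = 0" | "u = 0" "P \<noteq> 0" | "u = 0" "P = 0"
      by blast
    then show False
    proof cases
      case 1
      then show False using no_vertex[OF inI3[OF i12]] xi ui yj vj by blast
    next
      case 2
      obtain t where t: "t \<in> {0..1}" "u = (1 - t) * fe 1 w + t * fe 2 w"
        using between_convex_combination[OF rng(3)] by blast
      show False
      proof (rule no_edge[OF \<open>0 < n\<close> inI3[OF i12(1), of 1] inI3[OF i12(1), of 2] \<kappa>ne t(1)])
        show "Im ((Complex (ge ig w - ge ig w) (go j w - go j w) + \<kappa> * Complex (fe 2 w - fe 1 w) (fo j w - fo j w)) / \<kappa>) = 0" for w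
          using \<kappa>ne by (simp add: Complex_eq)
        show "x + Re \<kappa> * u - Im \<kappa> * v = (1 - t) * (ge ig w + Re \<kappa> * fe 1 w - Im \<kappa> * fo j w)
          + t * (ge ig w + Re \<kappa> * fe 2 w - Im \<kappa> * fo j w)"
          by (simp only: xi[OF 2(1)] vj t(2)) (simp add: algebra_simps)
        show "y + Re \<kappa> * v + Im \<kappa> * u = (1 - t) * (go j w + Re \<kappa> * fo j w + Im \<kappa> * fe 1 w)
          + t * (go j w + Re \<kappa> * fo j w + Im \<kappa> * fe 2 w)"
          by (simp only: yj vj t(2)) (simp add: algebra_simps)
      qed auto
    next
      case 3
      obtain t where t: "t \<in> {0..1}" "x = (1 - t) * ge 1 w + t * ge 2 w"
        using between_convex_combination[OF rng(1)] by blast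
      show False
      proof (rule no_edge[OF \<open>0 < n\<close> inI3[OF _ i12(2), of 1] inI3[OF _ i12(2), of 2] _ t(1), of 1])
        show "Im ((Complex (ge 2 w - ge 1 w) (go j w - go j w) + \<kappa> * Complex (fe if' w - fe if' w) (fo j w - fo j w)) / 1) = 0" for w
          by (simp add: Complex_eq)
        show "x + Re \<kappa> * u - Im \<kappa> * v = (1 - t) * (ge 1 w + Re \<kappa> * fe if' w - Im \<kappa> * fo j w)
          + t * (ge 2 w + Re \<kappa> * fe if' w - Im \<kappa> * fo j w)"
          using t(2) vj ui[OF 3(2)] by (simp add: algebra_simps)
        show "y + Re \<kappa> * v + Im \<kappa> * u = (1 - t) * (go j w + Re \<kappa> * fo j w + Im \<kappa> * fe if' w)
          + t * (go j w + Re \<kappa> * fo j w + Im \<kappa> * fe if' w)"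
          using yj vj ui[OF 3(2)] by (simp add: algebra_simps)
      qed auto
    next
      case 4
      have im: "Im \<kappa> = 0" using 4 vQ by (auto simp: P_def)
      have "x + Re \<kappa> * u \<in> {ge 1 w + Re \<kappa> * fe 1 w..ge 2 w + Re \<kappa> * fe 2 w}"
        using rng \<kappa>0 by (auto intro!: add_mono mult_left_mono)
      then obtain t where t: "t \<in> {0..1}"
        "x + Re \<kappa> * u = (1 - t) * (ge 1 w + Re \<kappa> * fe 1 w) + t * (ge 2 w + Re \<kappa> * fe 2 w)"
        using between_convex_combination by blast
      show False
      proof (rule no_edge[OF \<open>0 < n\<close> inI3[of 1 1] inI3[of 2 2] _ t(1), of 1])
        show "Im ((Complex (ge 2 w - ge 1 w) (go j w - go j w) + \<kappa> * Complex (fe 2 w - fe 1 w) (fo j w - fo j w)) / 1) = 0" for w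
          using im by (simp add: Complex_eq)
        show "x + Re \<kappa> * u - Im \<kappa> * v = (1 - t) * (ge 1 w + Re \<kappa> * fe 1 w - Im \<kappa> * fo j w)
          + t * (ge 2 w + Re \<kappa> * fe 2 w - Im \<kappa> * fo j w)"
          using t(2) im by (simp add: algebra_simps)
        show "y + Re \<kappa> * v + Im \<kappa> * u = (1 - t) * (go j w + Re \<kappa> * fo j w + Im \<kappa> * fe 1 w)
          + t * (go j w + Re \<kappa> * fo j w + Im \<kappa> * fe 2 w)"
          using yj vj im by (simp add: algebra_simps)
      qed auto
    qed
  qed
qed

section \<open>Nonnegative real polynomials as sums of two squares\<close>

lemma cpoly_simps:
  "cpoly 0 = 0" "cpoly (pCons a p) = pCons (of_real a) (cpoly p)"
  "cpoly (p + q) = cpoly p + cpoly q" "cpoly (p * q) = cpoly p * cpoly q"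
  "cpoly (Polynomial.smult a p) = Polynomial.smult (of_real a) (cpoly p)"
  by (auto simp: cpoly_def coeff_map_poly coeff_mult coeff_pCons intro!: poly_eqI split: nat.split)

lemma poly_cpoly_of_real: "poly (cpoly p) (of_real x) = of_real (poly p x)"
  by (induction p) (simp_all add: cpoly_simps)

lemma tendsto_poly_within: "(poly p \<longlongrightarrow> poly p r) (at r within S)" for p :: "real poly"
  using continuous_poly[of "at r within S" "\<lambda>x. x" p] by (simp add: continuous_within)

lemma nonneg_at_point_by_continuity:
  fixes p :: "real poly"
  assumes "\<And>x. x \<noteq> r \<Longrightarrow> 0 \<le> poly p x"
  shows "0 \<le> poly p r"
proof (rule tendsto_lowerbound[of "poly p" "poly p r" "at r"])
  show "(poly p \<longlongrightarrow> poly p r) (at r)" by (rule tendsto_poly_within)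
  show "\<forall>\<^sub>F x in at r. 0 \<le> poly p x" unfolding eventually_at_filter using assms by simp
qed simp

lemma sum_of_two_squares_mult:
  fixes a b u v :: "'a::comm_ring_1"
  shows "(u\<^sup>2 + v\<^sup>2) * (a\<^sup>2 + b\<^sup>2) = (u * a - v * b)\<^sup>2 + (u * b + v * a)\<^sup>2"
  by (simp add: power2_eq_square algebra_simps)

text \<open>A real root of a nonnegative polynomial is a root of even multiplicity and splits off a square; a
  nonreal root together with its conjugate splits off \<open>(x - Re z)\<^sup>2 + (Im z)\<^sup>2\<close>, and sums of two
  squares are closed under multiplication.\<close>

lemma nonneg_poly_sum_of_two_squares:
  fixes p :: "real poly"
  assumes "\<And>x. 0 \<le> poly p x"
  shows "\<exists>a b. p = a\<^sup>2 + b\<^sup>2"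
  using assms
proof (induction "degree p" arbitrary: p rule: less_induct)
  case less
  show ?case
  proof (cases "degree p = 0")
    case True
    then obtain d where d: "p = [:d:]" by (metis degree_eq_zeroE)
    then have "0 \<le> d" using less.prems[of 0] by simp
    then have "p = [:sqrt d:]\<^sup>2 + 0\<^sup>2" unfolding d by (simp add: power2_eq_square)
    then show ?thesis by blast
  next
    case False
    then obtain z where z: "poly (cpoly p) z = 0"
      using alg_closed_imp_poly_has_root[of "cpoly p"] by (auto simp: degree_cpoly)
    have p0: "p \<noteq> 0" using False by auto
    show ?thesis
    proof (cases "Im z = 0")
      case True
      define r where "r = Re z"
      have "z = of_real r" using True by (simp add: r_def complex_eq_iff)
      then have "poly p r = 0" using z by (metis poly_cpoly_of_real of_real_eq_0_iff)
      then obtain p1 where p1: "p = [:-r, 1:] * p1" by (auto simp: poly_eq_0_iff_dvd elim: dvdE)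
      have "0 \<le> (x - r) * poly p1 x" for x using less.prems[of x] by (simp add: p1 algebra_simps)
      then have sgn: "r < x \<Longrightarrow> 0 \<le> poly p1 x" "x < r \<Longrightarrow> poly p1 x \<le> 0" for x
        by (metis diff_gt_0_iff_gt diff_less_0_iff_less zero_le_mult_iff not_less)+
      \<comment> \<open>\<open>p1\<close> changes sign at \<open>r\<close>, hence has a root there: the multiplicity of \<open>r\<close> is at least two\<close>
      have "poly p1 r = 0"
      proof (rule antisym)
        show "0 \<le> poly p1 r"
        proof (rule tendsto_lowerbound[of "poly p1" "poly p1 r" "at_right r"])
          show "(poly p1 \<longlongrightarrow> poly p1 r) (at_right r)"
            by (rule tendsto_poly_within)
          show "\<forall>\<^sub>F x in at_right r. 0 \<le> poly p1 x"
            unfolding eventually_at_filter using sgn by (auto simp: zero_le_mult_iff intro!: always_eventually)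
        qed simp
        show "poly p1 r \<le> 0"
        proof (rule tendsto_upperbound[of "poly p1" "poly p1 r" "at_left r"])
          show "(poly p1 \<longlongrightarrow> poly p1 r) (at_left r)"
            by (rule tendsto_poly_within)
          show "\<forall>\<^sub>F x in at_left r. poly p1 x \<le> 0"
            unfolding eventually_at_filter using sgn by (auto simp: zero_le_mult_iff intro!: always_eventually)
        qed simp
      qed
      then obtain p2 where p2: "p1 = [:-r, 1:] * p2" by (auto simp: poly_eq_0_iff_dvd elim: dvdE)
      have pe: "p = [:-r, 1:]\<^sup>2 * p2" unfolding p1 p2 by (simp only: power2_eq_square mult.assoc)
      have "0 \<le> poly p2 x" if "x \<noteq> r" for x
      proof -
        have "0 \<le> (x - r)\<^sup>2 * poly p2 x" using less.prems[of x] unfolding pe by simp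
        then show ?thesis using that by (simp add: zero_le_mult_iff)
      qed
      then have "0 \<le> poly p2 x" for x by (metis nonneg_at_point_by_continuity)
      moreover have "degree p2 < degree p"
        using p0 unfolding pe by (subst degree_mult_eq) (auto simp: degree_power_eq)
      ultimately obtain a b where "p2 = a\<^sup>2 + b\<^sup>2" using less.hyps by blast
      then have "p = ([:-r, 1:] * a)\<^sup>2 + ([:-r, 1:] * b)\<^sup>2"
        unfolding pe by (simp only: power_mult_distrib distrib_left)
      then show ?thesis by blast
    next
      case False
      define u where "u = [:- Re z, 1:]"
      define q where "q = u\<^sup>2 + [:Im z:]\<^sup>2"
      have qz: "poly (cpoly q) z = 0"
        by (simp add: q_def u_def cpoly_simps power2_eq_square complex_eq_iff algebra_simps)
      have degq: "degree q = 2" by (simp add: q_def u_def power2_eq_square)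
      have "p mod q = 0"
      proof (rule ccontr)
        assume "p mod q \<noteq> 0"
        then have "degree (p mod q) < 2" using degree_mod_less[of q p] degq by fastforce
        moreover obtain d r where dr: "p mod q = pCons d r" by (cases "p mod q")
        ultimately have "degree r = 0" by (auto split: if_splits)
        then obtain e where de: "p mod q = [:d, e:]" using dr degree_eq_zeroE by blast
        have "cpoly p = cpoly q * cpoly (p div q) + cpoly (p mod q)"
          by (simp only: cpoly_simps(3,4)[symmetric] mult_div_mod_eq)
        then have "poly (cpoly (p mod q)) z = 0" using z qz by simp
        then have "of_real d + z * of_real e = 0" by (simp add: de cpoly_simps)
        then have "d + Re z * e = 0 \<and> Im z * e = 0" by (simp add: complex_eq_iff)
        then show False using False \<open>p mod q \<noteq> 0\<close> de by auto
      qed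
      then obtain s where pe: "p = q * s" by (metis dvd_def mod_0_imp_dvd)
      have qpos: "poly q x > 0" for x
      proof -
        have "poly q x = (x - Re z)\<^sup>2 + (Im z)\<^sup>2" by (simp add: q_def u_def)
        then show ?thesis using False by (simp add: add_nonneg_pos)
      qed
      have "0 \<le> poly s x" for x
        using less.prems[of x] qpos[of x] unfolding pe poly_mult by (simp only: zero_le_mult_iff) linarith
      moreover have "degree s < degree p"
        using p0 degq unfolding pe by (subst degree_mult_eq) auto
      ultimately obtain a b where ab: "s = a\<^sup>2 + b\<^sup>2" using less.hyps by blast
      have "p = (u\<^sup>2 + [:Im z:]\<^sup>2) * (a\<^sup>2 + b\<^sup>2)" unfolding pe ab q_def ..
      also have "\<dots> = (u * a - [:Im z:] * b)\<^sup>2 + (u * b + [:Im z:] * a)\<^sup>2"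
        by (rule sum_of_two_squares_mult)
      finally have "p = (u * a - [:Im z:] * b)\<^sup>2 + (u * b + [:Im z:] * a)\<^sup>2" .
      then show ?thesis by blast
    qed
  qed
qed

text \<open>Leading coefficients of squares are positive and cannot cancel.\<close>

lemma degree_sum_of_squares:
  fixes a b :: "real poly"
  assumes "degree (a\<^sup>2 + b\<^sup>2) \<le> 2 * N"
  shows "degree a \<le> N" "degree b \<le> N"
proof -
  define d where "d = max (degree a) (degree b)"
  have top: "coeff (p\<^sup>2) (2 * d) = (coeff p d)\<^sup>2" if "degree p \<le> d" for p :: "real poly"
  proof (cases "degree p = d")
    case True
    then show ?thesis using coeff_mult_degree_sum[of p p] by (simp add: power2_eq_square mult_2)
  next
    case False
    then have "degree (p\<^sup>2) < 2 * d" using that degree_power_le[of p 2] by linarith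
    then show ?thesis using False that by (simp add: coeff_eq_0)
  qed
  have "degree (a\<^sup>2 + b\<^sup>2) \<ge> 2 * d \<or> d = 0"
  proof (rule disjCI)
    assume "d \<noteq> 0"
    then have "coeff a d \<noteq> 0 \<or> coeff b d \<noteq> 0"
      unfolding d_def by (metis degree_0 leading_coeff_0_iff max_def)
    then have "coeff (a\<^sup>2 + b\<^sup>2) (2 * d) \<noteq> 0"
      using top[of a] top[of b] by (simp add: d_def sum_power2_eq_zero_iff)
    then show "2 * d \<le> degree (a\<^sup>2 + b\<^sup>2)" by (rule le_degree)
  qed
  then have "d \<le> N" using assms by auto
  then show "degree a \<le> N" "degree b \<le> N" by (auto simp: d_def)
qed

section \<open>Quadratic forms along a chain of integrators\<close>

lemma sum_atMost_rev: "(\<Sum>a\<le>n. f a) = (\<Sum>k\<le>n. f (n - k))" for n :: nat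
  unfolding atMost_atLeast0 by (subst sum.atLeastAtMost_rev) (simp only: add_0_right)

text \<open>Write a form \<open>\<Sum>i j. \<Phi> i j z\<^sub>i z\<^sub>j\<close> as a polynomial \<open>\<Sum>i j. \<Phi> i j X\<^sup>i Y\<^sup>j\<close>. Differentiation
  along the chain \<open>z\<^sub>i' = z\<^sub>i\<^sub>+\<^sub>1\<close> is multiplication with \<open>X + Y\<close>, so a form is a derivative if
  and only if its polynomial vanishes on \<open>Y = - X\<close>; in each homogeneous degree this is the vanishing of
  an alternating sum. The matrix \<open>P\<close> of the proof holds the coefficients of the quotient.\<close>

lemma alternating_form_is_derivative:
  fixes \<Phi> :: "nat \<Rightarrow> nat \<Rightarrow> real"
  assumes supp: "\<And>i j. N < i \<or> N < j \<Longrightarrow> \<Phi> i j = 0"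
    and alt: "\<And>l. (\<Sum>i\<le>l. (- 1) ^ i * \<Phi> i (l - i)) = 0"
  shows "\<exists>P. \<forall>z. (\<Sum>i\<le>N. \<Sum>j\<le>N. \<Phi> i j * z i * z j)
    = (\<Sum>i<N. \<Sum>j<N. P i j * (z (Suc i) * z j + z i * z (Suc j)))"
proof -
  define P where "P i j = (\<Sum>k\<le>i. (- 1) ^ k * \<Phi> (i - k) (Suc (j + k)))" for i j
  \<comment> \<open>up to sign, \<open>P i j\<close> is the initial part of an alternating sum of degree \<open>i + j + 1\<close>; the vanishing of the
    complete sums makes the division by \<open>X + Y\<close> exact\<close>
  have rev: "(- 1) ^ i * P i j = (\<Sum>a\<le>i. (- 1) ^ a * \<Phi> a (Suc (i + j) - a))" for i j
  proof -
    define f where "f a = (- 1) ^ a * \<Phi> a (Suc (i + j) - a)" for a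
    have "(\<Sum>a\<le>i. f a) = (\<Sum>k\<le>i. f (i - k))"
      by (subst sum_atMost_rev) (rule refl)
    also have "\<dots> = (\<Sum>k\<le>i. (- 1) ^ i * ((- 1) ^ k * \<Phi> (i - k) (Suc (j + k))))"
    proof (intro sum.cong refl)
      fix k assume "k \<in> {..i}"
      then have "(- 1 :: real) ^ (i - k) = (- 1) ^ i * (- 1) ^ k" "Suc (i + j) - (i - k) = Suc (j + k)"
        by (auto simp: uminus_power_if)
      then show "f (i - k) = (- 1) ^ i * ((- 1) ^ k * \<Phi> (i - k) (Suc (j + k)))"
        unfolding f_def by simp
    qed
    finally show ?thesis by (simp add: P_def f_def sum_distrib_left)
  qed
  have P0: "P 0 j = \<Phi> 0 (Suc j)" for j by (simp add: P_def)
  have PS: "P (Suc i) j + P i (Suc j) = \<Phi> (Suc i) (Suc j)" for i j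
    unfolding P_def by (subst sum.atMost_Suc_shift) (simp add: sum_negf)
  have Pl: "P i 0 = \<Phi> (Suc i) 0" for i
  proof -
    have "(- 1) ^ i * P i 0 + (- 1) ^ Suc i * \<Phi> (Suc i) 0 = 0"
      unfolding rev using alt[of "Suc i"] by simp
    then have "(- 1) ^ i * (P i 0 - \<Phi> (Suc i) 0) = 0" by (simp add: algebra_simps)
    then show ?thesis by simp
  qed
  have Phi0: "\<Phi> 0 0 = 0" using alt[of 0] by simp
  have Pr: "P i N = 0" for i unfolding P_def using supp by (intro sum.neutral) auto
  have Pb: "P N j = 0" for j
  proof -
    have "(\<Sum>a\<le>Suc (N + j). (- 1) ^ a * \<Phi> a (Suc (N + j) - a)) = (\<Sum>a\<le>N. (- 1) ^ a * \<Phi> a (Suc (N + j) - a))"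
      using supp by (intro sum.mono_neutral_right) auto
    then have "(- 1) ^ N * P N j = 0" using alt[of "Suc (N + j)"] rev[of N j] by simp
    then show ?thesis by simp
  qed
  have Phi: "\<Phi> i j = (if i = 0 then 0 else P (i - 1) j) + (if j = 0 then 0 else P i (j - 1))" for i j
    by (cases i; cases j; simp add: P0 Pl Phi0 PS[symmetric])
  have shift: "(\<Sum>i\<le>N. if i = 0 then 0 else f (i - 1)) = (\<Sum>i<N. f i)" for f :: "nat \<Rightarrow> real"
    by (induction N) simp_all
  have "(\<Sum>i\<le>N. \<Sum>j\<le>N. \<Phi> i j * z i * z j)
      = (\<Sum>i<N. \<Sum>j<N. P i j * (z (Suc i) * z j + z i * z (Suc j)))" for z
  proof -
    have pt: "\<Phi> i j * z i * z j = (if i = 0 then 0 else P (i - 1) j * z (Suc (i - 1)) * z j)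
        + (if j = 0 then 0 else P i (j - 1) * z i * z (Suc (j - 1)))" for i j
      using Phi[of i j] by (simp add: distrib_right)
    have "(\<Sum>i\<le>N. \<Sum>j\<le>N. \<Phi> i j * z i * z j)
      = (\<Sum>j\<le>N. \<Sum>i\<le>N. if i = 0 then 0 else P (i - 1) j * z (Suc (i - 1)) * z j)
      + (\<Sum>i\<le>N. \<Sum>j\<le>N. if j = 0 then 0 else P i (j - 1) * z i * z (Suc (j - 1)))"
      unfolding pt sum.distrib by (subst sum.swap) (rule refl)
    also have "\<dots> = (\<Sum>j\<le>N. \<Sum>i<N. P i j * z (Suc i) * z j) + (\<Sum>i\<le>N. \<Sum>j<N. P i j * z i * z (Suc j))"
      by (simp only: shift[where f = "\<lambda>i. P i _ * z (Suc i) * z _"] shift[where f = "\<lambda>j. P _ j * z _ * z (Suc j)"])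
    also have "\<dots> = (\<Sum>j<N. \<Sum>i<N. P i j * z (Suc i) * z j) + (\<Sum>i<N. \<Sum>j<N. P i j * z i * z (Suc j))"
      by (simp add: lessThan_Suc_atMost[symmetric] Pr Pb)
    also have "\<dots> = (\<Sum>i<N. \<Sum>j<N. P i j * (z (Suc i) * z j + z i * z (Suc j)))"
      by (subst sum.swap) (simp add: sum.distrib distrib_left mult.assoc)
    finally show ?thesis .
  qed
  then show ?thesis by (intro exI[of _ P] allI)
qed

lemma antidiagonal_sum:
  fixes F :: "nat \<Rightarrow> nat \<Rightarrow> 'a::comm_monoid_add"
  assumes "\<And>i j. N < i \<or> N < j \<Longrightarrow> F i j = 0"
  shows "(\<Sum>i\<le>N. \<Sum>j\<le>N. F i j) = (\<Sum>l\<le>2 * N. \<Sum>i\<le>l. F i (l - i))"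
proof -
  have F0: "F i j = 0" if "\<not> (i \<le> N \<and> j \<le> N)" for i j using assms[of i j] that by auto
  have "(\<Sum>l\<le>2 * N. \<Sum>i\<le>l. F i (l - i)) = (\<Sum>(i, j)\<in>{(i, j). i + j \<le> 2 * N}. F i j)"
    by (rule sum.triangle_reindex_eq[symmetric])
  also have "\<dots> = (\<Sum>(i, j)\<in>{..N} \<times> {..N}. F i j)"
  proof (rule sum.mono_neutral_right)
    show "finite {(i, j). i + j \<le> 2 * N}"
      by (rule finite_subset[of _ "{..2 * N} \<times> {..2 * N}"]) auto
    show "\<forall>x\<in>{(i, j). i + j \<le> 2 * N} - {..N} \<times> {..N}. (case x of (i, j) \<Rightarrow> F i j) = 0"
      by (auto intro: F0)
  qed auto
  finally show ?thesis by (simp add: sum.cartesian_product)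
qed

text \<open>On the imaginary axis \<open>cnj w = - w\<close>, so a form that vanishes at all vectors of powers
  \<open>(1, w, w\<^sup>2, \<dots>)\<close> gives a polynomial in \<open>w\<close> with infinitely many zeros whose coefficients are
  the alternating sums.\<close>

lemma alternating_sums_vanish:
  fixes \<Phi> :: "nat \<Rightarrow> nat \<Rightarrow> real"
  assumes supp: "\<And>i j. N < i \<or> N < j \<Longrightarrow> \<Phi> i j = 0"
    and zero: "\<And>\<omega>::real. (\<Sum>i\<le>N. \<Sum>j\<le>N. of_real (\<Phi> i j) * cnj (\<i> * of_real \<omega>) ^ i * (\<i> * of_real \<omega>) ^ j) = 0"
  shows "(\<Sum>i\<le>l. (- 1) ^ i * \<Phi> i (l - i)) = 0"
proof (cases "l \<le> 2 * N")
  case False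
  show ?thesis
  proof (intro sum.neutral ballI)
    fix i assume "i \<in> {..l}"
    then have "N < i \<or> N < l - i" using False by auto
    then show "(- 1) ^ i * \<Phi> i (l - i) = 0" using supp by simp
  qed
next
  case True
  define A where "A l = (\<Sum>i\<le>l. (- 1) ^ i * \<Phi> i (l - i))" for l
  define p where "p = (\<Sum>l\<le>2 * N. monom (complex_of_real (A l)) l)"
  have val: "poly p (\<i> * of_real \<omega>) = 0" for \<omega> :: real
  proof -
    let ?w = "\<i> * complex_of_real \<omega>"
    have "0 = (\<Sum>i\<le>N. \<Sum>j\<le>N. of_real (\<Phi> i j) * cnj ?w ^ i * ?w ^ j)" using zero by simp
    also have "\<dots> = (\<Sum>l\<le>2 * N. \<Sum>i\<le>l. of_real (\<Phi> i (l - i)) * cnj ?w ^ i * ?w ^ (l - i))"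
      by (rule antidiagonal_sum) (use supp in auto)
    also have "\<dots> = (\<Sum>l\<le>2 * N. \<Sum>i\<le>l. of_real ((- 1) ^ i * \<Phi> i (l - i)) * ?w ^ l)"
    proof (intro sum.cong refl)
      fix l i :: nat assume "i \<in> {..l}"
      then have "?w ^ l = ?w ^ i * ?w ^ (l - i)" by (simp add: power_add[symmetric])
      moreover have "cnj ?w = - 1 * ?w" by simp
      then have "cnj ?w ^ i = (- 1) ^ i * ?w ^ i" by (simp only: power_mult_distrib)
      ultimately show "of_real (\<Phi> i (l - i)) * cnj ?w ^ i * ?w ^ (l - i) = of_real ((- 1) ^ i * \<Phi> i (l - i)) * ?w ^ l"
        by simp
    qed
    also have "\<dots> = poly p ?w" by (simp add: p_def poly_sum poly_monom A_def sum_distrib_right)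
    finally show ?thesis by simp
  qed
  have "infinite (range (\<lambda>\<omega>. \<i> * complex_of_real \<omega>))"
    by (simp add: infinite_UNIV_char_0 finite_image_iff inj_on_def)
  moreover have "range (\<lambda>\<omega>. \<i> * complex_of_real \<omega>) \<subseteq> {z. poly p z = 0}" using val by auto
  ultimately have "p = 0" using poly_roots_finite finite_subset by blast
  then have "coeff p l = 0" by simp
  then have "complex_of_real (A l) = 0" using True by (simp add: p_def coeff_sum)
  then have "A l = 0" using of_real_eq_0_iff by blast
  then show ?thesis by (simp only: A_def)
qed

lemma poly_as_sum_atMost:
  fixes p :: "'a::comm_semiring_1 poly"
  assumes "degree p \<le> N"
  shows "poly p x = (\<Sum>i\<le>N. coeff p i * x ^ i)"
  unfolding poly_altdef using assms
  by (intro sum.mono_neutral_left) (auto simp: coeff_eq_0)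

lemma hermitian_form_of_coeffs:
  assumes "degree p \<le> N" "degree q \<le> N"
  shows "(\<Sum>i\<le>N. \<Sum>j\<le>N. coeff p i * coeff q j * cnj w ^ i * w ^ j)
    = (\<Sum>i\<le>N. coeff p i * cnj w ^ i) * poly q w"
  unfolding poly_as_sum_atMost[OF assms(2)] sum_product by (simp add: mult_ac)

lemma coeff_cpoly: "coeff (cpoly p) i = of_real (coeff p i)"
  by (simp add: cpoly_def coeff_map_poly)

lemma poly_cpoly_cnj: "poly (cpoly p) (cnj w) = cnj (poly (cpoly p) w)"
  by (simp add: poly_altdef coeff_cpoly degree_cpoly)

text \<open>Spectral factorization in the time domain. The left hand side of the assumption is subtracted from
  the right hand side and written as \<open>a\<^sup>2 + b\<^sup>2\<close> with real polynomials in \<open>\<omega>\<close>; replacing \<open>\<omega>\<close> by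
  \<open>- i d/dt\<close> gives a complex linear form \<open>\<rho>\<close> in the derivatives of \<open>z\<close>. The form \<open>|\<rho> \<cdot> z|\<^sup>2\<close>
  agrees on the imaginary axis with \<open>2 (c \<cdot> z) (h \<cdot> z) - \<eta> |z|\<^sup>2\<close>, so the difference of the
  two is a derivative along the chain.\<close>

lemma frequency_form_sum_of_two_squares:
  fixes c h :: "real poly"
  assumes deg: "degree c \<le> N" "degree h \<le> N"
    and pos: "\<And>\<omega>::real. \<eta> * (\<Sum>i\<le>N. \<omega> ^ (2 * i))
      \<le> 2 * Re (poly (cpoly h) (\<i> * of_real \<omega>) * cnj (poly (cpoly c) (\<i> * of_real \<omega>)))"
  shows "\<exists>\<alpha> \<beta> P. \<forall>z. 2 * (\<Sum>i\<le>N. coeff c i * z i) * (\<Sum>i\<le>N. coeff h i * z i)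
      = (\<Sum>i<N. \<Sum>j<N. P i j * (z (Suc i) * z j + z i * z (Suc j)))
        + (\<Sum>i\<le>N. \<alpha> i * z i)\<^sup>2 + (\<Sum>i\<le>N. \<beta> i * z i)\<^sup>2 + \<eta> * (\<Sum>i\<le>N. (z i)\<^sup>2)"
proof -
  define \<Psi> where "\<Psi> i j = coeff c i * coeff h j + coeff c j * coeff h i - (if i = j \<and> i \<le> N then \<eta> else 0)" for i j
  define E where "E \<omega> = 2 * Re (poly (cpoly h) (\<i> * of_real \<omega>) * cnj (poly (cpoly c) (\<i> * of_real \<omega>)))
    - \<eta> * (\<Sum>i\<le>N. \<omega> ^ (2 * i))" for \<omega>
  have \<Psi>0: "\<Psi> i j = 0" if "N < i \<or> N < j" for i j using that deg by (auto simp: \<Psi>_def coeff_eq_0)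
  have form: "(\<Sum>i\<le>N. \<Sum>j\<le>N. of_real (\<Psi> i j) * cnj (\<i> * of_real \<omega>) ^ i * (\<i> * of_real \<omega>) ^ j) = of_real (E \<omega>)" for \<omega>
  proof -
    let ?w = "\<i> * complex_of_real \<omega>"
    have d: "degree (cpoly c) \<le> N" "degree (cpoly h) \<le> N" using deg by (simp_all add: degree_cpoly)
    have cv: "(\<Sum>i\<le>N. coeff (cpoly p) i * cnj ?w ^ i) = cnj (poly (cpoly p) ?w)" if "degree p \<le> N" for p
      using poly_as_sum_atMost[of "cpoly p" N "cnj ?w"] that poly_cpoly_cnj[of p ?w] by (simp add: degree_cpoly)
    have "(\<Sum>i\<le>N. \<Sum>j\<le>N. of_real (\<Psi> i j) * cnj ?w ^ i * ?w ^ j)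
      = (\<Sum>i\<le>N. \<Sum>j\<le>N. coeff (cpoly c) i * coeff (cpoly h) j * cnj ?w ^ i * ?w ^ j)
      + (\<Sum>i\<le>N. \<Sum>j\<le>N. coeff (cpoly h) i * coeff (cpoly c) j * cnj ?w ^ i * ?w ^ j)
      - (\<Sum>i\<le>N. \<Sum>j\<le>N. if i = j then of_real \<eta> * cnj ?w ^ i * ?w ^ j else 0)"
      unfolding sum.distrib[symmetric] sum_subtractf[symmetric]
      by (intro sum.cong refl) (auto simp: \<Psi>_def coeff_cpoly algebra_simps)
    also have "\<dots> = cnj (poly (cpoly c) ?w) * poly (cpoly h) ?w + cnj (poly (cpoly h) ?w) * poly (cpoly c) ?w
      - (\<Sum>i\<le>N. of_real \<eta> * cnj ?w ^ i * ?w ^ i)"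
      unfolding hermitian_form_of_coeffs[OF d] hermitian_form_of_coeffs[OF d(2,1)] cv[OF deg(1)] cv[OF deg(2)]
      by (simp add: sum.delta)
    also have "(\<Sum>i\<le>N. of_real \<eta> * cnj ?w ^ i * ?w ^ i) = of_real (\<eta> * (\<Sum>i\<le>N. \<omega> ^ (2 * i)))"
    proof -
      have "cnj ?w ^ i * ?w ^ i = of_real (\<omega> ^ (2 * i))" for i
      proof -
        have "cnj ?w * ?w = of_real (\<omega>\<^sup>2)" by (simp add: complex_eq_iff power2_eq_square)
        then show ?thesis by (simp only: power_mult_distrib[symmetric] power_mult of_real_power)
      qed
      then show ?thesis by (simp add: sum_distrib_left mult.assoc)
    qed
    also have "cnj (poly (cpoly c) ?w) * poly (cpoly h) ?w + cnj (poly (cpoly h) ?w) * poly (cpoly c) ?w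
      = of_real (2 * Re (poly (cpoly h) ?w * cnj (poly (cpoly c) ?w)))"
      by (simp add: complex_eq_iff algebra_simps)
    finally show ?thesis by (simp add: E_def)
  qed
  \<comment> \<open>the frequency form is real for real \<open>\<omega>\<close>, so its coefficients may be replaced by their real parts\<close>
  define A where "A l = (\<Sum>i\<le>l. of_real (\<Psi> i (l - i)) * cnj \<i> ^ i * \<i> ^ (l - i))" for l
  define e where "e = (\<Sum>l\<le>2 * N. monom (Re (A l)) l)"
  have e: "poly e \<omega> = E \<omega>" for \<omega>
  proof -
    have "of_real (E \<omega>) = (\<Sum>i\<le>N. \<Sum>j\<le>N. of_real (\<Psi> i j) * cnj (\<i> * of_real \<omega>) ^ i * (\<i> * of_real \<omega>) ^ j)"
      by (rule form[symmetric])
    also have "\<dots> = (\<Sum>l\<le>2 * N. \<Sum>i\<le>l. of_real (\<Psi> i (l - i)) * cnj (\<i> * of_real \<omega>) ^ i * (\<i> * of_real \<omega>) ^ (l - i))"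
      by (rule antidiagonal_sum) (use \<Psi>0 in auto)
    also have "\<dots> = (\<Sum>l\<le>2 * N. A l * of_real (\<omega> ^ l))"
    proof (intro sum.cong refl)
      fix l
      have "of_real (\<Psi> i (l - i)) * cnj (\<i> * of_real \<omega>) ^ i * (\<i> * of_real \<omega>) ^ (l - i)
        = of_real (\<Psi> i (l - i)) * cnj \<i> ^ i * \<i> ^ (l - i) * of_real (\<omega> ^ l)" if "i \<le> l" for i
      proof -
        have "complex_of_real \<omega> ^ i * complex_of_real \<omega> ^ (l - i) = of_real (\<omega> ^ l)"
          using that by (simp add: power_add[symmetric])
        moreover have "of_real (\<Psi> i (l - i)) * cnj (\<i> * of_real \<omega>) ^ i * (\<i> * of_real \<omega>) ^ (l - i)
          = of_real (\<Psi> i (l - i)) * cnj \<i> ^ i * \<i> ^ (l - i) * (complex_of_real \<omega> ^ i * complex_of_real \<omega> ^ (l - i))"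
          unfolding complex_cnj_mult complex_cnj_complex_of_real power_mult_distrib by (simp only: mult_ac)
        ultimately show ?thesis by simp
      qed
      then show "(\<Sum>i\<le>l. of_real (\<Psi> i (l - i)) * cnj (\<i> * of_real \<omega>) ^ i * (\<i> * of_real \<omega>) ^ (l - i)) = A l * of_real (\<omega> ^ l)"
        unfolding A_def sum_distrib_right by (intro sum.cong) auto
    qed
    finally have "E \<omega> = Re (\<Sum>l\<le>2 * N. A l * of_real (\<omega> ^ l))" by (metis Re_complex_of_real)
    also have "\<dots> = poly e \<omega>" by (simp add: e_def poly_sum poly_monom Re_sum del: of_real_power)
    finally show ?thesis by simp
  qed
  have "0 \<le> poly e \<omega>" for \<omega> unfolding e E_def using pos[of \<omega>] by simp
  then obtain a b where ab: "e = a\<^sup>2 + b\<^sup>2" using nonneg_poly_sum_of_two_squares by blast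
  have "degree e \<le> 2 * N" unfolding e_def
    by (intro degree_sum_le) (auto intro: order.trans[OF degree_monom_le])
  then have dab: "degree a \<le> N" "degree b \<le> N" using degree_sum_of_squares[of a b N] ab by auto
  \<comment> \<open>\<open>\<rho>\<close> takes the value \<open>a(\<omega>) + i b(\<omega>)\<close> at \<open>i \<omega>\<close>\<close>
  define \<rho> where "\<rho> j = (of_real (coeff a j) + \<i> * of_real (coeff b j)) * (- \<i>) ^ j" for j
  have \<rho>0: "\<rho> j = 0" if "N < j" for j using that dab by (simp add: \<rho>_def coeff_eq_0)
  have \<rho>v: "(\<Sum>j\<le>N. \<rho> j * (\<i> * of_real \<omega>) ^ j) = of_real (poly a \<omega>) + \<i> * of_real (poly b \<omega>)" for \<omega>
  proof -
    have "\<rho> j * (\<i> * of_real \<omega>) ^ j = (of_real (coeff a j) + \<i> * of_real (coeff b j)) * of_real \<omega> ^ j" for j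
    proof -
      have "(- \<i>) ^ j * (\<i> * complex_of_real \<omega>) ^ j = of_real \<omega> ^ j" unfolding power_mult_distrib[symmetric] by simp
      then show ?thesis by (simp add: \<rho>_def mult.assoc)
    qed
    then show ?thesis unfolding poly_as_sum_atMost[OF dab(1)] poly_as_sum_atMost[OF dab(2)]
      by (simp add: distrib_right sum.distrib sum_distrib_left mult.assoc)
  qed
  have Eeven: "E (- \<omega>) = E \<omega>" for \<omega>
  proof -
    have "\<i> * complex_of_real (- \<omega>) = cnj (\<i> * of_real \<omega>)" by simp
    then have "poly (cpoly p) (\<i> * complex_of_real (- \<omega>)) = cnj (poly (cpoly p) (\<i> * of_real \<omega>))" for p
      using poly_cpoly_cnj by metis
    then show ?thesis by (simp add: E_def mult.commute)
  qed
  \<comment> \<open>\<open>R\<close> is the real part of the matrix of \<open>|\<rho> \<cdot> z|\<^sup>2\<close>; its value at \<open>\<omega>\<close> is the mean of the values at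
    \<open>\<omega>\<close> and \<open>- \<omega>\<close>, so evenness of \<open>E\<close> is used\<close>
  define R where "R i j = Re (\<rho> i * cnj (\<rho> j))" for i j
  have Rform: "(\<Sum>i\<le>N. \<Sum>j\<le>N. of_real (R i j) * cnj (\<i> * of_real \<omega>) ^ i * (\<i> * of_real \<omega>) ^ j) = of_real (E \<omega>)" for \<omega>
  proof -
    let ?w = "\<i> * complex_of_real \<omega>"
    have w': "cnj ?w = \<i> * of_real (- \<omega>)" by simp
    have mod: "(of_real x + \<i> * of_real y) * cnj (of_real x + \<i> * of_real y) = of_real (x\<^sup>2 + y\<^sup>2)" for x y
      by (simp add: complex_eq_iff power2_eq_square)
    have Eab: "E \<omega> = (poly a \<omega>)\<^sup>2 + (poly b \<omega>)\<^sup>2" for \<omega> using e[of \<omega>] ab by simp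
    have cs: "(\<Sum>j\<le>N. cnj (\<rho> j) * v ^ j) = cnj (\<Sum>j\<le>N. \<rho> j * cnj v ^ j)" for v by simp
    have "2 * (\<Sum>i\<le>N. \<Sum>j\<le>N. of_real (R i j) * cnj ?w ^ i * ?w ^ j)
      = (\<Sum>i\<le>N. \<Sum>j\<le>N. (\<rho> i * cnj ?w ^ i) * (cnj (\<rho> j) * ?w ^ j))
      + (\<Sum>i\<le>N. \<Sum>j\<le>N. (cnj (\<rho> i) * cnj ?w ^ i) * (\<rho> j * ?w ^ j))"
    proof -
      have R2: "2 * of_real (R i j) = \<rho> i * cnj (\<rho> j) + cnj (\<rho> i) * \<rho> j" for i j
        by (simp add: R_def complex_eq_iff)
      have "2 * (of_real (R i j) * A * B) = (\<rho> i * A) * (cnj (\<rho> j) * B) + (cnj (\<rho> i) * A) * (\<rho> j * B)" for i j A B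
      proof -
        have "2 * (of_real (R i j) * A * B) = (2 * of_real (R i j)) * (A * B)" by (simp only: mult.assoc)
        then show ?thesis unfolding R2 by (simp only: distrib_right distrib_left mult_ac)
      qed
      then show ?thesis unfolding sum_distrib_left sum.distrib[symmetric] by simp
    qed
    also have "\<dots> = (\<Sum>i\<le>N. \<rho> i * cnj ?w ^ i) * (\<Sum>j\<le>N. cnj (\<rho> j) * ?w ^ j)
      + (\<Sum>i\<le>N. cnj (\<rho> i) * cnj ?w ^ i) * (\<Sum>j\<le>N. \<rho> j * ?w ^ j)"
      unfolding sum_product ..
    also have "\<dots> = of_real (E (- \<omega>)) + of_real (E \<omega>)"
    proof -
      let ?v1 = "of_real (poly a (- \<omega>)) + \<i> * complex_of_real (poly b (- \<omega>))"
      let ?v2 = "of_real (poly a \<omega>) + \<i> * complex_of_real (poly b \<omega>)"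
      have s1: "(\<Sum>i\<le>N. \<rho> i * cnj ?w ^ i) = ?v1" unfolding w' by (rule \<rho>v)
      have s2: "(\<Sum>j\<le>N. cnj (\<rho> j) * ?w ^ j) = cnj ?v1" unfolding cs s1 ..
      have s4: "(\<Sum>j\<le>N. \<rho> j * ?w ^ j) = ?v2" by (rule \<rho>v)
      have s3: "(\<Sum>j\<le>N. cnj (\<rho> j) * cnj ?w ^ j) = cnj ?v2" unfolding cs complex_cnj_cnj s4 ..
      show ?thesis unfolding s1 s2 s3 s4 Eab mod mult.commute[of "cnj ?v2"] ..
    qed
    finally show ?thesis unfolding Eeven by simp
  qed
  define \<Phi> where "\<Phi> i j = \<Psi> i j - R i j" for i j
  have \<Phi>0: "\<Phi> i j = 0" if "N < i \<or> N < j" for i j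
    using that \<Psi>0 \<rho>0 by (auto simp: \<Phi>_def R_def)
  have "(\<Sum>i\<le>N. \<Sum>j\<le>N. of_real (\<Phi> i j) * cnj (\<i> * of_real \<omega>) ^ i * (\<i> * of_real \<omega>) ^ j) = 0" for \<omega>
    unfolding \<Phi>_def of_real_diff left_diff_distrib sum_subtractf form Rform by simp
  then have alt: "(\<Sum>i\<le>l. (- 1) ^ i * \<Phi> i (l - i)) = 0" for l
    by (intro alternating_sums_vanish[of N \<Phi>] \<Phi>0)
  have "\<exists>P. \<forall>z. (\<Sum>i\<le>N. \<Sum>j\<le>N. \<Phi> i j * z i * z j)
    = (\<Sum>i<N. \<Sum>j<N. P i j * (z (Suc i) * z j + z i * z (Suc j)))"
    by (rule alternating_form_is_derivative[of N \<Phi>, OF \<Phi>0 alt])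
  then obtain P where P: "\<forall>z. (\<Sum>i\<le>N. \<Sum>j\<le>N. \<Phi> i j * z i * z j)
    = (\<Sum>i<N. \<Sum>j<N. P i j * (z (Suc i) * z j + z i * z (Suc j)))" ..
  have "2 * (\<Sum>i\<le>N. coeff c i * z i) * (\<Sum>i\<le>N. coeff h i * z i)
      = (\<Sum>i<N. \<Sum>j<N. P i j * (z (Suc i) * z j + z i * z (Suc j)))
        + (\<Sum>i\<le>N. Re (\<rho> i) * z i)\<^sup>2 + (\<Sum>i\<le>N. Im (\<rho> i) * z i)\<^sup>2 + \<eta> * (\<Sum>i\<le>N. (z i)\<^sup>2)" for z
  proof -
    have "(\<Sum>i\<le>N. \<Sum>j\<le>N. \<Phi> i j * z i * z j)
      = (\<Sum>i\<le>N. \<Sum>j\<le>N. (coeff c i * z i) * (coeff h j * z j)) + (\<Sum>i\<le>N. \<Sum>j\<le>N. (coeff h i * z i) * (coeff c j * z j))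
       - (\<Sum>i\<le>N. \<Sum>j\<le>N. if i = j then \<eta> * (z i * z j) else 0)
       - ((\<Sum>i\<le>N. \<Sum>j\<le>N. (Re (\<rho> i) * z i) * (Re (\<rho> j) * z j)) + (\<Sum>i\<le>N. \<Sum>j\<le>N. (Im (\<rho> i) * z i) * (Im (\<rho> j) * z j)))"
      unfolding sum.distrib[symmetric] sum_subtractf[symmetric]
      by (intro sum.cong refl) (auto simp: \<Phi>_def \<Psi>_def R_def algebra_simps)
    also have "\<dots> = 2 * (\<Sum>i\<le>N. coeff c i * z i) * (\<Sum>i\<le>N. coeff h i * z i) - \<eta> * (\<Sum>i\<le>N. (z i)\<^sup>2)
       - ((\<Sum>i\<le>N. Re (\<rho> i) * z i)\<^sup>2 + (\<Sum>i\<le>N. Im (\<rho> i) * z i)\<^sup>2)"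
    proof -
      have "(\<Sum>i\<le>N. \<Sum>j\<le>N. if i = j then \<eta> * (z i * z j) else 0) = \<eta> * (\<Sum>i\<le>N. (z i)\<^sup>2)"
        by (simp add: sum_distrib_left power2_eq_square)
      then show ?thesis unfolding sum_product[symmetric] by (simp add: power2_eq_square)
    qed
    finally show ?thesis unfolding P[rule_format] by linarith
  qed
  then show ?thesis
    by (intro exI[of _ "\<lambda>i. Re (\<rho> i)"] exI[of _ "\<lambda>i. Im (\<rho> i)"] exI[of _ P] allI)
qed

section \<open>Lyapunov forms of companion systems\<close>

lemma stable_poly_factorization:
  assumes "stable p"
  shows "\<exists>\<nu>. (\<forall>i. Re (\<nu> i) < 0) \<and> p = Polynomial.smult (lead_coeff p) (\<Prod>i<degree p. [:- \<nu> i, 1:])"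
  using assms
proof (induction rule: stable_induct)
  case (const c)
  then show ?case by (intro exI[of _ "\<lambda>_. - 1"]) simp
next
  case (root z q)
  then obtain \<nu> where l: "\<And>i. Re (\<nu> i) < 0" "q = Polynomial.smult (lead_coeff q) (\<Prod>i<degree q. [:- \<nu> i, 1:])"
    by blast
  define \<mu> where "\<mu> = \<nu>(degree q := z)"
  have "q \<noteq> 0" using root(2) by (auto simp: stable_def dest: spec[of _ 0])
  then have deg: "degree ([:-z, 1:] * q) = Suc (degree q)" by (subst degree_mult_eq) auto
  have lc: "lead_coeff ([:-z, 1:] * q) = lead_coeff q" by (subst lead_coeff_mult) simp
  have "(\<Prod>i<degree q. [:- \<mu> i, 1:]) = (\<Prod>i<degree q. [:- \<nu> i, 1:])"
    by (intro prod.cong) (auto simp: \<mu>_def)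
  then have eq: "Polynomial.smult (lead_coeff q) (\<Prod>i<Suc (degree q). [:- \<mu> i, 1:]) = [:-z, 1:] * q"
    using l(2) by (simp only: prod.lessThan_Suc \<mu>_def fun_upd_same) (metis mult.commute mult_smult_left)
  have "[:-z, 1:] * q = Polynomial.smult (lead_coeff ([:-z, 1:] * q)) (\<Prod>i<degree ([:-z, 1:] * q). [:- \<mu> i, 1:])"
    by (subst lc, subst deg, rule eq[symmetric])
  moreover have "Re (\<mu> i) < 0" for i using l(1) root(1) by (simp add: \<mu>_def)
  ultimately show ?case by blast
qed

text \<open>Extends a state of the companion system \<open>c(d/dt) z\<^sub>0 = 0\<close> by the entry with index \<open>N\<close>, the
  derivative of \<open>z\<^sub>N\<^sub>-\<^sub>1\<close>, which the equation determines from the state.\<close>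

definition companion_ext :: "nat \<Rightarrow> (nat \<Rightarrow> real) \<Rightarrow> (nat \<Rightarrow> real) \<Rightarrow> nat \<Rightarrow> real" where
  "companion_ext N c z i = (if i < N then z i else if i = N then - (\<Sum>j<N. c j * z j) else 0)"

definition euler_step :: "nat \<Rightarrow> (nat \<Rightarrow> real) \<Rightarrow> real \<Rightarrow> (nat \<Rightarrow> real) \<Rightarrow> nat \<Rightarrow> real" where
  "euler_step N c h z i = companion_ext N c z i + h * companion_ext N c z (Suc i)"

text \<open>A unitriangular linear map is injective; quantitatively, the last coordinate is the last value minus
  a combination of the coordinates before it.\<close>

lemma triangular_lower_bound:
  fixes T :: "nat \<Rightarrow> nat \<Rightarrow> complex"
  assumes "\<And>l. T l l = 1"
  shows "\<exists>C\<ge>0. \<forall>z::nat \<Rightarrow> real. (\<Sum>i<N. (z i)\<^sup>2) \<le> C * (\<Sum>l<N. (cmod (\<Sum>i\<le>l. T l i * of_real (z i)))\<^sup>2)"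
proof (induction N)
  case 0
  then show ?case by (intro exI[of _ 0]) simp
next
  case (Suc N)
  then obtain C where C: "C \<ge> 0" "\<And>z::nat \<Rightarrow> real. (\<Sum>i<N. (z i)\<^sup>2) \<le> C * (\<Sum>l<N. (cmod (\<Sum>i\<le>l. T l i * of_real (z i)))\<^sup>2)"
    by blast
  define M where "M = (\<Sum>i<N. (cmod (T N i))\<^sup>2)"
  have M: "M \<ge> 0" by (simp add: M_def sum_nonneg)
  show ?case
  proof (intro exI[of _ "2 + C * (1 + 2 * M)"] conjI allI)
    show "0 \<le> 2 + C * (1 + 2 * M)" using C M by simp
    fix z :: "nat \<Rightarrow> real"
    let ?y = "\<lambda>l. \<Sum>i\<le>l. T l i * of_real (z i)"
    let ?S = "\<Sum>i<N. (z i)\<^sup>2"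
    let ?Y = "\<Sum>l<N. (cmod (?y l))\<^sup>2"
    let ?r = "\<Sum>i<N. T N i * of_real (z i)"
    have "cmod ?r \<le> (\<Sum>i<N. cmod (T N i) * \<bar>z i\<bar>)"
      by (rule order.trans[OF norm_sum]) (simp add: norm_mult)
    then have "(cmod ?r)\<^sup>2 \<le> (\<Sum>i<N. cmod (T N i) * \<bar>z i\<bar>)\<^sup>2" by (intro power_mono) auto
    also have "\<dots> \<le> M * ?S"
      using Cauchy_Schwarz_ineq_sum[of "\<lambda>i. cmod (T N i)" "\<lambda>i. \<bar>z i\<bar>" "{..<N}"] by (simp add: M_def)
    finally have r: "(cmod ?r)\<^sup>2 \<le> M * ?S" .
    have "of_real (z N) = ?y N - ?r" using assms by (simp add: lessThan_Suc_atMost[symmetric])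
    then have "\<bar>z N\<bar> \<le> cmod (?y N) + cmod ?r" by (metis norm_of_real norm_triangle_ineq4)
    then have "(z N)\<^sup>2 \<le> (cmod (?y N) + cmod ?r)\<^sup>2" by (metis abs_ge_zero power2_abs power_mono)
    also have "\<dots> \<le> 2 * (cmod (?y N))\<^sup>2 + 2 * (cmod ?r)\<^sup>2"
      using sum_squares_bound[of "cmod (?y N)" "cmod ?r"] by (simp add: power2_sum)
    finally have zN: "(z N)\<^sup>2 \<le> 2 * (cmod (?y N))\<^sup>2 + 2 * M * ?S" using r by simp
    have "?S * (1 + 2 * M) \<le> C * ?Y * (1 + 2 * M)" using C(2)[of z] M by (intro mult_right_mono) auto
    moreover have "0 \<le> C * (1 + 2 * M) * (cmod (?y N))\<^sup>2" "0 \<le> ?Y" using C(1) M by (auto intro: sum_nonneg)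
    ultimately show "(\<Sum>i<Suc N. (z i)\<^sup>2) \<le> (2 + C * (1 + 2 * M)) * (\<Sum>l<Suc N. (cmod (?y l))\<^sup>2)"
      using zN by (simp add: algebra_simps)
  qed
qed

lemma quadratic_form_upper_bound:
  fixes P :: "nat \<Rightarrow> nat \<Rightarrow> real"
  shows "\<bar>\<Sum>i<N. \<Sum>j<N. P i j * (z i * z j)\<bar> \<le> (\<Sum>i<N. \<Sum>j<N. \<bar>P i j\<bar>) * (\<Sum>i<N. (z i)\<^sup>2)"
proof -
  have zz: "\<bar>z i * z j\<bar> \<le> (\<Sum>i<N. (z i)\<^sup>2)" if "i < N" "j < N" for i j
  proof -
    have "(z k)\<^sup>2 \<le> (\<Sum>i<N. (z i)\<^sup>2)" if "k < N" for k using that by (intro member_le_sum) auto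
    from this[OF that(1)] this[OF that(2)] show ?thesis
      using sum_squares_bound[of "\<bar>z i\<bar>" "\<bar>z j\<bar>"] by (simp add: abs_mult)
  qed
  have "\<bar>\<Sum>i<N. \<Sum>j<N. P i j * (z i * z j)\<bar> \<le> (\<Sum>i<N. \<Sum>j<N. \<bar>P i j * (z i * z j)\<bar>)"
    by (intro order.trans[OF sum_abs] sum_mono sum_abs)
  also have "\<dots> \<le> (\<Sum>i<N. \<Sum>j<N. \<bar>P i j\<bar> * (\<Sum>i<N. (z i)\<^sup>2))"
    using zz by (intro sum_mono) (auto simp: abs_mult intro!: mult_left_mono)
  finally show ?thesis by (simp add: sum_distrib_right)
qed

text \<open>The converse half of Lyapunov's theorem. The value of \<open>P\<close> decreases along the flow of the stable
  companion system and tends to \<open>0\<close>, so it was positive at the start. The flow is replaced by Euler steps of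
  a small fixed length, which avoids solving the differential equation. That the steps tend to \<open>0\<close> is
  shown with an explicit Lyapunov function \<open>W = \<Sum>l<N. \<mu> l |y\<^sub>l|\<^sup>2\<close> in the triangular coordinates
  \<open>y\<^sub>l = (\<Prod>i<l. (d/dt - \<nu>\<^sub>i)) z\<^sub>0\<close>, which satisfy \<open>y\<^sub>l' = \<nu>\<^sub>l y\<^sub>l + y\<^sub>l\<^sub>+\<^sub>1\<close> and
  \<open>y\<^sub>N = 0\<close>; rapidly growing weights absorb the coupling terms.\<close>

lemma companion_lyapunov_positive:
  fixes c :: "real poly" and P :: "nat \<Rightarrow> nat \<Rightarrow> real"
  assumes st: "stable (cpoly c)" and deg: "degree c = N" and monic: "lead_coeff c = 1" and \<eta>: "\<eta> > 0"
    and dec: "\<And>z. (\<Sum>i\<le>N. coeff c i * z i) = 0 \<Longrightarrow>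
      (\<Sum>i<N. \<Sum>j<N. P i j * (z (Suc i) * z j + z i * z (Suc j))) \<le> - \<eta> * (\<Sum>i<N. (z i)\<^sup>2)"
  shows "\<exists>\<kappa>>0. \<forall>z. \<kappa> * (\<Sum>i<N. (z i)\<^sup>2) \<le> (\<Sum>i<N. \<Sum>j<N. P i j * (z i * z j))"
proof -
  obtain \<nu> where \<nu>: "\<And>i. Re (\<nu> i) < 0" "cpoly c = (\<Prod>i<N. [:- \<nu> i, 1:])"
    using stable_poly_factorization[OF st] monic deg by (auto simp: degree_cpoly coeff_cpoly)
  define p where "p l = (\<Prod>i<l. [:- \<nu> i, 1:])" for l
  define T where "T l i = coeff (p l) i" for l i
  have degp: "degree (p l) = l" for l
    unfolding p_def by (subst degree_prod_sum_eq) auto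
  have "lead_coeff (p l) = 1" for l unfolding p_def by (simp add: lead_coeff_prod)
  then have T1: "T l l = 1" for l using degp by (simp add: T_def)
  have T0: "T l i = 0" if "l < i" for l i using that degp by (simp add: T_def coeff_eq_0)
  have TS: "T (Suc l) (Suc i) = T l i - \<nu> l * T l (Suc i)" "T (Suc l) 0 = - \<nu> l * T l 0" for l i
    by (simp_all add: T_def p_def mult.commute[of "prod _ _"])
  define y where "y l z = (\<Sum>i\<le>l. T l i * complex_of_real (z i))" for l and z :: "nat \<Rightarrow> real"
  have yS: "y (Suc l) z = y l (\<lambda>i. z (Suc i)) - \<nu> l * y l z" for l z
  proof -
    have "y (Suc l) z = - \<nu> l * T l 0 * of_real (z 0) + (\<Sum>i\<le>l. (T l i - \<nu> l * T l (Suc i)) * of_real (z (Suc i)))"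
      unfolding y_def by (subst sum.atMost_Suc_shift) (simp add: TS)
    also have "\<dots> = y l (\<lambda>i. z (Suc i)) - \<nu> l * (T l 0 * of_real (z 0) + (\<Sum>i\<le>l. T l (Suc i) * of_real (z (Suc i))))"
      by (simp add: y_def left_diff_distrib sum_subtractf distrib_left sum_distrib_left mult.assoc)
    also have "T l 0 * of_real (z 0) + (\<Sum>i\<le>l. T l (Suc i) * of_real (z (Suc i))) = (\<Sum>i\<le>Suc l. T l i * of_real (z i))"
      by (subst sum.atMost_Suc_shift) simp
    also have "\<dots> = y l z" by (simp add: y_def T0)
    finally show ?thesis .
  qed
  define w where "w z = companion_ext N (coeff c) z" for z
  have w: "w z i = z i" if "i < N" for z i using that by (simp add: w_def companion_ext_def)
  have wN: "w z N = - (\<Sum>j<N. coeff c j * z j)" for z by (simp add: w_def companion_ext_def)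
  have wc: "(\<Sum>i\<le>N. coeff c i * w z i) = 0" for z
    using monic deg by (simp add: lessThan_Suc_atMost[symmetric] w wN)
  have yN: "y N (w z) = 0" for z
  proof -
    have "y N (w z) = of_real (\<Sum>i\<le>N. coeff c i * w z i)"
      unfolding y_def T_def p_def \<nu>(2)[symmetric] coeff_cpoly by simp
    then show ?thesis using wc by simp
  qed
  have yw: "y l (w z) = y l z" if "l < N" for l z
    unfolding y_def using that w by (intro sum.cong) auto
  \<comment> \<open>all roots have real part at most \<open>- \<rho>\<close>; taking \<open>\<rho> \<le> 1\<close> makes the weights \<open>\<mu>\<close> at least 1\<close>
  obtain \<rho> where \<rho>: "0 < \<rho>" "\<rho> \<le> 1" "\<And>l. l < N \<Longrightarrow> Re (\<nu> l) \<le> - \<rho>"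
  proof
    let ?A = "insert 1 ((\<lambda>l. - Re (\<nu> l)) ` {..<N})"
    show "0 < Min ?A" using \<nu>(1) by (subst Min_gr_iff) auto
    show "Min ?A \<le> 1" by (intro Min_le) auto
    show "Re (\<nu> l) \<le> - Min ?A" if "l < N" for l
    proof -
      have "Min ?A \<le> - Re (\<nu> l)" using that by (intro Min_le) auto
      then show ?thesis by (rule le_imp_neg_le[of "Min ?A" "- Re (\<nu> l)", simplified minus_minus])
    qed
  qed
  define \<Lambda> where "\<Lambda> = (\<Sum>l<N. cmod (\<nu> l))"
  have \<Lambda>: "cmod (\<nu> l) \<le> \<Lambda>" if "l < N" for l unfolding \<Lambda>_def using that by (intro member_le_sum) auto
  define \<mu> where "\<mu> l = (2 / \<rho>\<^sup>2) ^ l" for l :: nat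
  have \<mu>1: "1 \<le> \<mu> l" for l
  proof -
    have "\<rho>\<^sup>2 \<le> 1" using \<rho> by (simp add: power_le_one)
    then have "1 \<le> 2 / \<rho>\<^sup>2" using \<rho> by (simp add: field_simps)
    then show ?thesis unfolding \<mu>_def by (rule one_le_power)
  qed
  have \<mu>S: "\<mu> l = (\<rho>\<^sup>2 / 2) * \<mu> (Suc l)" for l using \<rho> by (simp add: \<mu>_def)
  define W where "W z = (\<Sum>l<N. \<mu> l * (cmod (y l z))\<^sup>2)" for z
  define S where "S z = (\<Sum>i<N. (z i)\<^sup>2)" for z :: "nat \<Rightarrow> real"
  define V where "V z = (\<Sum>i<N. \<Sum>j<N. P i j * (z i * z j))" for z
  obtain C where C: "C \<ge> 0" "\<And>z. S z \<le> C * (\<Sum>l<N. (cmod (y l z))\<^sup>2)"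
    using triangular_lower_bound[of T N, OF T1] unfolding S_def y_def by blast
  have SW: "S z \<le> C * W z" for z
  proof -
    have "(\<Sum>l<N. (cmod (y l z))\<^sup>2) \<le> W z" unfolding W_def
      using \<mu>1 by (intro sum_mono) (simp add: mult_le_cancel_right1)
    then show ?thesis using C mult_left_mono order.trans by metis
  qed
  define K where "K = (\<Sum>i<N. \<Sum>j<N. \<bar>P i j\<bar>)"
  have K: "K \<ge> 0" by (simp add: K_def sum_nonneg)
  have VK: "\<bar>V z\<bar> \<le> K * S z" for z unfolding V_def K_def S_def by (rule quadratic_form_upper_bound)
  define L where "L = 1 + (\<Sum>j<N. (coeff c j)\<^sup>2)"
  have L: "L \<ge> 1" by (simp add: L_def sum_nonneg)
  have Sshift: "S (\<lambda>i. w z (Suc i)) \<le> L * S z" for z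
  proof -
    have "(w z N)\<^sup>2 \<le> (\<Sum>j<N. (coeff c j)\<^sup>2) * S z"
      unfolding wN S_def using Cauchy_Schwarz_ineq_sum[of "coeff c" z "{..<N}"] by simp
    moreover have "S (\<lambda>i. w z (Suc i)) + (w z 0)\<^sup>2 = S (w z) + (w z N)\<^sup>2"
      unfolding S_def using sum.lessThan_Suc_shift[of "\<lambda>i. (w z i)\<^sup>2" N] sum.lessThan_Suc[of "\<lambda>i. (w z i)\<^sup>2" N]
      by linarith
    moreover have "S (w z) = S z" by (simp add: S_def w)
    moreover have "0 \<le> (w z 0)\<^sup>2" by simp
    moreover have "L * S z = S z + (\<Sum>j<N. (coeff c j)\<^sup>2) * S z" by (simp only: L_def distrib_right mult_1)
    ultimately show ?thesis by linarith
  qed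
  \<comment> \<open>step length: the terms of second order in \<open>h\<close> must cost at most half of the first-order
    decrease, both for \<open>W\<close> and for the form \<open>V\<close>\<close>
  define h where "h = min (min 1 (\<rho> / (4 * (2 * \<Lambda>\<^sup>2 + \<rho>\<^sup>2)))) (\<eta> / (2 * (K * L + 1)))"
  have KL: "K * L + 1 > 0" using K L by (simp add: add_nonneg_pos)
  have q: "2 * \<Lambda>\<^sup>2 + \<rho>\<^sup>2 > 0" using \<rho> by (simp add: add_nonneg_pos)
  have h: "h > 0" "h \<le> 1" unfolding h_def using \<rho> \<eta> KL q by auto
  have h1: "h * (2 * \<Lambda>\<^sup>2 + \<rho>\<^sup>2) \<le> \<rho> / 4"
  proof -
    have "h \<le> \<rho> / (4 * (2 * \<Lambda>\<^sup>2 + \<rho>\<^sup>2))" unfolding h_def by simp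
    then have "h * (2 * \<Lambda>\<^sup>2 + \<rho>\<^sup>2) \<le> \<rho> / (4 * (2 * \<Lambda>\<^sup>2 + \<rho>\<^sup>2)) * (2 * \<Lambda>\<^sup>2 + \<rho>\<^sup>2)"
      using q by (intro mult_right_mono) auto
    also have "\<dots> = \<rho> / 4"
    proof -
      have "\<rho> / (4 * x) * x = \<rho> / 4" if "x > 0" for x using that by simp
      from this[OF q] show ?thesis .
    qed
    finally show ?thesis .
  qed
  have h2: "h * (K * L) \<le> \<eta> / 2"
  proof -
    have "h \<le> \<eta> / (2 * (K * L + 1))" unfolding h_def by simp
    then have "h * (K * L + 1) \<le> \<eta> / 2" using KL by (simp add: field_simps)
    then show ?thesis using h by (simp add: algebra_simps)
  qed
  define F where "F = euler_step N (coeff c) h"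
  have F: "F z i = w z i + h * w z (Suc i)" for z i by (simp add: F_def euler_step_def w_def)
  have Wstep: "W (F z) \<le> (1 - h * \<rho> / 4) * W z" for z
  proof -
    let ?Y = "\<lambda>l. y l (w z)"
    have yF: "y l (F z) = ?Y l + h * (?Y (Suc l) + \<nu> l * ?Y l)" for l
    proof -
      have "y l (F z) = ?Y l + h * y l (\<lambda>i. w z (Suc i))"
        unfolding y_def F by (simp add: distrib_left sum.distrib sum_distrib_left mult_ac)
      then show ?thesis by (simp add: yS)
    qed
    have step: "(cmod (y l (F z)))\<^sup>2 \<le> (cmod (?Y l))\<^sup>2 * (1 - h * \<rho> + 2 * h\<^sup>2 * \<Lambda>\<^sup>2)
        + (cmod (?Y (Suc l)))\<^sup>2 * (h / \<rho> + 2 * h\<^sup>2)" if l: "l < N" for l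
    proof -
      define a where "a = ?Y l"
      define b where "b = ?Y (Suc l)"
      have id: "(cmod (a + h * u))\<^sup>2 = (cmod a)\<^sup>2 + h * (2 * Re (cnj a * u)) + h\<^sup>2 * (cmod u)\<^sup>2" for u :: complex
        unfolding cmod_power2 by (simp add: power2_eq_square algebra_simps)
      have "Re (cnj a * (b + \<nu> l * a)) = Re (cnj a * b) + Re (\<nu> l) * (cmod a)\<^sup>2"
        unfolding cmod_power2 by (simp add: power2_eq_square algebra_simps)
      also have "\<dots> \<le> cmod a * cmod b - \<rho> * (cmod a)\<^sup>2"
        using complex_Re_le_cmod[of "cnj a * b"] mult_right_mono[OF \<rho>(3)[OF l], of "(cmod a)\<^sup>2"]
        by (simp add: norm_mult)
      finally have cross: "Re (cnj a * (b + \<nu> l * a)) \<le> cmod a * cmod b - \<rho> * (cmod a)\<^sup>2" .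
      have "0 \<le> (\<rho> * cmod a - cmod b)\<^sup>2" by simp
      then have "2 * \<rho> * (cmod a * cmod b) \<le> \<rho> * (\<rho> * (cmod a)\<^sup>2 + (cmod b)\<^sup>2 / \<rho>)"
        using \<rho>(1) by (simp add: power2_eq_square algebra_simps)
      \<comment> \<open>half of the damping \<open>2 \<rho> |a|\<^sup>2\<close> pays for the coupling with the next coordinate\<close>
      then have young: "2 * (cmod a * cmod b) \<le> \<rho> * (cmod a)\<^sup>2 + (cmod b)\<^sup>2 / \<rho>"
        using \<rho>(1) by (metis mult.assoc mult.left_commute mult_le_cancel_left_pos)
      have "cmod (b + \<nu> l * a) \<le> cmod b + \<Lambda> * cmod a"
        using norm_triangle_ineq[of b "\<nu> l * a"] mult_right_mono[OF \<Lambda>[OF l], of "cmod a"] by (simp add: norm_mult)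
      then have "(cmod (b + \<nu> l * a))\<^sup>2 \<le> (cmod b + \<Lambda> * cmod a)\<^sup>2" by (intro power_mono) auto
      also have "\<dots> \<le> 2 * (cmod b)\<^sup>2 + 2 * (\<Lambda> * cmod a)\<^sup>2"
        using sum_squares_bound[of "cmod b" "\<Lambda> * cmod a"] by (simp add: power2_sum)
      finally have quad: "(cmod (b + \<nu> l * a))\<^sup>2 \<le> 2 * (cmod b)\<^sup>2 + 2 * \<Lambda>\<^sup>2 * (cmod a)\<^sup>2" by (simp add: power_mult_distrib)
      have "(cmod (y l (F z)))\<^sup>2 = (cmod a)\<^sup>2 + h * (2 * Re (cnj a * (b + \<nu> l * a))) + h\<^sup>2 * (cmod (b + \<nu> l * a))\<^sup>2"
        unfolding yF a_def[symmetric] b_def[symmetric] by (rule id)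
      also have "\<dots> \<le> (cmod a)\<^sup>2 + h * (\<rho> * (cmod a)\<^sup>2 + (cmod b)\<^sup>2 / \<rho> - 2 * \<rho> * (cmod a)\<^sup>2)
        + h\<^sup>2 * (2 * (cmod b)\<^sup>2 + 2 * \<Lambda>\<^sup>2 * (cmod a)\<^sup>2)"
        using cross young h by (intro add_mono mult_left_mono quad order.refl) auto
      also have "\<dots> = (cmod a)\<^sup>2 * (1 - h * \<rho> + 2 * h\<^sup>2 * \<Lambda>\<^sup>2) + (cmod b)\<^sup>2 * (h / \<rho> + 2 * h\<^sup>2)"
        by (simp add: algebra_simps)
      finally show ?thesis by (simp add: a_def b_def)
    qed
    \<comment> \<open>the weights grow by \<open>2 / \<rho>\<^sup>2\<close>, so the coupling costs half of the damping that is left\<close>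
    have tail: "(\<Sum>l<N. \<mu> l * (cmod (?Y (Suc l)))\<^sup>2) \<le> \<rho>\<^sup>2 / 2 * W z"
    proof -
      have "(\<Sum>l<N. \<mu> (Suc l) * (cmod (?Y (Suc l)))\<^sup>2) + \<mu> 0 * (cmod (?Y 0))\<^sup>2
        = (\<Sum>l<N. \<mu> l * (cmod (?Y l))\<^sup>2) + \<mu> N * (cmod (?Y N))\<^sup>2"
        using sum.lessThan_Suc_shift[of "\<lambda>l. \<mu> l * (cmod (?Y l))\<^sup>2" N]
          sum.lessThan_Suc[of "\<lambda>l. \<mu> l * (cmod (?Y l))\<^sup>2" N] by linarith
      moreover have "(\<Sum>l<N. \<mu> l * (cmod (?Y l))\<^sup>2) = W z" by (simp add: W_def yw)
      moreover have "0 \<le> \<mu> 0 * (cmod (?Y 0))\<^sup>2" by (simp add: \<mu>_def)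
      ultimately have "(\<Sum>l<N. \<mu> (Suc l) * (cmod (?Y (Suc l)))\<^sup>2) \<le> W z" using yN by simp
      moreover have "(\<Sum>l<N. \<mu> l * (cmod (?Y (Suc l)))\<^sup>2) = \<rho>\<^sup>2 / 2 * (\<Sum>l<N. \<mu> (Suc l) * (cmod (?Y (Suc l)))\<^sup>2)"
        unfolding sum_distrib_left by (intro sum.cong refl) (subst \<mu>S, simp)
      ultimately show ?thesis using \<rho> by (simp add: mult_left_mono)
    qed
    have "W (F z) \<le> (\<Sum>l<N. \<mu> l * ((cmod (?Y l))\<^sup>2 * (1 - h * \<rho> + 2 * h\<^sup>2 * \<Lambda>\<^sup>2)
        + (cmod (?Y (Suc l)))\<^sup>2 * (h / \<rho> + 2 * h\<^sup>2)))"
      unfolding W_def using step \<mu>1 by (intro sum_mono mult_left_mono) (auto intro: order.trans[OF zero_le_one])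
    also have "\<dots> = (1 - h * \<rho> + 2 * h\<^sup>2 * \<Lambda>\<^sup>2) * W z + (h / \<rho> + 2 * h\<^sup>2) * (\<Sum>l<N. \<mu> l * (cmod (?Y (Suc l)))\<^sup>2)"
    proof -
      have "W z = (\<Sum>l<N. \<mu> l * (cmod (?Y l))\<^sup>2)" by (simp add: W_def yw)
      then show ?thesis by (simp add: distrib_left sum.distrib sum_distrib_left mult_ac)
    qed
    also have "\<dots> \<le> (1 - h * \<rho> + 2 * h\<^sup>2 * \<Lambda>\<^sup>2) * W z + (h / \<rho> + 2 * h\<^sup>2) * (\<rho>\<^sup>2 / 2 * W z)"
      using tail h \<rho> by (intro add_left_mono mult_left_mono) auto
    also have "\<dots> = (1 - h * \<rho> / 2 + h * (h * (2 * \<Lambda>\<^sup>2 + \<rho>\<^sup>2))) * W z"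
      using \<rho> by (simp add: field_simps power2_eq_square)
    also have "\<dots> \<le> (1 - h * \<rho> / 2 + h * (\<rho> / 4)) * W z"
    proof -
      have "0 \<le> W z" unfolding W_def using \<mu>1 by (intro sum_nonneg mult_nonneg_nonneg) (auto intro: order.trans[OF zero_le_one])
      then show ?thesis using h h1 by (intro mult_right_mono add_left_mono mult_left_mono) auto
    qed
    also have "\<dots> = (1 - h * \<rho> / 4) * W z" by (simp add: algebra_simps)
    finally show ?thesis .
  qed
  have Vstep: "V (F z) \<le> V z - h * \<eta> / 2 * S z" for z
  proof -
    have "V (F z) = V (w z) + h * (\<Sum>i<N. \<Sum>j<N. P i j * (w z (Suc i) * w z j + w z i * w z (Suc j)))
      + h\<^sup>2 * V (\<lambda>i. w z (Suc i))"
      unfolding V_def F sum_distrib_left sum.distrib[symmetric]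
      by (intro sum.cong refl) (simp add: power2_eq_square algebra_simps)
    moreover have "h * (\<Sum>i<N. \<Sum>j<N. P i j * (w z (Suc i) * w z j + w z i * w z (Suc j))) \<le> h * (- \<eta> * S z)"
      using dec[OF wc[of z]] h by (intro mult_left_mono) (auto simp: S_def w)
    moreover have "h\<^sup>2 * V (\<lambda>i. w z (Suc i)) \<le> h * (\<eta> / 2 * S z)"
    proof -
      have "V (\<lambda>i. w z (Suc i)) \<le> K * S (\<lambda>i. w z (Suc i))" using VK[of "\<lambda>i. w z (Suc i)"] by simp
      also have "\<dots> \<le> K * (L * S z)" using Sshift K by (intro mult_left_mono)
      finally have "h * V (\<lambda>i. w z (Suc i)) \<le> h * (K * L) * S z"
        using h mult_left_mono[of _ _ h] by (simp add: mult.assoc)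
      also have "\<dots> \<le> \<eta> / 2 * S z" using h2 by (intro mult_right_mono) (auto simp: S_def sum_nonneg)
      finally show ?thesis using h by (simp add: power2_eq_square mult.assoc)
    qed
    moreover have "V (w z) = V z" by (simp add: V_def w)
    ultimately show ?thesis by (simp add: algebra_simps)
  qed
  have "h * \<eta> / 2 * S z \<le> V z" for z
  proof -
    define r where "r = 1 - h * \<rho> / 4"
    have r: "0 \<le> r" "r < 1" using h \<rho> mult_mono[of h 1 \<rho> 1] by (auto simp: r_def)
    have Wn: "W ((F ^^ n) z) \<le> r ^ n * W z" for n
    proof (induction n)
      case (Suc n)
      have "W ((F ^^ Suc n) z) \<le> r * W ((F ^^ n) z)" using Wstep by (simp add: r_def)
      also have "\<dots> \<le> r * (r ^ n * W z)" using Suc r by (intro mult_left_mono)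
      finally show ?case by (simp add: mult.assoc)
    qed simp
    have Vn: "V ((F ^^ Suc n) z) \<le> V z - h * \<eta> / 2 * S z" for n
    proof (induction n)
      case (Suc n)
      have "0 \<le> h * \<eta> / 2 * S ((F ^^ Suc n) z)" using h \<eta> by (simp add: S_def sum_nonneg)
      then show ?case using Vstep[of "(F ^^ Suc n) z"] Suc by simp
    next
      case 0
      then show ?case using Vstep[of z] by (simp only: funpow.simps comp_apply id_apply)
    qed
    have lower: "- (K * C * W z) * r ^ Suc n \<le> V z - h * \<eta> / 2 * S z" for n
    proof -
      have "K * S ((F ^^ Suc n) z) \<le> K * (C * (r ^ Suc n * W z))"
        using SW[of "(F ^^ Suc n) z"] Wn[of "Suc n"] C(1) K by (intro mult_left_mono) (auto intro: order.trans mult_left_mono)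
      moreover have "- (K * S ((F ^^ Suc n) z)) \<le> V ((F ^^ Suc n) z)" using VK[of "(F ^^ Suc n) z"] by linarith
      ultimately show ?thesis using Vn[of n] by (simp add: mult_ac)
    qed
    have "(\<lambda>n. - (K * C * W z) * r ^ Suc n) \<longlonglongrightarrow> - (K * C * W z) * 0"
      using LIMSEQ_Suc[OF LIMSEQ_realpow_zero[OF r]] by (intro tendsto_mult tendsto_const)
    then have "- (K * C * W z) * 0 \<le> V z - h * \<eta> / 2 * S z"
      by (rule LIMSEQ_le_const2) (use lower in auto)
    then show ?thesis by simp
  qed
  then show ?thesis using h \<eta> unfolding S_def V_def by (intro exI[of _ "h * \<eta> / 2"]) auto
qed

text \<open>The Kalman-Yakubovich-Popov lemma for a chain of integrators with input \<open>c \<cdot> z\<close> and output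
  \<open>g \<cdot> z\<close>: a strictly positive real transfer function makes the system strictly passive, with a positive
  definite storage function. Here \<open>z\<^sub>N\<close> is a free variable that stands for the input.\<close>

theorem companion_kyp:
  fixes c g :: "real poly"
  assumes st: "stable (cpoly c)" and deg: "degree c = N" and monic: "lead_coeff c = 1" and degh: "degree g \<le> N"
    and \<epsilon>: "\<epsilon> > 0" "\<And>\<omega>::real. \<epsilon> \<le> Re (poly (cpoly g) (\<i> * of_real \<omega>) / poly (cpoly c) (\<i> * of_real \<omega>))"
  shows "\<exists>P \<eta>. \<eta> > 0 \<and> (\<forall>i j. P i j = P j i) \<and>
    (\<forall>z. \<eta> * (\<Sum>i<N. (z i)\<^sup>2) \<le> (\<Sum>i<N. \<Sum>j<N. P i j * (z i * z j))) \<and>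
    (\<forall>z. 2 * (\<Sum>i<N. \<Sum>j<N. P i j * (z i * z (Suc j)))
       \<le> 2 * (\<Sum>i\<le>N. coeff c i * z i) * (\<Sum>i\<le>N. coeff g i * z i) - \<eta> * (\<Sum>i\<le>N. (z i)\<^sup>2))"
proof -
  obtain d where d: "d > 0" "\<And>s. 0 \<le> Re s \<Longrightarrow> d * (1 + cmod s) ^ N \<le> cmod (poly (cpoly c) s)"
    using stable_lower_bound[OF st] deg by (auto simp: degree_cpoly)
  \<comment> \<open>chosen so that \<open>\<eta> \<Sum>i\<le>N. \<omega> ^ (2 * i) \<le> 2 \<epsilon> |c(i \<omega>)|\<^sup>2\<close>: each of the \<open>N + 1\<close> powers is at most
    \<open>(1 + |\<omega>|) ^ (2 * N)\<close>\<close>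
  define \<eta> where "\<eta> = 2 * \<epsilon> * d\<^sup>2 / real (Suc N)"
  have \<eta>: "\<eta> > 0" using \<epsilon> d by (simp add: \<eta>_def)
  have pos: "\<eta> * (\<Sum>i\<le>N. \<omega> ^ (2 * i))
      \<le> 2 * Re (poly (cpoly g) (\<i> * of_real \<omega>) * cnj (poly (cpoly c) (\<i> * of_real \<omega>)))" for \<omega> :: real
  proof -
    let ?c = "poly (cpoly c) (\<i> * of_real \<omega>)" and ?g = "poly (cpoly g) (\<i> * of_real \<omega>)"
    have c0: "?c \<noteq> 0" using stable_nonzero[OF st] by simp
    have "\<omega> ^ (2 * i) \<le> ((1 + \<bar>\<omega>\<bar>) ^ N)\<^sup>2" if "i \<le> N" for i
    proof -
      have "\<omega> ^ (2 * i) = \<bar>\<omega>\<bar> ^ (2 * i)" by (simp add: power_mult)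
      also have "\<dots> \<le> (1 + \<bar>\<omega>\<bar>) ^ (2 * i)" by (intro power_mono) auto
      also have "\<dots> \<le> (1 + \<bar>\<omega>\<bar>) ^ (2 * N)" using that by (intro power_increasing) auto
      finally show ?thesis by (simp add: power_mult[symmetric] mult.commute)
    qed
    then have "(\<Sum>i\<le>N. \<omega> ^ (2 * i)) \<le> (\<Sum>i\<le>N. ((1 + \<bar>\<omega>\<bar>) ^ N)\<^sup>2)" by (intro sum_mono) auto
    also have "\<dots> = real (Suc N) * ((1 + \<bar>\<omega>\<bar>) ^ N)\<^sup>2" by simp
    finally have "\<eta> * (\<Sum>i\<le>N. \<omega> ^ (2 * i)) \<le> \<eta> * (real (Suc N) * ((1 + \<bar>\<omega>\<bar>) ^ N)\<^sup>2)"
      using \<eta> by (intro mult_left_mono) auto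
    also have "\<dots> = 2 * \<epsilon> * (d * (1 + \<bar>\<omega>\<bar>) ^ N)\<^sup>2"
      by (simp add: \<eta>_def power_mult_distrib)
    also have "\<dots> \<le> 2 * \<epsilon> * (cmod ?c)\<^sup>2"
      using d(2)[of "\<i> * of_real \<omega>"] d(1) \<epsilon>(1) by (intro mult_left_mono power_mono) (auto simp: norm_mult)
    also have "\<dots> \<le> 2 * (Re (?g / ?c) * (cmod ?c)\<^sup>2)"
      using \<epsilon>(2)[of \<omega>] by (simp add: mult_right_mono del: Re_divide)
    also have "Re (?g / ?c) * (cmod ?c)\<^sup>2 = Re (?g * cnj ?c)"
      using c0 complex_div_cnj[of ?g ?c] by (simp add: Re_divide_of_real[symmetric] flip: of_real_power)
    finally show ?thesis .
  qed
  have "\<exists>\<alpha> \<beta> P. \<forall>z. 2 * (\<Sum>i\<le>N. coeff c i * z i) * (\<Sum>i\<le>N. coeff g i * z i)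
      = (\<Sum>i<N. \<Sum>j<N. P i j * (z (Suc i) * z j + z i * z (Suc j)))
        + (\<Sum>i\<le>N. \<alpha> i * z i)\<^sup>2 + (\<Sum>i\<le>N. \<beta> i * z i)\<^sup>2 + \<eta> * (\<Sum>i\<le>N. (z i)\<^sup>2)"
    by (rule frequency_form_sum_of_two_squares) (use deg degh pos in auto)
  then obtain \<alpha> \<beta> P where P: "\<forall>z. 2 * (\<Sum>i\<le>N. coeff c i * z i) * (\<Sum>i\<le>N. coeff g i * z i)
      = (\<Sum>i<N. \<Sum>j<N. P i j * (z (Suc i) * z j + z i * z (Suc j)))
        + (\<Sum>i\<le>N. \<alpha> i * z i)\<^sup>2 + (\<Sum>i\<le>N. \<beta> i * z i)\<^sup>2 + \<eta> * (\<Sum>i\<le>N. (z i)\<^sup>2)"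
    by (elim exE) (rule that)
  \<comment> \<open>symmetrizing changes neither the form nor its derivative along the chain\<close>
  define Q where "Q i j = (P i j + P j i) / 2" for i j
  have Qz: "(\<Sum>i<N. \<Sum>j<N. Q i j * (z i * z j)) = (\<Sum>i<N. \<Sum>j<N. P i j * (z i * z j))" for z
  proof -
    have "(\<Sum>i<N. \<Sum>j<N. P j i * (z i * z j)) = (\<Sum>i<N. \<Sum>j<N. P i j * (z i * z j))"
      by (subst sum.swap) (simp add: mult.commute)
    moreover have "(\<Sum>i<N. \<Sum>j<N. Q i j * (z i * z j))
      = ((\<Sum>i<N. \<Sum>j<N. P i j * (z i * z j)) + (\<Sum>i<N. \<Sum>j<N. P j i * (z i * z j))) / 2"
      unfolding sum.distrib[symmetric] sum_divide_distrib by (intro sum.cong refl) (simp add: Q_def field_simps)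
    ultimately show ?thesis by simp
  qed
  have Qd: "2 * (\<Sum>i<N. \<Sum>j<N. Q i j * (z i * z (Suc j))) = (\<Sum>i<N. \<Sum>j<N. P i j * (z (Suc i) * z j + z i * z (Suc j)))" for z
  proof -
    have "(\<Sum>i<N. \<Sum>j<N. P j i * (z i * z (Suc j))) = (\<Sum>i<N. \<Sum>j<N. P i j * (z (Suc i) * z j))"
      by (subst sum.swap) (simp add: mult.commute)
    moreover have "2 * (\<Sum>i<N. \<Sum>j<N. Q i j * (z i * z (Suc j)))
      = (\<Sum>i<N. \<Sum>j<N. P i j * (z i * z (Suc j))) + (\<Sum>i<N. \<Sum>j<N. P j i * (z i * z (Suc j)))"
      unfolding sum.distrib[symmetric] sum_distrib_left by (intro sum.cong refl) (simp add: Q_def field_simps)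
    ultimately show ?thesis by (simp add: distrib_left sum.distrib)
  qed
  have dec: "2 * (\<Sum>i<N. \<Sum>j<N. Q i j * (z i * z (Suc j)))
       \<le> 2 * (\<Sum>i\<le>N. coeff c i * z i) * (\<Sum>i\<le>N. coeff g i * z i) - \<eta> * (\<Sum>i\<le>N. (z i)\<^sup>2)" for z
  proof -
    have "0 \<le> (\<Sum>i\<le>N. \<alpha> i * z i)\<^sup>2" "0 \<le> (\<Sum>i\<le>N. \<beta> i * z i)\<^sup>2" by simp_all
    then show ?thesis using P[rule_format, of z] Qd[of z] by linarith
  qed
  have "\<exists>\<kappa>>0. \<forall>z. \<kappa> * (\<Sum>i<N. (z i)\<^sup>2) \<le> (\<Sum>i<N. \<Sum>j<N. P i j * (z i * z j))"
  proof (rule companion_lyapunov_positive[OF st deg monic \<eta>])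
    fix z assume "(\<Sum>i\<le>N. coeff c i * z i) = 0"
    then have "(\<Sum>i<N. \<Sum>j<N. P i j * (z (Suc i) * z j + z i * z (Suc j))) \<le> - \<eta> * (\<Sum>i\<le>N. (z i)\<^sup>2)"
      using dec[of z] Qd[of z] by simp
    also have "\<dots> \<le> - \<eta> * (\<Sum>i<N. (z i)\<^sup>2)"
      using \<eta> by (simp add: lessThan_Suc_atMost[symmetric])
    finally show "(\<Sum>i<N. \<Sum>j<N. P i j * (z (Suc i) * z j + z i * z (Suc j))) \<le> - \<eta> * (\<Sum>i<N. (z i)\<^sup>2)" .
  qed
  then obtain \<kappa> where \<kappa>: "\<kappa> > 0" "\<And>z. \<kappa> * (\<Sum>i<N. (z i)\<^sup>2) \<le> (\<Sum>i<N. \<Sum>j<N. Q i j * (z i * z j))"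
    unfolding Qz by blast
  show ?thesis
  proof (intro exI[of _ Q] exI[of _ "min \<eta> \<kappa>"] conjI allI)
    show "0 < min \<eta> \<kappa>" using \<eta> \<kappa> by simp
    show "Q i j = Q j i" for i j by (simp add: Q_def)
    show "min \<eta> \<kappa> * (\<Sum>i<N. (z i)\<^sup>2) \<le> (\<Sum>i<N. \<Sum>j<N. Q i j * (z i * z j))" for z
      by (rule order.trans[OF mult_right_mono \<kappa>(2)]) (auto intro: sum_nonneg)
    show "2 * (\<Sum>i<N. \<Sum>j<N. Q i j * (z i * z (Suc j)))
       \<le> 2 * (\<Sum>i\<le>N. coeff c i * z i) * (\<Sum>i\<le>N. coeff g i * z i) - min \<eta> \<kappa> * (\<Sum>i\<le>N. (z i)\<^sup>2)" for z
      by (rule order.trans[OF dec]) (auto intro!: mult_right_mono sum_nonneg)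
  qed
qed

section \<open>Transfer functions and realizations\<close>

lemma mat_inverse_of_nonsingular:
  assumes M: "M \<in> carrier_mat d d" and det: "Determinant.det M \<noteq> (0 :: 'a :: field)"
  obtains W where "mat_inverse M = Some W" "W \<in> carrier_mat d d" "W * M = 1\<^sub>m d" "M * W = 1\<^sub>m d"
proof -
  have "M \<in> Units (ring_mat TYPE('a) d ())" by (rule det_non_zero_imp_unit[OF M det])
  then obtain W where W: "mat_inverse M = Some W"
    using mat_inverse(1)[OF M, where b = "()"] by (cases "mat_inverse M") auto
  then show ?thesis using mat_inverse(2)[OF M W] that by blast
qed

lemma resolvent_carrier: "A \<in> carrier_mat N N \<Longrightarrow> resolvent_mat N A s \<in> carrier_mat N N"
  unfolding resolvent_mat_def by (intro minus_carrier_mat) auto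

lemma resolvent_mult_vec:
  assumes "A \<in> carrier_mat N N" "a < N"
  shows "vec_index (resolvent_mat N A s *\<^sub>v Matrix.vec N v) a = s * v a - (\<Sum>b<N. of_real (A $$ (a, b)) * v b)"
proof -
  have "vec_index (resolvent_mat N A s *\<^sub>v Matrix.vec N v) a = (\<Sum>b<N. (s * (if a = b then 1 else 0) - of_real (A $$ (a, b))) * v b)"
    using assms by (simp add: resolvent_mat_def scalar_prod_def atLeast0LessThan)
  also have "\<dots> = (\<Sum>b<N. (if a = b then s * v b else 0)) - (\<Sum>b<N. of_real (A $$ (a, b)) * v b)"
    unfolding sum_subtractf[symmetric] by (intro sum.cong) (auto simp: algebra_simps)
  finally show ?thesis using assms by simp
qed

text \<open>Evaluates the transfer function without inverting a matrix: any solution \<open>v\<close> of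
  \<open>(s - A) v = p B\<close> will do. The factor \<open>p\<close> allows \<open>v\<close> to be polynomial in \<open>s\<close>.\<close>

lemma transfer_function_from_solution:
  assumes ss: "state_space N A B C" and det: "Determinant.det (resolvent_mat N A s) \<noteq> 0"
    and sol: "\<And>a. a < N \<Longrightarrow> s * v a - (\<Sum>b<N. of_real (A $$ (a, b)) * v b) = p * of_real (vec_index B a)"
  shows "p * transfer_function N A B C D s = (\<Sum>a<N. of_real (vec_index C a) * v a) + p * of_real D"
proof -
  let ?R = "resolvent_mat N A s" and ?B = "map_vec complex_of_real B" and ?C = "map_vec complex_of_real C"
  let ?x = "the (mat_inverse ?R) *\<^sub>v ?B"
  have A: "A \<in> carrier_mat N N" and B: "B \<in> carrier_vec N" and C: "C \<in> carrier_vec N"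
    using ss by (auto simp: state_space_def)
  have R: "?R \<in> carrier_mat N N" using A by (rule resolvent_carrier)
  obtain W where W: "W \<in> carrier_mat N N" "the (mat_inverse ?R) = W" "W * ?R = 1\<^sub>m N"
    using mat_inverse_of_nonsingular[OF R det] by (metis option.sel)
  have "?R *\<^sub>v Matrix.vec N v = p \<cdot>\<^sub>v ?B"
    using A B R sol by (intro eq_vecI) (simp_all add: resolvent_mult_vec del: index_mult_mat_vec)
  then have "W *\<^sub>v (p \<cdot>\<^sub>v ?B) = Matrix.vec N v"
    using assoc_mult_mat_vec[OF W(1) R, of "Matrix.vec N v"] W(3) by simp
  then have "p \<cdot>\<^sub>v ?x = Matrix.vec N v" using W B by (simp add: mult_mat_vec)
  then have "scalar_prod ?C (p \<cdot>\<^sub>v ?x) = (\<Sum>a<N. of_real (vec_index C a) * v a)"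
    using C by (simp add: scalar_prod_def atLeast0LessThan)
  moreover have "scalar_prod ?C (p \<cdot>\<^sub>v ?x) = p * scalar_prod ?C ?x"
    using C W B by (intro scalar_prod_smult_distrib[of _ N]) auto
  ultimately show ?thesis by (simp add: transfer_function_def distrib_left)
qed

lemma det_zero_from_kernel:
  assumes A: "A \<in> carrier_mat N N" and nz: "\<exists>a<N. v a \<noteq> 0"
    and sol: "\<And>a. a < N \<Longrightarrow> s * v a - (\<Sum>b<N. of_real (A $$ (a, b)) * v b) = 0"
  shows "Determinant.det (resolvent_mat N A s) = 0"
proof -
  have "resolvent_mat N A s *\<^sub>v Matrix.vec N v = 0\<^sub>v N"
    using resolvent_carrier[OF A, of s] A sol by (intro eq_vecI) (simp_all add: resolvent_mult_vec del: index_mult_mat_vec)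
  moreover have "Matrix.vec N v \<noteq> 0\<^sub>v N"
  proof
    assume "Matrix.vec N v = 0\<^sub>v N"
    then have "vec_index (Matrix.vec N v) a = vec_index (0\<^sub>v N) a" for a by simp
    then show False using nz by (metis index_vec index_zero_vec(1))
  qed
  ultimately show ?thesis using det_0_iff_vec_prod_zero[OF resolvent_carrier[OF A]]
    by (metis vec_carrier)
qed

lemma finite_resolvent_singular:
  assumes A: "A \<in> carrier_mat N N"
  shows "finite {s. Determinant.det (resolvent_mat N A s) = 0}"
proof (rule finite_subset)
  let ?A = "map_mat complex_of_real A"
  have A': "?A \<in> carrier_mat N N" using A by simp
  show "{s. Determinant.det (resolvent_mat N A s) = 0} \<subseteq> {s. poly (char_poly ?A) s = 0}"
  proof
    fix s assume "s \<in> {s. Determinant.det (resolvent_mat N A s) = 0}"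
    then obtain v where v: "v \<in> carrier_vec N" "v \<noteq> 0\<^sub>v N" "resolvent_mat N A s *\<^sub>v v = 0\<^sub>v N"
      using det_0_iff_vec_prod_zero[OF resolvent_carrier[OF A]] by auto
    have "?A *\<^sub>v v = s \<cdot>\<^sub>v v"
    proof (rule eq_vecI)
      fix a assume a: "a < dim_vec (s \<cdot>\<^sub>v v)"
      then have aN: "a < N" using v by simp
      have "v = Matrix.vec N (vec_index v)" using v by auto
      then have "s * vec_index v a - (\<Sum>b<N. of_real (A $$ (a, b)) * vec_index v b) = vec_index (0\<^sub>v N) a"
        using resolvent_mult_vec[OF A aN, of s "vec_index v"] v(3) by simp
      then show "vec_index (?A *\<^sub>v v) a = vec_index (s \<cdot>\<^sub>v v) a"
        using aN A v(1) by (simp add: scalar_prod_def atLeast0LessThan)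
    qed (use A v in auto)
    then have "eigenvalue ?A s" using v A unfolding eigenvalue_def eigenvector_def by auto
    then show "s \<in> {s. poly (char_poly ?A) s = 0}" using eigenvalue_root_char_poly[OF A'] by simp
  qed
  show "finite {s. poly (char_poly ?A) s = 0}"
    using degree_monic_char_poly[OF A'] by (intro poly_roots_finite) auto
qed

text \<open>A denominator of degree \<open>d\<close> yields the controllable canonical form of dimension \<open>d\<close>. The vector
  \<open>(1, s, \<dots>, s\<^sup>d\<^sup>-\<^sup>1)\<close> solves the resolvent equation with right hand side \<open>p(s) B\<close>.\<close>

lemma companion_realization:
  fixes p q :: "real poly"
  assumes d: "degree p = d" and monic: "lead_coeff p = 1" and q: "degree q \<le> d" and eq: "q * f = g * p"
  shows "\<exists>A B C D. realizes d A B C D g f"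
proof -
  define A where "A = mat d d (\<lambda>(i, j). if Suc i < d then (if j = Suc i then 1 else 0) else - coeff p j)"
  define B where "B = Matrix.vec d (\<lambda>i. if Suc i = d then 1 else (0::real))"
  define D where "D = coeff q d"
  define C where "C = Matrix.vec d (\<lambda>i. coeff q i - D * coeff p i)"
  have A: "A \<in> carrier_mat d d" by (simp add: A_def)
  have ss: "state_space d A B C" by (simp add: state_space_def A_def B_def C_def)
  have ps: "poly (cpoly r) s = (\<Sum>i<d. of_real (coeff r i) * s ^ i) + of_real (coeff r d) * s ^ d" if "degree r \<le> d" for r s
  proof -
    have "poly (cpoly r) s = (\<Sum>i\<le>d. coeff (cpoly r) i * s ^ i)"
      unfolding poly_altdef using that by (intro sum.mono_neutral_left) (auto simp: coeff_eq_0 degree_cpoly)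
    then show ?thesis by (simp add: coeff_cpoly lessThan_Suc_atMost[symmetric])
  qed
  have sol: "s * s ^ a - (\<Sum>b<d. of_real (A $$ (a, b)) * s ^ b) = poly (cpoly p) s * of_real (vec_index B a)" if a: "a < d" for a s
  proof (cases "Suc a < d")
    case True
    then have "(\<Sum>b<d. of_real (A $$ (a, b)) * s ^ b) = (\<Sum>b<d. if b = Suc a then s ^ b else 0)"
      using a by (intro sum.cong) (auto simp: A_def)
    then show ?thesis using True a by (simp add: B_def)
  next
    case False
    then have ad: "Suc a = d" using a by simp
    have "(\<Sum>b<d. of_real (A $$ (a, b)) * s ^ b) = - (\<Sum>b<d. of_real (coeff p b) * s ^ b)"
      unfolding sum_negf[symmetric] using a False by (intro sum.cong) (auto simp: A_def)
    moreover have "s * s ^ a = s ^ d" using ad by auto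
    ultimately show ?thesis using ps[of p s] d monic ad a by (simp add: B_def)
  qed
  show ?thesis
  proof (intro exI)
    show "realizes d A B C D g f"
      unfolding realizes_def
    proof (intro conjI ss allI impI)
      fix s assume "Determinant.det (resolvent_mat d A s) \<noteq> 0 \<and> poly (cpoly f) s \<noteq> 0"
      then have det: "Determinant.det (resolvent_mat d A s) \<noteq> 0" and fs: "poly (cpoly f) s \<noteq> 0" by auto
      have p0: "poly (cpoly p) s \<noteq> 0"
      proof
        assume p0: "poly (cpoly p) s = 0"
        have "d \<noteq> 0" using p0 ps[of p s] d monic by (cases "d = 0") auto
        then have "\<exists>a<d. s ^ a \<noteq> 0" by (intro exI[of _ 0]) auto
        then show False using det_zero_from_kernel[OF A, of "\<lambda>a. s ^ a" s] sol[of _ s] p0 det by simp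
      qed
      have "poly (cpoly p) s * transfer_function d A B C D s
        = (\<Sum>a<d. of_real (vec_index C a) * s ^ a) + poly (cpoly p) s * of_real D"
        by (rule transfer_function_from_solution[OF ss det sol])
      also have "(\<Sum>a<d. of_real (vec_index C a) * s ^ a)
        = (\<Sum>a<d. of_real (coeff q a) * s ^ a) - of_real D * (\<Sum>a<d. of_real (coeff p a) * s ^ a)"
        unfolding sum_distrib_left sum_subtractf[symmetric] by (intro sum.cong) (auto simp: C_def algebra_simps)
      also have "\<dots> + poly (cpoly p) s * of_real D = poly (cpoly q) s"
        using ps[of q s] ps[of p s] q d monic by (simp add: D_def algebra_simps)
      finally have pT: "poly (cpoly p) s * transfer_function d A B C D s = poly (cpoly q) s" .
      have qf: "poly (cpoly q) s * poly (cpoly f) s = poly (cpoly g) s * poly (cpoly p) s"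
        by (metis eq cpoly_simps(4) poly_mult)
      show "transfer_function d A B C D s = poly (cpoly g) s / poly (cpoly f) s"
      proof -
        have "poly (cpoly p) s * (poly (cpoly f) s * transfer_function d A B C D s)
          = poly (cpoly f) s * (poly (cpoly p) s * transfer_function d A B C D s)" by (simp only: mult_ac)
        also have "\<dots> = poly (cpoly p) s * poly (cpoly g) s"
          unfolding pT using qf by (simp only: mult.commute)
        finally show ?thesis using p0 fs by (simp add: field_simps)
      qed
    qed
  qed
qed

lemma minimal_realization_le_degree:
  fixes p q :: "real poly"
  assumes min: "minimal_realization N A B C D g f" and "p \<noteq> 0" "degree q \<le> degree p" "q * f = g * p"
  shows "N \<le> degree p"
proof -
  let ?k = "inverse (lead_coeff p)"
  have "\<exists>A B C D. realizes (degree p) A B C D g f"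
  proof (rule companion_realization[of "Polynomial.smult ?k p" _ "Polynomial.smult ?k q"])
    show "Polynomial.smult ?k q * f = g * Polynomial.smult ?k p" using assms(4) by simp
  qed (use assms in auto)
  then show ?thesis using min unfolding minimal_realization_def by blast
qed

section \<open>Krylov vectors and companion coordinates\<close>

primrec krylov :: "nat \<Rightarrow> real mat \<Rightarrow> real Matrix.vec \<Rightarrow> nat \<Rightarrow> nat \<Rightarrow> real" where
  "krylov N A B 0 a = vec_index B a"
| "krylov N A B (Suc l) a = (\<Sum>b<N. A $$ (a, b) * krylov N A B l b)"

text \<open>Horner tails of \<open>c(A) B\<close>: \<open>u\<^sub>i = \<Sum>l. c\<^sub>l\<^sub>+\<^sub>i A\<^sup>l B\<close>. They satisfy
  \<open>A u\<^sub>i\<^sub>+\<^sub>1 = u\<^sub>i - c\<^sub>i B\<close>, which is the companion form of \<open>A\<close>.\<close>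

definition krylov_tail :: "nat \<Rightarrow> real mat \<Rightarrow> real Matrix.vec \<Rightarrow> real poly \<Rightarrow> nat \<Rightarrow> nat \<Rightarrow> nat \<Rightarrow> real" where
  "krylov_tail N A B c d i a = (\<Sum>l<Suc d - i. coeff c (l + i) * krylov N A B l a)"

lemma krylov_tail_step:
  assumes "i \<le> d"
  shows "(\<Sum>b<N. A $$ (a, b) * krylov_tail N A B c d (Suc i) b) = krylov_tail N A B c d i a - coeff c i * vec_index B a"
proof -
  have "(\<Sum>b<N. A $$ (a, b) * krylov_tail N A B c d (Suc i) b)
    = (\<Sum>b<N. \<Sum>l<d - i. coeff c (Suc (l + i)) * (A $$ (a, b) * krylov N A B l b))"
    unfolding krylov_tail_def sum_distrib_left by (intro sum.cong) (auto simp: mult_ac)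
  also have "\<dots> = (\<Sum>l<d - i. coeff c (Suc (l + i)) * krylov N A B (Suc l) a)"
    by (subst sum.swap) (simp add: sum_distrib_left)
  also have "\<dots> = krylov_tail N A B c d i a - coeff c i * vec_index B a"
    unfolding krylov_tail_def Suc_diff_le[OF assms] by (subst sum.lessThan_Suc_shift) simp
  finally show ?thesis .
qed

lemma krylov_tail_top: "krylov_tail N A B c d d a = coeff c d * vec_index B a"
  by (simp add: krylov_tail_def)

text \<open>The numerator of the transfer function over the denominator \<open>c\<close>, provided that \<open>c(A) B = 0\<close>.\<close>

definition krylov_numerator ::
  "nat \<Rightarrow> real mat \<Rightarrow> real Matrix.vec \<Rightarrow> real Matrix.vec \<Rightarrow> real \<Rightarrow> real poly \<Rightarrow> nat \<Rightarrow> real poly" where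
  "krylov_numerator N A B C D c d =
    (\<Sum>i<d. monom (\<Sum>a<N. vec_index C a * krylov_tail N A B c d (Suc i) a) i) + Polynomial.smult D c"

text \<open>Every polynomial \<open>c\<close> with \<open>c(A) B = 0\<close> is a denominator of \<open>g / f\<close>, because
  \<open>\<Sum>i<d. s\<^sup>i u\<^sub>i\<^sub>+\<^sub>1\<close> solves \<open>(s - A) v = c(s) B\<close>. The identity holds wherever both sides are
  defined, hence as an identity of polynomials.\<close>

lemma krylov_annihilator_transfer:
  assumes re: "realizes N A B C D g f" and f: "f \<noteq> 0" and deg: "degree c \<le> d"
    and ann: "\<And>a. a < N \<Longrightarrow> (\<Sum>l\<le>d. coeff c l * krylov N A B l a) = 0"
  shows "krylov_numerator N A B C D c d * f = g * c"
proof -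
  let ?q = "krylov_numerator N A B C D c d" and ?u = "krylov_tail N A B c d"
  have ss: "state_space N A B C" using re by (simp add: realizes_def)
  then have A: "A \<in> carrier_mat N N" by (simp add: state_space_def)
  have u0: "?u 0 a = 0" if "a < N" for a using ann[OF that] by (simp add: krylov_tail_def lessThan_Suc_atMost)
  have val: "poly (cpoly c) s * transfer_function N A B C D s = poly (cpoly ?q) s"
    if det: "Determinant.det (resolvent_mat N A s) \<noteq> 0" for s
  proof -
    have "poly (cpoly c) s * transfer_function N A B C D s
      = (\<Sum>a<N. of_real (vec_index C a) * (\<Sum>i<d. of_real (?u (Suc i) a) * s ^ i)) + poly (cpoly c) s * of_real D"
    proof (rule transfer_function_from_solution[OF ss det])
      fix a assume a: "a < N"
      have "(\<Sum>b<N. of_real (A $$ (a, b)) * (\<Sum>i<d. of_real (?u (Suc i) b) * s ^ i))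
        = (\<Sum>b<N. \<Sum>i<d. of_real (A $$ (a, b) * ?u (Suc i) b) * s ^ i)"
        unfolding sum_distrib_left by (simp add: mult.assoc)
      also have "\<dots> = (\<Sum>i<d. of_real (\<Sum>b<N. A $$ (a, b) * ?u (Suc i) b) * s ^ i)"
        by (subst sum.swap) (simp add: sum_distrib_right)
      also have "\<dots> = (\<Sum>i<d. (of_real (?u i a) - of_real (coeff c i * vec_index B a)) * s ^ i)"
        by (intro sum.cong refl) (subst krylov_tail_step, auto)
      also have "\<dots> = (\<Sum>i<d. of_real (?u i a) * s ^ i) - (\<Sum>i<d. of_real (coeff c i) * s ^ i) * of_real (vec_index B a)"
        by (simp add: algebra_simps sum_subtractf sum_distrib_left)
      also have "(\<Sum>i<d. of_real (?u i a) * s ^ i)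
          = s * (\<Sum>i<d. of_real (?u (Suc i) a) * s ^ i) - of_real (coeff c d * vec_index B a) * s ^ d"
      proof -
        have "(\<Sum>i<Suc d. of_real (?u i a) * s ^ i) = of_real (?u 0 a) + (\<Sum>i<d. of_real (?u (Suc i) a) * s ^ Suc i)"
          by (subst sum.lessThan_Suc_shift) simp
        then show ?thesis using u0[OF a] by (simp add: krylov_tail_top sum_distrib_left mult_ac algebra_simps)
      qed
      finally have "s * (\<Sum>i<d. of_real (?u (Suc i) a) * s ^ i)
          - (\<Sum>b<N. of_real (A $$ (a, b)) * (\<Sum>i<d. of_real (?u (Suc i) b) * s ^ i))
        = ((\<Sum>i<d. of_real (coeff c i) * s ^ i) + of_real (coeff c d) * s ^ d) * of_real (vec_index B a)"
        by (simp add: algebra_simps)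
      also have "(\<Sum>i<d. of_real (coeff c i) * s ^ i) + of_real (coeff c d) * s ^ d = poly (cpoly c) s"
      proof -
        have "poly (cpoly c) s = (\<Sum>i\<le>d. coeff (cpoly c) i * s ^ i)"
          unfolding poly_altdef using deg by (intro sum.mono_neutral_left) (auto simp: coeff_eq_0 degree_cpoly)
        then show ?thesis by (simp add: coeff_cpoly lessThan_Suc_atMost[symmetric])
      qed
      finally show "s * (\<Sum>i<d. of_real (?u (Suc i) a) * s ^ i)
          - (\<Sum>b<N. of_real (A $$ (a, b)) * (\<Sum>i<d. of_real (?u (Suc i) b) * s ^ i))
        = poly (cpoly c) s * of_real (vec_index B a)" .
    qed
    also have "(\<Sum>a<N. of_real (vec_index C a) * (\<Sum>i<d. of_real (?u (Suc i) a) * s ^ i))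
      = (\<Sum>i<d. of_real (\<Sum>a<N. vec_index C a * ?u (Suc i) a) * s ^ i)"
      unfolding sum_distrib_left by (subst sum.swap) (simp add: sum_distrib_left sum_distrib_right mult_ac)
    also have "\<dots> + poly (cpoly c) s * of_real D = poly (cpoly ?q) s"
    proof -
      have "cpoly (sum h {..<d}) = (\<Sum>i<d. cpoly (h i))" for h :: "nat \<Rightarrow> real poly" and d :: nat
        by (induction d) (simp_all add: cpoly_simps)
      moreover have "cpoly (monom x i) = monom (of_real x) i" for x i
        by (simp add: cpoly_def map_poly_monom)
      ultimately show ?thesis
        by (simp add: krylov_numerator_def cpoly_simps poly_sum poly_monom mult.commute)
    qed
    finally show ?thesis .
  qed
  have "infinite (UNIV :: complex set)" by (rule infinite_UNIV_char_0)
  moreover have "UNIV \<subseteq> {s. Determinant.det (resolvent_mat N A s) = 0} \<union> {s. poly (cpoly f) s = 0}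
    \<union> {s. poly (cpoly (?q * f - g * c)) s = 0}"
  proof
    fix s
    show "s \<in> {s. Determinant.det (resolvent_mat N A s) = 0} \<union> {s. poly (cpoly f) s = 0}
      \<union> {s. poly (cpoly (?q * f - g * c)) s = 0}"
    proof (cases "Determinant.det (resolvent_mat N A s) = 0 \<or> poly (cpoly f) s = 0")
      case False
      then have "transfer_function N A B C D s = poly (cpoly g) s / poly (cpoly f) s"
        using re by (simp add: realizes_def)
      then have "poly (cpoly c) s * poly (cpoly g) s = poly (cpoly ?q) s * poly (cpoly f) s"
        using val[of s] False by (simp add: field_simps)
      moreover have "poly (cpoly (?q * f)) s = poly (cpoly (?q * f - g * c)) s + poly (cpoly (g * c)) s"
        unfolding poly_add[symmetric] cpoly_simps(3)[symmetric] by (simp only: diff_add_cancel)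
      ultimately have "poly (cpoly (?q * f - g * c)) s = 0"
        unfolding cpoly_simps(4) poly_mult by (simp add: mult.commute)
      then show ?thesis by simp
    qed auto
  qed
  moreover have "finite {s. poly (cpoly f) s = 0}"
    using f by (intro poly_roots_finite) (metis degree_cpoly coeff_cpoly leading_coeff_0_iff of_real_eq_0_iff)
  ultimately have "infinite {s. poly (cpoly (?q * f - g * c)) s = 0}"
    using finite_resolvent_singular[OF A] by (meson finite_UnI finite_subset)
  then have "cpoly (?q * f - g * c) = 0" using poly_roots_finite by blast
  then have "?q * f - g * c = 0" by (metis degree_cpoly coeff_cpoly leading_coeff_0_iff of_real_eq_0_iff)
  then show ?thesis by simp
qed

lemma degree_krylov_numerator: "degree c \<le> d \<Longrightarrow> degree (krylov_numerator N A B C D c d) \<le> d"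
  unfolding krylov_numerator_def
  by (intro degree_add_le degree_sum_le) (auto intro: order.trans[OF degree_monom_le] order.trans[OF degree_smult_le])

lemma coeff_krylov_numerator:
  "i < d \<Longrightarrow> coeff (krylov_numerator N A B C D c d) i = (\<Sum>a<N. vec_index C a * krylov_tail N A B c d (Suc i) a) + D * coeff c i"
  "coeff (krylov_numerator N A B C D c d) d = D * coeff c d"
  by (simp_all add: krylov_numerator_def coeff_sum)

text \<open>Minimality gives controllability: a linear relation between \<open>B, A B, \<dots>, A\<^sup>N\<^sup>-\<^sup>1 B\<close> would be a
  denominator of degree below \<open>N\<close>, and hence produce a realization of smaller dimension.\<close>

lemma minimal_krylov_independent:
  assumes min: "minimal_realization N A B C D g f" and f: "f \<noteq> 0"
    and dep: "\<And>a. a < N \<Longrightarrow> (\<Sum>l<N. e l * krylov N A B l a) = 0" and l: "l < N"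
  shows "e l = 0"
proof (rule ccontr)
  assume "e l \<noteq> 0"
  define c where "c = (\<Sum>l<N. monom (e l) l)"
  have cc: "coeff c i = (if i < N then e i else 0)" for i by (simp add: c_def coeff_sum)
  have c0: "c \<noteq> 0" using cc[of l] l \<open>e l \<noteq> 0\<close> by auto
  then have dN: "degree c < N" using cc[of "degree c"] by (metis leading_coeff_0_iff)
  have "(\<Sum>l\<le>degree c. coeff c l * krylov N A B l a) = 0" if a: "a < N" for a
  proof -
    have "(\<Sum>l<N. e l * krylov N A B l a) = (\<Sum>l<N. coeff c l * krylov N A B l a)" by (simp add: cc)
    also have "\<dots> = (\<Sum>l\<le>degree c. coeff c l * krylov N A B l a)"
      using dN by (intro sum.mono_neutral_right) (auto simp: coeff_eq_0)
    finally show ?thesis using dep[OF a] by simp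
  qed
  then have "krylov_numerator N A B C D c (degree c) * f = g * c"
    using min f by (intro krylov_annihilator_transfer) (auto simp: minimal_realization_def)
  then have "N \<le> degree c"
    by (intro minimal_realization_le_degree[OF min c0 degree_krylov_numerator]) auto
  then show False using dN by simp
qed

lemma independent_columns_inverse:
  fixes u :: "nat \<Rightarrow> nat \<Rightarrow> real"
  assumes "\<And>e. (\<And>a. a < N \<Longrightarrow> (\<Sum>l<N. e l * u l a) = 0) \<Longrightarrow> (\<And>l. l < N \<Longrightarrow> e l = 0)"
  shows "\<exists>Z. (\<forall>x. \<forall>a<N. (\<Sum>l<N. (\<Sum>b<N. Z l b * x b) * u l a) = x a)
    \<and> (\<forall>e. \<forall>l<N. (\<Sum>b<N. Z l b * (\<Sum>k<N. e k * u k b)) = e l)"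
proof -
  define M where "M = mat N N (\<lambda>(a, l). u l a)"
  have M: "M \<in> carrier_mat N N" by (simp add: M_def)
  have "Determinant.det M \<noteq> 0"
  proof
    assume "Determinant.det M = 0"
    then obtain v where v: "v \<in> carrier_vec N" "v \<noteq> 0\<^sub>v N" "M *\<^sub>v v = 0\<^sub>v N"
      using det_0_iff_vec_prod_zero[OF M] by auto
    have "(\<Sum>l<N. vec_index v l * u l a) = 0" if "a < N" for a
    proof -
      have "vec_index (M *\<^sub>v v) a = (\<Sum>l<N. vec_index v l * u l a)"
        using that v(1) by (simp add: M_def scalar_prod_def atLeast0LessThan mult.commute)
      then show ?thesis using v(3) that by simp
    qed
    then have "vec_index v l = 0" if "l < N" for l using assms[of "vec_index v" l] that by blast
    then have "v = 0\<^sub>v N" using v(1) by (intro eq_vecI) auto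
    then show False using v by simp
  qed
  then obtain W where W: "W \<in> carrier_mat N N" "W * M = 1\<^sub>m N" "M * W = 1\<^sub>m N"
    using mat_inverse_of_nonsingular[OF M] by metis
  define Z where "Z l b = W $$ (l, b)" for l b
  have mw: "(\<Sum>l<N. u l a * Z l b) = (if a = b then 1 else 0)" if "a < N" "b < N" for a b
  proof -
    have "(M * W) $$ (a, b) = (\<Sum>l<N. u l a * Z l b)"
      using that M W(1) by (simp add: scalar_prod_def M_def Z_def atLeast0LessThan)
    then show ?thesis using W(3) that by simp
  qed
  have wm: "(\<Sum>b<N. Z l b * u k b) = (if l = k then 1 else 0)" if "l < N" "k < N" for l k
  proof -
    have "(W * M) $$ (l, k) = (\<Sum>b<N. Z l b * u k b)"
      using that M W(1) by (simp add: scalar_prod_def M_def Z_def atLeast0LessThan)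
    then show ?thesis using W(2) that by simp
  qed
  show ?thesis
  proof (intro exI[of _ Z] conjI allI impI)
    fix x :: "nat \<Rightarrow> real" and a assume a: "a < N"
    have "(\<Sum>l<N. (\<Sum>b<N. Z l b * x b) * u l a) = (\<Sum>b<N. (\<Sum>l<N. u l a * Z l b) * x b)"
      unfolding sum_distrib_right by (subst sum.swap) (simp add: mult_ac)
    also have "\<dots> = (\<Sum>b<N. if a = b then x b else 0)" using mw[OF a] by (intro sum.cong) auto
    finally show "(\<Sum>l<N. (\<Sum>b<N. Z l b * x b) * u l a) = x a" using a by simp
  next
    fix e :: "nat \<Rightarrow> real" and l assume l: "l < N"
    have "(\<Sum>b<N. Z l b * (\<Sum>k<N. e k * u k b)) = (\<Sum>k<N. e k * (\<Sum>b<N. Z l b * u k b))"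
      unfolding sum_distrib_left by (subst sum.swap) (simp add: mult_ac)
    also have "\<dots> = (\<Sum>k<N. if l = k then e k else 0)" using wm[OF l] by (intro sum.cong) auto
    finally show "(\<Sum>b<N. Z l b * (\<Sum>k<N. e k * u k b)) = e l" using l by simp
  qed
qed

text \<open>The Horner tails \<open>u\<^sub>1, \<dots>, u\<^sub>N\<close> of the annihilating polynomial \<open>c\<close> of \<open>B\<close> are a basis of the
  state space in which the system is a chain of integrators; row \<open>i\<close> of \<open>Z\<close> is the coordinate function
  \<open>z\<^sub>i\<close>, and the columns of \<open>T\<close> are the basis vectors. The numerator \<open>q\<close> expresses the output in these
  coordinates. Stability passes from \<open>f\<close> to \<open>c\<close> because a denominator of least degree already has degree
  at least \<open>N\<close>, so \<open>c\<close> is one of these, and they all divide \<open>f\<close>.\<close>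

theorem minimal_companion_coordinates:
  assumes min: "minimal_realization N A B C D g f" and st: "stable (cpoly f)" and deg: "degree g \<le> degree f"
  shows "\<exists>c q Z T. degree c = N \<and> lead_coeff c = 1 \<and> stable (cpoly c) \<and> degree q \<le> N \<and> q * f = g * c \<and>
    (\<forall>x \<in> carrier_vec N. \<forall>a<N. vec_index x a = (\<Sum>i<N. T a i * (\<Sum>b<N. Z i b * vec_index x b))) \<and>
    (\<forall>x \<in> carrier_vec N. \<forall>u. \<forall>i<N. (\<Sum>b<N. Z i b * vec_index (A *\<^sub>v x + u \<cdot>\<^sub>v B) b)
      = (if Suc i < N then (\<Sum>b<N. Z (Suc i) b * vec_index x b)
         else u - (\<Sum>j<N. coeff c j * (\<Sum>b<N. Z j b * vec_index x b)))) \<and>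
    (\<forall>x \<in> carrier_vec N. \<forall>u. scalar_prod C x + D * u = (\<Sum>i<N. coeff q i * (\<Sum>b<N. Z i b * vec_index x b))
      + coeff q N * (u - (\<Sum>j<N. coeff c j * (\<Sum>b<N. Z j b * vec_index x b))))"
proof -
  let ?K = "krylov N A B"
  have f: "f \<noteq> 0" using st by (auto simp: stable_def cpoly_simps dest: spec[of _ 0])
  have re: "realizes N A B C D g f" using min by (simp add: minimal_realization_def)
  then have A: "A \<in> carrier_mat N N" and B: "B \<in> carrier_vec N" and C: "C \<in> carrier_vec N"
    by (auto simp: realizes_def state_space_def)
  \<comment> \<open>the Krylov vectors are a basis, so the next one, \<open>A\<^sup>N B\<close>, is a combination of them: this is the
    monic \<open>c\<close> of degree \<open>N\<close> with \<open>c(A) B = 0\<close>\<close>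
  obtain ZK where ZK: "\<And>x a. a < N \<Longrightarrow> (\<Sum>l<N. (\<Sum>b<N. ZK l b * x b) * ?K l a) = x a"
    using independent_columns_inverse[of N ?K] minimal_krylov_independent[OF min f] by blast
  define c where "c = monom 1 N - (\<Sum>l<N. monom (\<Sum>b<N. ZK l b * ?K N b) l)"
  have ccl: "coeff c l = - (\<Sum>b<N. ZK l b * ?K N b)" if "l < N" for l
    using that by (simp add: c_def coeff_sum)
  have ccN: "coeff c N = 1" by (simp add: c_def coeff_sum)
  have cc0: "coeff c l = 0" if "N < l" for l using that by (simp add: c_def coeff_sum)
  have degc: "degree c = N" using ccN cc0 by (intro antisym degree_le le_degree) auto
  have lc: "lead_coeff c = 1" using degc ccN by simp
  have ann: "(\<Sum>l\<le>N. coeff c l * ?K l a) = 0" if a: "a < N" for a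
  proof -
    have "(\<Sum>l\<le>N. coeff c l * ?K l a) = (\<Sum>l<N. coeff c l * ?K l a) + ?K N a"
      by (simp add: lessThan_Suc_atMost[symmetric] ccN)
    also have "(\<Sum>l<N. coeff c l * ?K l a) = - (\<Sum>l<N. (\<Sum>b<N. ZK l b * ?K N b) * ?K l a)"
      unfolding sum_negf[symmetric] by (intro sum.cong) (auto simp: ccl)
    finally show ?thesis unfolding ZK[OF a] by simp
  qed
  define q where "q = krylov_numerator N A B C D c N"
  have qf: "q * f = g * c" unfolding q_def
    by (rule krylov_annihilator_transfer[OF re f]) (use degc ann in auto)
  have degq: "degree q \<le> N" unfolding q_def using degc by (intro degree_krylov_numerator) simp
  have stc: "stable (cpoly c)"
  proof -
    have c0: "c \<noteq> 0" using lc by auto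
    \<comment> \<open>\<open>f'\<close> generates the ideal of all denominators of \<open>g / f\<close>\<close>
    obtain f' where f': "f' \<noteq> 0" "f dvd g * f'" and least: "\<And>p. p \<noteq> 0 \<Longrightarrow> f dvd g * p \<Longrightarrow> degree f' \<le> degree p"
      using ex_has_least_nat[of "\<lambda>p. p \<noteq> 0 \<and> f dvd g * p" f degree] f by auto
    have gen: "f' dvd p" if p: "f dvd g * p" for p
    proof -
      have "g * (p mod f') = g * p - (g * f') * (p div f')"
        by (metis (no_types, lifting) minus_div_mult_eq_mod mult.assoc mult.commute right_diff_distrib)
      then have "f dvd g * (p mod f')" using p f'(2) by (metis dvd_diff dvd_mult2)
      then have "p mod f' = 0" using least[of "p mod f'"] degree_mod_less[OF f'(1), of p] by fastforce
      then show ?thesis by (simp add: mod_eq_0_iff_dvd)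
    qed
    have f'f: "f' dvd f" by (rule gen) simp
    have "f' dvd c" by (rule gen) (metis dvd_triv_right qf)
    then obtain e where e: "c = f' * e" by (elim dvdE)
    obtain q' where q': "g * f' = f * q'" using f'(2) by (elim dvdE)
    have "degree q' \<le> degree f'"
    proof (cases "q' = 0")
      case False
      then have "degree g + degree f' = degree f + degree q'"
        using q' f f'(1) by (metis degree_mult_eq mult_eq_0_iff)
      then show ?thesis using deg by simp
    qed simp
    moreover have "q' * f = g * f'" using q' by (simp add: mult.commute)
    ultimately have "N \<le> degree f'" using minimal_realization_le_degree[OF min f'(1)] by blast
    moreover have "degree c = degree f' + degree e" using c0 unfolding e by (intro degree_mult_eq) auto
    ultimately have "degree e = 0" using degc by simp
    then obtain e0 where "e = [:e0:]" by (metis degree_eq_zeroE)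
    with e c0 have e0: "c = Polynomial.smult e0 f'" "e0 \<noteq> 0" by (auto simp: mult.commute)
    show ?thesis unfolding stable_def
    proof (intro allI impI)
      fix z assume "poly (cpoly c) z = 0"
      then have "poly (cpoly f') z = 0" using e0 by (simp add: cpoly_simps)
      then have "poly (cpoly f) z = 0" using f'f by (auto simp: cpoly_simps elim!: dvdE)
      then show "Re z < 0" using st by (simp add: stable_def)
    qed
  qed
  \<comment> \<open>in the Krylov basis the Horner tails form an anti-triangular matrix with the leading
    coefficient \<open>1\<close> of \<open>c\<close> on the antidiagonal, hence they are independent as well\<close>
  define u where "u i = krylov_tail N A B c N i" for i
  have u0: "u 0 a = 0" if "a < N" for a using ann[OF that] by (simp add: u_def krylov_tail_def lessThan_Suc_atMost)
  have uN: "u N a = vec_index B a" for a using ccN by (simp add: u_def krylov_tail_top)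
  have indep: "e l = 0" if dep: "\<And>a. a < N \<Longrightarrow> (\<Sum>i<N. e i * u (Suc i) a) = 0" and l: "l < N" for e l
  proof -
    have triang: "(\<Sum>i<N. e i * u (Suc i) a) = (\<Sum>k<N. (\<Sum>i<N - k. e i * coeff c (Suc (k + i))) * ?K k a)" for a
    proof -
      have "(\<Sum>i<N. e i * u (Suc i) a) = (\<Sum>i<N. \<Sum>k<N - i. e i * (coeff c (Suc (k + i)) * ?K k a))"
        by (simp add: u_def krylov_tail_def sum_distrib_left)
      also have "\<dots> = (\<Sum>i<N. \<Sum>k<N. e i * (coeff c (Suc (k + i)) * ?K k a))"
        by (intro sum.cong refl sum.mono_neutral_left) (auto simp: cc0)
      also have "\<dots> = (\<Sum>k<N. \<Sum>i<N. e i * (coeff c (Suc (k + i)) * ?K k a))" by (rule sum.swap)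
      also have "\<dots> = (\<Sum>k<N. \<Sum>i<N - k. e i * (coeff c (Suc (k + i)) * ?K k a))"
        by (intro sum.cong refl sum.mono_neutral_right) (auto simp: cc0)
      finally show ?thesis by (simp add: sum_distrib_right mult.assoc)
    qed
    have tri0: "(\<Sum>i<N - k. e i * coeff c (Suc (k + i))) = 0" if "k < N" for k
      by (rule minimal_krylov_independent[OF min f _ that]) (use dep triang in simp)
    show ?thesis using l
    proof (induction l rule: less_induct)
      case (less l)
      have "(\<Sum>i<Suc l. e i * coeff c (Suc (N - Suc l + i))) = 0"
        using tri0[of "N - Suc l"] less.prems by (simp add: Suc_diff_Suc)
      moreover have "(\<Sum>i<l. e i * coeff c (Suc (N - Suc l + i))) = 0"
        using less by (intro sum.neutral) auto
      moreover have "Suc (N - Suc l + l) = N" using less.prems by simp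
      ultimately show ?case using ccN by simp
    qed
  qed
  have "\<exists>Z. (\<forall>x. \<forall>a<N. (\<Sum>l<N. (\<Sum>b<N. Z l b * x b) * u (Suc l) a) = x a)
    \<and> (\<forall>e. \<forall>l<N. (\<Sum>b<N. Z l b * (\<Sum>k<N. e k * u (Suc k) b)) = e l)"
    by (rule independent_columns_inverse, rule indep)
  then obtain Z where Z: "\<forall>x. \<forall>a<N. (\<Sum>l<N. (\<Sum>b<N. Z l b * x b) * u (Suc l) a) = x a"
    "\<forall>e. \<forall>l<N. (\<Sum>b<N. Z l b * (\<Sum>k<N. e k * u (Suc k) b)) = e l"
    by (elim exE conjE) (rule that)
  define \<zeta> where "\<zeta> x i = (\<Sum>b<N. Z i b * vec_index x b)" for x :: "real Matrix.vec" and i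
  have rep: "vec_index x a = (\<Sum>i<N. \<zeta> x i * u (Suc i) a)" if "a < N" for x a
    unfolding \<zeta>_def using Z(1)[rule_format, OF that, of "vec_index x"] by simp
  have dyn: "(\<Sum>b<N. Z i b * vec_index (A *\<^sub>v x + v \<cdot>\<^sub>v B) b) = (if Suc i < N then \<zeta> x (Suc i) else v - (\<Sum>j<N. coeff c j * \<zeta> x j))"
    if x: "x \<in> carrier_vec N" and i: "i < N" for x v i
  proof -
    define \<xi> where "\<xi> i = (if Suc i < N then \<zeta> x (Suc i) else v - (\<Sum>j<N. coeff c j * \<zeta> x j))" for i
    have "vec_index (A *\<^sub>v x + v \<cdot>\<^sub>v B) a = (\<Sum>k<N. \<xi> k * u (Suc k) a)" if a: "a < N" for a
    proof -
      have "vec_index (A *\<^sub>v x + v \<cdot>\<^sub>v B) a = (\<Sum>b<N. A $$ (a, b) * vec_index x b) + v * vec_index B a"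
        using A B x a by (simp add: scalar_prod_def atLeast0LessThan)
      also have "(\<Sum>b<N. A $$ (a, b) * vec_index x b) = (\<Sum>b<N. \<Sum>k<N. A $$ (a, b) * (\<zeta> x k * u (Suc k) b))"
        by (intro sum.cong refl) (subst rep, auto simp: sum_distrib_left)
      also have "\<dots> = (\<Sum>k<N. \<zeta> x k * (\<Sum>b<N. A $$ (a, b) * u (Suc k) b))"
        by (subst sum.swap) (simp add: sum_distrib_left mult_ac)
      also have "\<dots> = (\<Sum>k<N. \<zeta> x k * (u k a - coeff c k * vec_index B a))"
        by (intro sum.cong refl) (simp add: u_def krylov_tail_step)
      also have "\<dots> = (\<Sum>k<N. \<zeta> x k * u k a) - (\<Sum>k<N. coeff c k * \<zeta> x k) * vec_index B a"
        by (simp add: algebra_simps sum_subtractf sum_distrib_left)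
      finally have lhs: "vec_index (A *\<^sub>v x + v \<cdot>\<^sub>v B) a = (\<Sum>k<N. \<zeta> x k * u k a)
         + (v - (\<Sum>k<N. coeff c k * \<zeta> x k)) * vec_index B a" by (simp add: algebra_simps)
      obtain M where M: "N = Suc M" using a by (cases N) auto
      have "(\<Sum>k<N. \<xi> k * u (Suc k) a) = (\<Sum>k<M. \<xi> k * u (Suc k) a) + \<xi> M * u N a" by (simp add: M)
      also have "(\<Sum>k<M. \<xi> k * u (Suc k) a) = (\<Sum>k<M. \<zeta> x (Suc k) * u (Suc k) a)"
        by (intro sum.cong) (auto simp: \<xi>_def M)
      also have "\<dots> = (\<Sum>k<N. \<zeta> x k * u k a)" unfolding M using u0[OF a] by (subst sum.lessThan_Suc_shift) simp
      also have "\<xi> M = v - (\<Sum>k<N. coeff c k * \<zeta> x k)" by (simp add: \<xi>_def M)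
      finally show ?thesis using lhs uN by simp
    qed
    then have "(\<Sum>b<N. Z i b * vec_index (A *\<^sub>v x + v \<cdot>\<^sub>v B) b) = (\<Sum>b<N. Z i b * (\<Sum>k<N. \<xi> k * u (Suc k) b))"
      by (intro sum.cong) auto
    also have "\<dots> = \<xi> i" by (rule Z(2)[rule_format, OF i])
    finally show ?thesis by (simp add: \<xi>_def)
  qed
  have out: "scalar_prod C x + D * v = (\<Sum>i<N. coeff q i * \<zeta> x i) + coeff q N * (v - (\<Sum>j<N. coeff c j * \<zeta> x j))"
    if x: "x \<in> carrier_vec N" for x v
  proof -
    have "(\<Sum>i<N. coeff q i * \<zeta> x i) = (\<Sum>i<N. (\<Sum>a<N. vec_index C a * u (Suc i) a) * \<zeta> x i) + D * (\<Sum>i<N. coeff c i * \<zeta> x i)"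
      unfolding sum_distrib_left sum.distrib[symmetric]
      by (intro sum.cong refl) (simp add: q_def coeff_krylov_numerator u_def algebra_simps)
    also have "(\<Sum>i<N. (\<Sum>a<N. vec_index C a * u (Suc i) a) * \<zeta> x i) = (\<Sum>a<N. vec_index C a * (\<Sum>i<N. \<zeta> x i * u (Suc i) a))"
      unfolding sum_distrib_right by (subst sum.swap) (simp add: sum_distrib_left mult_ac)
    also have "\<dots> = (\<Sum>a<N. vec_index C a * vec_index x a)"
      by (intro sum.cong refl) (subst rep, auto)
    also have "\<dots> = scalar_prod C x" using x by (simp add: scalar_prod_def atLeast0LessThan)
    finally show ?thesis by (simp add: q_def coeff_krylov_numerator ccN algebra_simps)
  qed
  have "\<forall>x \<in> carrier_vec N. \<forall>a<N. vec_index x a = (\<Sum>i<N. u (Suc i) a * \<zeta> x i)"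
    using rep by (simp add: mult.commute)
  moreover have "\<forall>x \<in> carrier_vec N. \<forall>v. \<forall>i<N. (\<Sum>b<N. Z i b * vec_index (A *\<^sub>v x + v \<cdot>\<^sub>v B) b)
      = (if Suc i < N then \<zeta> x (Suc i) else v - (\<Sum>j<N. coeff c j * \<zeta> x j))"
    using dyn by blast
  moreover have "\<forall>x \<in> carrier_vec N. \<forall>v. scalar_prod C x + D * v = (\<Sum>i<N. coeff q i * \<zeta> x i)
      + coeff q N * (v - (\<Sum>j<N. coeff c j * \<zeta> x j))"
    using out by blast
  ultimately show ?thesis
    unfolding \<zeta>_def
    by (intro exI[of _ c] exI[of _ q] exI[of _ Z] exI[of _ "\<lambda>a i. u (Suc i) a"] conjI degc lc stc degq qf)
qed

section \<open>Decay along trajectories\<close>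

text \<open>A differential inequality \<open>F' \<le> - lam F\<close> in a form that needs no differentiability: over \<open>n + 1\<close> equal
  subintervals the quadratic errors sum up to \<open>O(1 / n)\<close>.\<close>

lemma exponential_decay_from_increments:
  fixes F :: "real \<Rightarrow> real"
  assumes ab: "a \<le> b" and lam: "0 \<le> lam" and K: "0 \<le> K" and nn: "\<And>t. t \<in> {a..b} \<Longrightarrow> 0 \<le> F t"
    and inc: "\<And>s t. a \<le> s \<Longrightarrow> s \<le> t \<Longrightarrow> t \<le> b \<Longrightarrow> F t \<le> F s - lam * (t - s) * F s + K * (t - s)\<^sup>2"
  shows "F b \<le> exp (- lam * (b - a)) * F a"
proof -
  have step: "F b \<le> exp (- lam * (b - a)) * F a + (K * (b - a)\<^sup>2) / real (Suc n)" for n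
  proof -
    define h where "h = (b - a) / real (Suc n)"
    have h: "h \<ge> 0" "real (Suc n) * h = b - a" using ab by (simp_all add: h_def)
    have ind: "F (a + real i * h) \<le> exp (- lam * (real i * h)) * F a + real i * (K * h\<^sup>2)" if "i \<le> Suc n" for i
      using that
    proof (induction i)
      case (Suc i)
      let ?s = "a + real i * h" and ?t = "a + real (Suc i) * h"
      have "real (Suc i) * h \<le> real (Suc n) * h" using Suc.prems h(1) by (intro mult_right_mono) auto
      then have t: "?t \<le> b" using h(2) by simp
      have s: "a \<le> ?s" "?s \<le> ?t" "?t - ?s = h" using h(1) by (simp_all add: algebra_simps)
      have "F ?t \<le> F ?s - lam * h * F ?s + K * h\<^sup>2" using inc[OF s(1,2) t] s(3) by simp
      also have "\<dots> = (1 + - (lam * h)) * F ?s + K * h\<^sup>2" by (simp add: algebra_simps)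
      also have "\<dots> \<le> exp (- (lam * h)) * F ?s + K * h\<^sup>2"
        using nn[of ?s] s t by (intro add_right_mono mult_right_mono exp_ge_add_one_self) auto
      also have "\<dots> \<le> exp (- (lam * h)) * (exp (- lam * (real i * h)) * F a + real i * (K * h\<^sup>2)) + K * h\<^sup>2"
        using Suc by (intro add_right_mono mult_left_mono) auto
      also have "\<dots> = exp (- lam * (real (Suc i) * h)) * F a + exp (- (lam * h)) * (real i * (K * h\<^sup>2)) + K * h\<^sup>2"
        by (simp add: distrib_left mult.assoc[symmetric] exp_add[symmetric]) (simp add: algebra_simps)
      also have "\<dots> \<le> exp (- lam * (real (Suc i) * h)) * F a + 1 * (real i * (K * h\<^sup>2)) + K * h\<^sup>2"
        using K lam h(1) by (intro add_right_mono add_left_mono mult_right_mono) auto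
      finally show ?case by (simp add: algebra_simps)
    qed simp
    have "F b \<le> exp (- lam * (b - a)) * F a + real (Suc n) * (K * h\<^sup>2)"
      using ind[of "Suc n"] unfolding h(2) by simp
    also have "real (Suc n) * (K * h\<^sup>2) = (K * (b - a)\<^sup>2) / real (Suc n)"
      unfolding h_def by (simp add: power_divide power2_eq_square del: of_nat_Suc)
    finally show ?thesis .
  qed
  have "(\<lambda>n. exp (- lam * (b - a)) * F a + (K * (b - a)\<^sup>2) / real (Suc n)) \<longlonglongrightarrow> exp (- lam * (b - a)) * F a + 0"
    by (intro tendsto_add tendsto_const LIMSEQ_Suc lim_const_over_n)
  then have "F b \<le> exp (- lam * (b - a)) * F a + 0"
    by (rule LIMSEQ_le_const) (use step in auto)
  then show ?thesis by simp
qed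

text \<open>The left hand side of the dissipation inequality is linear in \<open>z\<^sub>N\<close> and its right hand side
  quadratic, so the inequality bounds \<open>z\<^sub>N\<close>, that is the input, by the state. No Lipschitz or growth
  condition for the feedback is needed beyond the sector.\<close>

lemma dissipation_bounds_top_derivative:
  fixes P :: "nat \<Rightarrow> nat \<Rightarrow> real"
  assumes \<eta>: "\<eta> > 0"
    and dis: "2 * (\<Sum>i<N. \<Sum>j<N. P i j * (z i * z (Suc j))) \<le> - \<eta> * (\<Sum>i\<le>N. (z i)\<^sup>2)"
  shows "(\<Sum>i\<le>N. (z i)\<^sup>2) \<le> (2 * (\<Sum>i<N. \<Sum>j<N. \<bar>P i j\<bar>) / \<eta>)\<^sup>2 * (\<Sum>i<N. (z i)\<^sup>2)"
proof -
  define S where "S = (\<Sum>i<N. (z i)\<^sup>2)"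
  define S' where "S' = (\<Sum>i\<le>N. (z i)\<^sup>2)"
  define K where "K = (\<Sum>i<N. \<Sum>j<N. \<bar>P i j\<bar>)"
  have S: "0 \<le> S" "0 \<le> S'" by (simp_all add: S_def S'_def sum_nonneg)
  have zi: "\<bar>z i\<bar> \<le> sqrt S" if "i < N" for i
  proof -
    have "(z i)\<^sup>2 \<le> S" unfolding S_def using that by (intro member_le_sum) auto
    then show ?thesis by (metis real_sqrt_abs real_sqrt_le_mono)
  qed
  have zj: "\<bar>z i\<bar> \<le> sqrt S'" if "i \<le> N" for i
  proof -
    have "(z i)\<^sup>2 \<le> S'" unfolding S'_def using that by (intro member_le_sum) auto
    then show ?thesis by (metis real_sqrt_abs real_sqrt_le_mono)
  qed
  have "\<bar>\<Sum>i<N. \<Sum>j<N. P i j * (z i * z (Suc j))\<bar> \<le> (\<Sum>i<N. \<Sum>j<N. \<bar>P i j * (z i * z (Suc j))\<bar>)"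
    by (intro order.trans[OF sum_abs] sum_mono sum_abs)
  also have "\<dots> \<le> (\<Sum>i<N. \<Sum>j<N. \<bar>P i j\<bar> * (sqrt S * sqrt S'))"
    unfolding abs_mult using zi zj S by (intro sum_mono mult_left_mono mult_mono) auto
  also have "\<dots> = K * (sqrt S * sqrt S')" by (simp add: K_def sum_distrib_right)
  finally have "\<eta> * S' \<le> 2 * K * sqrt S * sqrt S'" using dis by (simp add: S'_def)
  then have "\<eta> * sqrt S' * sqrt S' \<le> 2 * K * sqrt S * sqrt S'" using S(2) by (simp add: mult.assoc)
  moreover have K: "0 \<le> K" by (simp add: K_def sum_nonneg)
  ultimately have "\<eta> * sqrt S' \<le> 2 * K * sqrt S"
    using S by (cases "S' = 0") (auto simp: mult_le_cancel_right)
  then have "sqrt S' \<le> 2 * K / \<eta> * sqrt S" using \<eta> by (simp add: field_simps)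
  then have "(sqrt S')\<^sup>2 \<le> (2 * K / \<eta> * sqrt S)\<^sup>2" using S by (intro power_mono) auto
  then show ?thesis using S unfolding S_def[symmetric] S'_def[symmetric] K_def[symmetric] by (simp add: power_mult_distrib power_divide)
qed

text \<open>The form \<open>V\<close> is a Lyapunov function with \<open>V' \<le> - \<eta> / (K + 1) V\<close>. The top derivative \<open>z\<^sub>N\<close> is
  only integrable in time, so the inequality is obtained for increments of \<open>V\<close>, with an error that is
  quadratic in the length of the time interval.\<close>

lemma chain_exponential_decay:
  fixes P :: "nat \<Rightarrow> nat \<Rightarrow> real" and z :: "nat \<Rightarrow> real \<Rightarrow> real"
  assumes sym: "\<And>i j. P i j = P j i" and \<eta>: "\<eta> > 0"
    and pos: "\<And>z. \<eta> * (\<Sum>i<N. (z i)\<^sup>2) \<le> (\<Sum>i<N. \<Sum>j<N. P i j * (z i * z j))"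
    and le: "t0 \<le> t1"
    and int: "\<And>i t. i < N \<Longrightarrow> t \<in> {t0..t1} \<Longrightarrow> (z (Suc i) has_integral (z i t - z i t0)) {t0..t}"
    and dis: "\<And>\<tau>. \<tau> \<in> {t0..t1} \<Longrightarrow> 2 * (\<Sum>i<N. \<Sum>j<N. P i j * (z i \<tau> * z (Suc j) \<tau>)) \<le> - \<eta> * (\<Sum>i\<le>N. (z i \<tau>)\<^sup>2)"
  defines "K \<equiv> (\<Sum>i<N. \<Sum>j<N. \<bar>P i j\<bar>)"
  shows "(\<Sum>i<N. (z i t1)\<^sup>2) \<le> K / \<eta> * exp (- (\<eta> / (K + 1)) * (t1 - t0)) * (\<Sum>i<N. (z i t0)\<^sup>2)"
proof -
  define S where "S \<tau> = (\<Sum>i<N. (z i \<tau>)\<^sup>2)" for \<tau>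
  define V where "V \<tau> = (\<Sum>i<N. \<Sum>j<N. P i j * (z i \<tau> * z j \<tau>))" for \<tau>
  have K: "0 \<le> K" by (simp add: K_def sum_nonneg)
  have S0: "0 \<le> S \<tau>" for \<tau> by (simp add: S_def sum_nonneg)
  have V_lower: "\<eta> * S \<tau> \<le> V \<tau>" for \<tau> unfolding S_def V_def by (rule pos)
  have V_upper: "V \<tau> \<le> K * S \<tau>" for \<tau>
    using quadratic_form_upper_bound[of P "\<lambda>i. z i \<tau>" N] unfolding S_def V_def K_def by linarith
  have V0: "0 \<le> V \<tau>" for \<tau>
    by (rule order.trans[OF mult_nonneg_nonneg V_lower]) (use \<eta> S0 in auto)
  have incr: "(z (Suc i) has_integral (z i t - z i s)) {s..t}" if "i < N" "t0 \<le> s" "s \<le> t" "t \<le> t1" for i s t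
  proof -
    have hs: "(z (Suc i) has_integral (z i s - z i t0)) {t0..s}" and ht: "(z (Suc i) has_integral (z i t - z i t0)) {t0..t}"
      using that by (auto intro!: int)
    have "z (Suc i) integrable_on {t0..t}" using ht by (rule has_integral_integrable)
    moreover have "{s..t} \<subseteq> {t0..t}" using that(2) by simp
    ultimately have st: "z (Suc i) integrable_on {s..t}" by (rule integrable_on_subinterval)
    have "(z (Suc i) has_integral ((z i s - z i t0) + integral {s..t} (z (Suc i)))) {t0..t}"
      by (rule has_integral_combine[OF that(2,3) hs integrable_integral[OF st]])
    then have "(z i s - z i t0) + integral {s..t} (z (Suc i)) = z i t - z i t0"
      using ht by (rule has_integral_unique)
    then have "integral {s..t} (z (Suc i)) = z i t - z i s" by simp
    then show ?thesis using integrable_integral[OF st] by simp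
  qed
  have cont: "continuous_on {t0..t1} (z i)" if "i < N" for i
  proof -
    have "z (Suc i) integrable_on {t0..t1}" by (rule has_integral_integrable[OF int[OF that]]) (use le in auto)
    then have "continuous_on {t0..t1} (\<lambda>t. z i t0 + integral {t0..t} (z (Suc i)))"
      by (intro continuous_intros indefinite_integral_continuous_1)
    moreover have "z i t0 + integral {t0..t} (z (Suc i)) = z i t" if "t \<in> {t0..t1}" for t
      using integral_unique[OF int[OF \<open>i < N\<close> that]] by simp
    ultimately show ?thesis by (rule continuous_on_eq)
  qed
  \<comment> \<open>the state is continuous, and dissipation bounds \<open>z N\<close> by the state; thus one constant bounds
    the whole chain, and the state is Lipschitz\<close>
  obtain R where R: "0 \<le> R" "\<And>i \<tau>. i \<le> N \<Longrightarrow> \<tau> \<in> {t0..t1} \<Longrightarrow> \<bar>z i \<tau>\<bar> \<le> R"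
  proof -
    have "continuous_on {t0..t1} S" unfolding S_def using cont by (intro continuous_intros) auto
    then have "bounded (S ` {t0..t1})" by (intro compact_imp_bounded compact_continuous_image compact_Icc)
    then obtain M where M: "\<forall>\<tau>\<in>{t0..t1}. \<bar>S \<tau>\<bar> \<le> M" by (auto simp: bounded_iff)
    define R where "R = sqrt ((2 * K / \<eta>)\<^sup>2 * \<bar>M\<bar>)"
    have "\<bar>z i \<tau>\<bar> \<le> R" if "i \<le> N" "\<tau> \<in> {t0..t1}" for i \<tau>
    proof -
      have "(z i \<tau>)\<^sup>2 \<le> (\<Sum>i\<le>N. (z i \<tau>)\<^sup>2)" using that by (intro member_le_sum) auto
      also have "\<dots> \<le> (2 * K / \<eta>)\<^sup>2 * S \<tau>"
        unfolding K_def S_def by (rule dissipation_bounds_top_derivative[OF \<eta> dis[OF that(2)]])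
      also have "\<dots> \<le> (2 * K / \<eta>)\<^sup>2 * \<bar>M\<bar>" using bspec[OF M that(2)] by (intro mult_left_mono) auto
      finally show ?thesis unfolding R_def by (metis real_sqrt_abs real_sqrt_le_mono)
    qed
    then show ?thesis using that[of R] by (auto simp: R_def)
  qed
  have lip: "\<bar>z i t - z i s\<bar> \<le> R * (t - s)" if "i < N" "t0 \<le> s" "s \<le> t" "t \<le> t1" for i s t
    using has_integral_bound_real[OF R(1) finite.emptyI incr[OF that]] that R(2)[of "Suc i"] by auto
  define C where "C = 2 * K * R\<^sup>2 + 2 * \<eta> * real N * R\<^sup>2"
  have C: "0 \<le> C" using K \<eta> by (simp add: C_def)
  have inc: "V t \<le> V s - \<eta> / (K + 1) * (t - s) * V s + C * (t - s)\<^sup>2" if st: "t0 \<le> s" "s \<le> t" "t \<le> t1" for s t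
  proof -
    \<comment> \<open>by symmetry \<open>V t - V s\<close> is the bilinear form at \<open>z(t) + z(s)\<close> and \<open>z(t) - z(s)\<close>; the second
      argument is an integral, and replacing the first one by \<open>2 z(\<tau>)\<close> costs an error of order \<open>t - s\<close>\<close>
    define \<phi> where "\<phi> \<tau> = (\<Sum>i<N. \<Sum>j<N. P i j * (z i t + z i s) * z (Suc j) \<tau>)" for \<tau>
    have "(\<phi> has_integral (\<Sum>i<N. \<Sum>j<N. P i j * (z i t + z i s) * (z j t - z j s))) {s..t}"
      unfolding \<phi>_def using incr st by (intro has_integral_sum has_integral_mult_right) auto
    also have "(\<Sum>i<N. \<Sum>j<N. P i j * (z i t + z i s) * (z j t - z j s)) = V t - V s"
    proof -
      have "(\<Sum>i<N. \<Sum>j<N. P i j * (z i s * z j t)) = (\<Sum>i<N. \<Sum>j<N. P i j * (z i t * z j s))"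
        by (subst sum.swap) (simp add: sym mult.commute)
      moreover have "(\<Sum>i<N. \<Sum>j<N. P i j * (z i t + z i s) * (z j t - z j s))
        = V t - V s + ((\<Sum>i<N. \<Sum>j<N. P i j * (z i s * z j t)) - (\<Sum>i<N. \<Sum>j<N. P i j * (z i t * z j s)))"
        unfolding V_def sum_subtractf[symmetric] sum.distrib[symmetric]
        by (intro sum.cong refl) (simp add: algebra_simps)
      ultimately show ?thesis by simp
    qed
    finally have hi: "(\<phi> has_integral (V t - V s)) {s..t}" .
    have bound: "\<phi> \<tau> \<le> - \<eta> * S s + C * (t - s)" if \<tau>: "\<tau> \<in> {s..t}" for \<tau>
    proof -
      have in0: "\<tau> \<in> {t0..t1}" using \<tau> st by auto
      have near: "\<bar>z i t + z i s - 2 * z i \<tau>\<bar> \<le> 2 * (R * (t - s))" if "i < N" for i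
      proof -
        have "\<bar>z i t - z i \<tau>\<bar> \<le> R * (t - \<tau>)" "\<bar>z i \<tau> - z i s\<bar> \<le> R * (\<tau> - s)"
          using lip[OF that, of \<tau> t] lip[OF that, of s \<tau>] \<tau> st by auto
        moreover have "R * (t - \<tau>) + R * (\<tau> - s) = R * (t - s)" by (simp add: algebra_simps)
        moreover have "0 \<le> R * (t - s)" using R st by simp
        ultimately show ?thesis by linarith
      qed
      have "\<phi> \<tau> - 2 * (\<Sum>i<N. \<Sum>j<N. P i j * (z i \<tau> * z (Suc j) \<tau>))
        = (\<Sum>i<N. \<Sum>j<N. P i j * (z i t + z i s - 2 * z i \<tau>) * z (Suc j) \<tau>)"
        unfolding \<phi>_def sum_distrib_left sum_subtractf[symmetric]
        by (intro sum.cong refl) (simp add: algebra_simps)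
      also have "\<dots> \<le> (\<Sum>i<N. \<Sum>j<N. \<bar>P i j\<bar> * (2 * (R * (t - s))) * R)"
      proof (intro sum_mono)
        fix i j assume ij: "i \<in> {..<N}" "j \<in> {..<N}"
        have "P i j * (z i t + z i s - 2 * z i \<tau>) * z (Suc j) \<tau> \<le> \<bar>P i j\<bar> * \<bar>z i t + z i s - 2 * z i \<tau>\<bar> * \<bar>z (Suc j) \<tau>\<bar>"
          using abs_ge_self[of "P i j * (z i t + z i s - 2 * z i \<tau>) * z (Suc j) \<tau>"] by (simp add: abs_mult)
        also have "\<dots> \<le> \<bar>P i j\<bar> * (2 * (R * (t - s))) * R"
          using near[of i] R(2)[of "Suc j" \<tau>] in0 ij R(1) st by (intro mult_mono mult_left_mono) auto
        finally show "P i j * (z i t + z i s - 2 * z i \<tau>) * z (Suc j) \<tau> \<le> \<bar>P i j\<bar> * (2 * (R * (t - s))) * R" .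
      qed
      also have "\<dots> = 2 * K * R\<^sup>2 * (t - s)"
        unfolding K_def sum_distrib_right[symmetric] by (simp add: power2_eq_square)
      finally have 1: "\<phi> \<tau> \<le> - \<eta> * (\<Sum>i\<le>N. (z i \<tau>)\<^sup>2) + 2 * K * R\<^sup>2 * (t - s)" using dis[OF in0] by linarith
      have "S s - S \<tau> = (\<Sum>i<N. (z i s - z i \<tau>) * (z i s + z i \<tau>))"
        unfolding S_def sum_subtractf[symmetric] by (intro sum.cong refl) (simp add: algebra_simps power2_eq_square)
      also have "\<dots> \<le> (\<Sum>i<N. (R * (t - s)) * (2 * R))"
      proof (intro sum_mono)
        fix i assume i: "i \<in> {..<N}"
        have "\<bar>z i s - z i \<tau>\<bar> \<le> R * (\<tau> - s)" using lip[of i s \<tau>] i \<tau> st by auto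
        also have "\<dots> \<le> R * (t - s)" using \<tau> R by (intro mult_left_mono) auto
        finally have d: "\<bar>z i s - z i \<tau>\<bar> \<le> R * (t - s)" .
        have e: "\<bar>z i s + z i \<tau>\<bar> \<le> 2 * R" using R(2)[of i s] R(2)[of i \<tau>] i in0 st by auto
        have "(z i s - z i \<tau>) * (z i s + z i \<tau>) \<le> \<bar>z i s - z i \<tau>\<bar> * \<bar>z i s + z i \<tau>\<bar>"
          using abs_ge_self[of "(z i s - z i \<tau>) * (z i s + z i \<tau>)"] by (simp add: abs_mult)
        also have "\<dots> \<le> (R * (t - s)) * (2 * R)" using d e R st by (intro mult_mono) auto
        finally show "(z i s - z i \<tau>) * (z i s + z i \<tau>) \<le> (R * (t - s)) * (2 * R)" .
      qed
      also have "\<dots> = 2 * real N * R\<^sup>2 * (t - s)" by (simp add: power2_eq_square)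
      finally have "\<eta> * S s \<le> \<eta> * (S \<tau> + 2 * real N * R\<^sup>2 * (t - s))" using \<eta> by (intro mult_left_mono) auto
      moreover have "\<eta> * S \<tau> \<le> \<eta> * (\<Sum>i\<le>N. (z i \<tau>)\<^sup>2)"
        using \<eta> by (intro mult_left_mono) (simp_all add: S_def lessThan_Suc_atMost[symmetric])
      ultimately show ?thesis using 1 by (simp add: C_def algebra_simps)
    qed
    have "V t - V s \<le> (t - s) * (- \<eta> * S s + C * (t - s))"
      using has_integral_le[OF hi has_integral_const_real[of "- \<eta> * S s + C * (t - s)" s t]] bound st by simp
    also have "\<dots> = - ((t - s) * (\<eta> * S s)) + C * (t - s)\<^sup>2" by (simp add: algebra_simps power2_eq_square)
    also have "\<dots> \<le> - ((t - s) * (\<eta> * (V s / (K + 1)))) + C * (t - s)\<^sup>2"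
    proof -
      have "V s \<le> (K + 1) * S s" using V_upper[of s] S0[of s] by (simp add: algebra_simps)
      then have "V s / (K + 1) \<le> S s" using K by (simp add: field_simps)
      then have "(t - s) * (\<eta> * (V s / (K + 1))) \<le> (t - s) * (\<eta> * S s)" using st \<eta> by (intro mult_left_mono) auto
      then show ?thesis by simp
    qed
    finally show ?thesis by (simp add: algebra_simps)
  qed
  have "V t1 \<le> exp (- (\<eta> / (K + 1)) * (t1 - t0)) * V t0"
    by (rule exponential_decay_from_increments[OF le _ C V0 inc]) (use \<eta> K in auto)
  also have "\<dots> \<le> exp (- (\<eta> / (K + 1)) * (t1 - t0)) * (K * S t0)" by (intro mult_left_mono V_upper) simp
  finally have "\<eta> * S t1 \<le> exp (- (\<eta> / (K + 1)) * (t1 - t0)) * (K * S t0)" using V_lower[of t1] by linarith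
  then have "S t1 \<le> exp (- (\<eta> / (K + 1)) * (t1 - t0)) * (K * S t0) / \<eta>"
    using \<eta> by (simp add: pos_le_divide_eq mult.commute)
  then show ?thesis by (simp add: S_def mult_ac)
qed

section \<open>Continuation of solutions\<close>

definition lure_field :: "real mat \<Rightarrow> real Matrix.vec \<Rightarrow> (real \<Rightarrow> real Matrix.vec) \<Rightarrow> (real \<Rightarrow> real) \<Rightarrow> nat \<Rightarrow> real \<Rightarrow> real" where
  "lure_field A B x u i \<tau> = vec_index (A *\<^sub>v x \<tau> + u \<tau> \<cdot>\<^sub>v B) i"

text \<open>The conditions on a solution at one time, with the input \<open>u\<close> made explicit; solutions with their
  inputs can then be restricted, compared and glued pointwise.\<close>

definition lure_at ::
  "nat \<Rightarrow> real mat \<Rightarrow> real Matrix.vec \<Rightarrow> real Matrix.vec \<Rightarrow> real \<Rightarrow> (real \<Rightarrow> real \<Rightarrow> real) \<Rightarrow>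
   real \<Rightarrow> (real \<Rightarrow> real Matrix.vec) \<Rightarrow> (real \<Rightarrow> real) \<Rightarrow> real \<Rightarrow> bool" where
  "lure_at N A B C D \<Phi> t0 x u t \<longleftrightarrow> x t \<in> carrier_vec N \<and> u t = - \<Phi> t (scalar_prod C (x t) + D * u t) \<and>
    (\<forall>i<N. lure_field A B x u i absolutely_integrable_on {t0..t} \<and>
       (lure_field A B x u i has_integral (vec_index (x t) i - vec_index (x t0) i)) {t0..t})"

lemma lure_solution_iff:
  "lure_solution N A B C D \<Phi> t0 J x \<longleftrightarrow> (\<exists>u. \<forall>t\<in>J. lure_at N A B C D \<Phi> t0 x u t)"
proof
  assume "lure_solution N A B C D \<Phi> t0 J x"
  then obtain \<sigma> u where "\<forall>t\<in>J. x t \<in> carrier_vec N"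
    and "\<forall>t\<in>J. \<sigma> t = scalar_prod C (x t) + D * u t \<and> u t = - \<Phi> t (\<sigma> t)"
    and "\<forall>t\<in>J. \<forall>i<N. lure_field A B x u i absolutely_integrable_on {t0..t} \<and>
       (lure_field A B x u i has_integral (vec_index (x t) i - vec_index (x t0) i)) {t0..t}"
    unfolding lure_solution_def lure_field_def[abs_def] by blast
  then have "\<forall>t\<in>J. lure_at N A B C D \<Phi> t0 x u t" unfolding lure_at_def by metis
  then show "\<exists>u. \<forall>t\<in>J. lure_at N A B C D \<Phi> t0 x u t" by (intro exI[of _ u])
next
  assume "\<exists>u. \<forall>t\<in>J. lure_at N A B C D \<Phi> t0 x u t"
  then obtain u where u: "\<forall>t\<in>J. lure_at N A B C D \<Phi> t0 x u t" by (elim exE)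
  show "lure_solution N A B C D \<Phi> t0 J x"
    unfolding lure_solution_def
    using u unfolding lure_at_def lure_field_def[abs_def]
    by (intro conjI exI[of _ "\<lambda>t. scalar_prod C (x t) + D * u t"] exI[of _ u]) auto
qed

lemma lure_at_cong:
  assumes t: "t0 \<le> t" and eq: "\<And>\<tau>. \<tau> \<in> {t0..t} \<Longrightarrow> x \<tau> = y \<tau> \<and> u \<tau> = v \<tau>"
    and at: "lure_at N A B C D \<Phi> t0 x u t"
  shows "lure_at N A B C D \<Phi> t0 y v t"
proof -
  have f: "lure_field A B x u i \<tau> = lure_field A B y v i \<tau>" if "\<tau> \<in> {t0..t}" for i \<tau>
    using eq[OF that] by (simp add: lure_field_def)
  have "lure_field A B y v i absolutely_integrable_on {t0..t}"
    if "lure_field A B x u i absolutely_integrable_on {t0..t}" for i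
    by (rule absolutely_integrable_spike[OF that negligible_empty]) (use f in auto)
  moreover have "(lure_field A B y v i has_integral I) {t0..t}"
    if "(lure_field A B x u i has_integral I) {t0..t}" for i I
    by (rule has_integral_eq[OF f that])
  moreover have "x t = y t" "u t = v t" "x t0 = y t0" using eq[of t] eq[of t0] t by auto
  ultimately show ?thesis using at unfolding lure_at_def by metis
qed

text \<open>Dominated convergence for the restrictions to \<open>{a..b - (b - a) / (n + 1)}\<close>.\<close>

lemma bounded_improper_integrable:
  fixes w :: "real \<Rightarrow> real"
  assumes "a < b" and int: "\<And>t. a \<le> t \<Longrightarrow> t < b \<Longrightarrow> w integrable_on {a..t}"
    and bd: "\<And>t. a \<le> t \<Longrightarrow> t < b \<Longrightarrow> \<bar>w t\<bar> \<le> R"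
  shows "w integrable_on {a..b}"
proof -
  define s where "s n = b - (b - a) / real (Suc n)" for n
  have s: "a \<le> s n" "s n < b" for n
  proof -
    have "(b - a) / real (Suc n) \<le> (b - a) / 1" using assms(1) by (intro divide_left_mono) auto
    then show "a \<le> s n" by (simp add: s_def)
    show "s n < b" using assms(1) by (simp add: s_def)
  qed
  have slim: "s \<longlonglongrightarrow> b - 0" unfolding s_def by (intro tendsto_diff tendsto_const LIMSEQ_Suc lim_const_over_n)
  define f where "f n t = (if t \<in> {a..s n} then w t else 0)" for n t
  define g where "g t = (if t < b then w t else 0)" for t
  have "g integrable_on {a..b}"
  proof (rule dominated_convergence(1)[of f _ "\<lambda>_. \<bar>R\<bar>"])
    show "f n integrable_on {a..b}" for n
    proof -
      have "w integrable_on {a..s n} \<inter> {a..b}"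
        using int[OF s] s(2)[of n] by (simp add: min_def Int_atLeastAtMost)
      then show ?thesis unfolding f_def by (subst integrable_restrict_Int)
    qed
    show "norm (f n t) \<le> \<bar>R\<bar>" if "t \<in> {a..b}" for n t
      using bd[of t] s(2)[of n] that by (auto simp: f_def)
    show "(\<lambda>n. f n t) \<longlonglongrightarrow> g t" if t: "t \<in> {a..b}" for t
    proof (cases "t < b")
      case True
      have "\<forall>\<^sub>F n in sequentially. t < s n" using order_tendstoD(1)[OF slim, of t] True by simp
      then have "\<forall>\<^sub>F n in sequentially. f n t = g t"
        by eventually_elim (use t True in \<open>auto simp: f_def g_def\<close>)
      then show ?thesis by (rule tendsto_eventually)
    next
      case False
      then have "f n t = 0" for n using s(2)[of n] by (auto simp: f_def)
      then show ?thesis using False by (simp add: g_def)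
    qed
  qed auto
  then show ?thesis
    by (rule integrable_spike_finite[of "{b}", rotated 2]) (auto simp: g_def)
qed

text \<open>A bounded right hand side is integrable up to the endpoint \<open>T\<close>, so the state has a limit there, and
  local solvability from this limit supplies the continuation.\<close>

lemma lure_extend_past_endpoint:
  assumes ss: "state_space N A B C" and wp: "lure_well_posed N A B C D \<Phi>" and T: "0 \<le> t0" "t0 < T"
    and sol: "\<forall>t\<in>{t0..<T}. lure_at N A B C D \<Phi> t0 x u t"
    and bd: "\<And>t i. t \<in> {t0..<T} \<Longrightarrow> i < N \<Longrightarrow> \<bar>lure_field A B x u i t\<bar> \<le> R"
  shows "\<exists>h>0. \<exists>y v. (\<forall>t\<in>{t0..<T + h}. lure_at N A B C D \<Phi> t0 y v t) \<and> (\<forall>t\<in>{t0..<T}. y t = x t \<and> v t = u t)"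
proof -
  let ?w = "lure_field A B x u"
  have wi: "?w i integrable_on {t0..T}" if "i < N" for i
  proof (rule bounded_improper_integrable[OF T(2)])
    show "?w i integrable_on {t0..t}" if "t0 \<le> t" "t < T" for t
    proof -
      have "lure_at N A B C D \<Phi> t0 x u t" using sol that by simp
      then have "(?w i has_integral (vec_index (x t) i - vec_index (x t0) i)) {t0..t}"
        using \<open>i < N\<close> by (simp add: lure_at_def)
      then show ?thesis by (rule has_integral_integrable)
    qed
    show "\<bar>?w i t\<bar> \<le> R" if "t0 \<le> t" "t < T" for t using bd \<open>i < N\<close> that by auto
  qed
  define xT where "xT = Matrix.vec N (\<lambda>i. vec_index (x t0) i + integral {t0..T} (?w i))"
  obtain h y v where h: "h > 0" and yv: "\<forall>t\<in>{T..T + h}. lure_at N A B C D \<Phi> T y v t" and yT: "y T = xT"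
  proof -
    have "xT \<in> carrier_vec N" by (simp add: xT_def)
    moreover have "0 \<le> T" using T by simp
    ultimately have "\<exists>h>0. \<exists>y. lure_solution N A B C D \<Phi> T {T..T + h} y \<and> y T = xT"
      using wp unfolding lure_well_posed_def by blast
    then show ?thesis using that unfolding lure_solution_iff by blast
  qed
  define X where "X t = (if t < T then x t else y t)" for t
  define U where "U t = (if t < T then u t else v t)" for t
  have before: "lure_at N A B C D \<Phi> t0 X U t" if "t \<in> {t0..<T}" for t
    by (rule lure_at_cong[OF _ _ bspec[OF sol that]]) (use that in \<open>auto simp: X_def U_def\<close>)
  have after: "lure_at N A B C D \<Phi> t0 X U t" if t: "T \<le> t" "t \<le> T + h" for t
  proof -
    have yvt: "lure_at N A B C D \<Phi> T y v t" using yv t by auto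
    have eq1: "lure_field A B X U i \<tau> = ?w i \<tau>" if "\<tau> \<in> {t0..T} - {T}" for i \<tau>
      using that by (simp add: lure_field_def X_def U_def)
    have eq2: "lure_field A B X U i \<tau> = lure_field A B y v i \<tau>" if "\<tau> \<in> {T..t}" for i \<tau>
      using that by (simp add: lure_field_def X_def U_def)
    have "lure_field A B X U i absolutely_integrable_on {t0..t} \<and>
       (lure_field A B X U i has_integral (vec_index (X t) i - vec_index (X t0) i)) {t0..t}" if i: "i < N" for i
    proof
      have un: "{t0..T} \<union> {T..t} = {t0..t}" using T t by auto
      have "?w i absolutely_integrable_on {t0..T}"
      proof (rule absolutely_integrable_spike[where f = "\<lambda>\<tau>. if \<tau> = T then 0 else ?w i \<tau>" and S = "{T}"])
        show "(\<lambda>\<tau>. if \<tau> = T then 0 else ?w i \<tau>) absolutely_integrable_on {t0..T}"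
        proof (rule absolutely_integrable_integrable_bound[where g = "\<lambda>_. \<bar>R\<bar>"])
          show "(\<lambda>\<tau>. if \<tau> = T then 0 else ?w i \<tau>) integrable_on {t0..T}"
            by (rule integrable_spike_finite[OF _ _ wi[OF i], of "{T}"]) auto
          show "norm (if \<tau> = T then 0 else ?w i \<tau>) \<le> \<bar>R\<bar>" if "\<tau> \<in> {t0..T}" for \<tau>
            using bd[of \<tau> i] that i by auto
        qed auto
      qed auto
      then have a1: "lure_field A B X U i absolutely_integrable_on {t0..T}"
        by (rule absolutely_integrable_spike[where S = "{T}"]) (use eq1 in auto)
      have a2: "lure_field A B X U i absolutely_integrable_on {T..t}"
        by (rule absolutely_integrable_spike[where f = "lure_field A B y v i" and S = "{}"])
          (use eq2 yvt i in \<open>auto simp: lure_at_def\<close>)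
      show "lure_field A B X U i absolutely_integrable_on {t0..t}"
        using absolutely_integrable_Un[OF a1 a2] unfolding un .
      have i1: "(lure_field A B X U i has_integral integral {t0..T} (?w i)) {t0..T}"
        by (rule has_integral_spike_finite[where S = "{T}", OF _ eq1 integrable_integral[OF wi[OF i]]]) simp_all
      have "(lure_field A B y v i has_integral (vec_index (y t) i - vec_index (y T) i)) {T..t}"
        using yvt i by (simp add: lure_at_def)
      then have i2: "(lure_field A B X U i has_integral (vec_index (y t) i - vec_index (y T) i)) {T..t}"
        by (rule has_integral_spike_finite[of "{}", rotated 2]) (use eq2 in auto)
      have "(lure_field A B X U i has_integral (integral {t0..T} (?w i) + (vec_index (y t) i - vec_index (y T) i))) {t0..t}"
        by (rule has_integral_combine[OF _ _ i1 i2]) (use T t in auto)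
      also have "integral {t0..T} (?w i) + (vec_index (y t) i - vec_index (y T) i) = vec_index (X t) i - vec_index (X t0) i"
        using T t i by (simp add: X_def yT xT_def)
      finally show "(lure_field A B X U i has_integral (vec_index (X t) i - vec_index (X t0) i)) {t0..t}" .
    qed
    then show ?thesis using yvt t by (simp add: lure_at_def X_def U_def)
  qed
  show ?thesis
  proof (intro exI conjI)
    show "\<forall>t\<in>{t0..<T + h}. lure_at N A B C D \<Phi> t0 X U t"
    proof
      fix t assume "t \<in> {t0..<T + h}"
      then show "lure_at N A B C D \<Phi> t0 X U t" using before[of t] after[of t] by (cases "t < T") auto
    qed
    show "\<forall>t\<in>{t0..<T}. X t = x t \<and> U t = u t" by (auto simp: X_def U_def)
    show "h > 0" by (rule h)
  qed
qed

text \<open>A solution is continued step by step, each time by at least half of what is possible. If the endpoints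
  stayed below a finite supremum \<open>L\<close>, the limit solution on \<open>[t0, L)\<close> could itself be extended beyond
  \<open>L\<close>, and a step taken shortly before \<open>L\<close> would have had to use half of this extension.\<close>

lemma lure_extend_to_infinity:
  assumes ss: "state_space N A B C" and wp: "lure_well_posed N A B C D \<Phi>" and t0: "0 \<le> t0" "t0 < T"
    and sol: "\<forall>t\<in>{t0..<T}. lure_at N A B C D \<Phi> t0 x u t"
    and bd: "\<And>T y v. t0 < T \<Longrightarrow> \<forall>t\<in>{t0..<T}. lure_at N A B C D \<Phi> t0 y v t \<Longrightarrow>
      \<exists>R. \<forall>t\<in>{t0..<T}. \<forall>i<N. \<bar>lure_field A B y v i t\<bar> \<le> R"
  shows "\<exists>y v. (\<forall>t\<in>{t0..}. lure_at N A B C D \<Phi> t0 y v t) \<and> (\<forall>t\<in>{t0..<T}. y t = x t \<and> v t = u t)"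
proof -
  let ?sol = "\<lambda>T y v. t0 < T \<and> (\<forall>t\<in>{t0..<T}. lure_at N A B C D \<Phi> t0 y v t)"
  \<comment> \<open>partial solutions are triples of an endpoint, a state and an input; \<open>reach\<close> collects the
    endpoints of their extensions, cut off at length one to have a supremum\<close>
  define ext where "ext = (\<lambda>(S, y, v) (S', y', v'). S < S' \<and> ?sol S' y' v' \<and> (\<forall>t\<in>{t0..<S}. y' t = y t \<and> v' t = v t))"
  define reach where "reach p = {S'. S' \<le> fst p + 1 \<and> (\<exists>y' v'. ext p (S', y', v'))}" for p
  define good where "good = (\<lambda>(S, y, v). ?sol S y v)"
  have extend: "\<exists>h>0. \<exists>y' v'. ?sol (S + h) y' v' \<and> (\<forall>t\<in>{t0..<S}. y' t = y t \<and> v' t = v t)" if "?sol S y v" for S y v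
  proof -
    note S = that
    obtain R where R: "\<forall>t\<in>{t0..<S}. \<forall>i<N. \<bar>lure_field A B y v i t\<bar> \<le> R"
      using bd[OF conjunct1[OF S] conjunct2[OF S]] by (elim exE)
    then have "\<exists>h>0. \<exists>y' v'. (\<forall>t\<in>{t0..<S + h}. lure_at N A B C D \<Phi> t0 y' v' t) \<and> (\<forall>t\<in>{t0..<S}. y' t = y t \<and> v' t = v t)"
      using S R by (intro lure_extend_past_endpoint[OF ss wp t0(1), where R = R]) auto
    then obtain h y' v' where "h > 0" "\<forall>t\<in>{t0..<S + h}. lure_at N A B C D \<Phi> t0 y' v' t" "\<forall>t\<in>{t0..<S}. y' t = y t \<and> v' t = v t"
      by blast
    then show ?thesis using that by (intro exI[of _ h] conjI exI[of _ y'] exI[of _ v']) auto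
  qed
  have shrink: "?sol S' y v" if "?sol S y v" "t0 < S'" "S' \<le> S" for S S' y v using that by auto
  have reach_bdd: "bdd_above (reach p)" for p unfolding reach_def by (rule bdd_aboveI[of _ "fst p + 1"]) auto
  have next_ex: "\<exists>q. good q \<and> (ext p q \<and> (fst p + Sup (reach p)) / 2 \<le> fst q)" if p: "good p" for p
  proof -
    obtain S y v where pe: "p = (S, y, v)" by (cases p)
    have S: "?sol S y v" using p by (simp add: good_def pe)
    obtain h y' v' where h: "h > 0" "?sol (S + h) y' v'" "\<forall>t\<in>{t0..<S}. y' t = y t \<and> v' t = v t"
      using extend[OF S] by blast
    define S' where "S' = S + min h 1"
    have "ext p (S', y', v')" unfolding ext_def pe using h S shrink[OF h(2), of S'] by (auto simp: S'_def)
    then have mem: "S' \<in> reach p" unfolding reach_def by (auto simp: pe S'_def)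
    have "S < S'" using h by (simp add: S'_def)
    also have "S' \<le> Sup (reach p)" by (rule cSup_upper[OF mem reach_bdd])
    finally have mid: "(S + Sup (reach p)) / 2 < Sup (reach p)" by simp
    have "reach p \<noteq> {}" using mem by auto
    from less_cSupD[OF this mid] obtain S'' where S'': "S'' \<in> reach p" "(S + Sup (reach p)) / 2 < S''"
      by (elim bexE) (rule that)
    then obtain y'' v'' where "ext p (S'', y'', v'')" unfolding reach_def by auto
    then show ?thesis using S'' by (intro exI[of _ "(S'', y'', v'')"]) (auto simp: ext_def good_def pe)
  qed
  have good0: "good (T, x, u)" using sol t0 by (simp add: good_def)
  obtain p where p0: "p 0 = (T, x, u)" and pg: "\<And>n. good (p n)"
    and pS: "\<And>n. ext (p n) (p (Suc n)) \<and> (fst (p n) + Sup (reach (p n))) / 2 \<le> fst (p (Suc n))"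
  proof -
    have "\<exists>p. \<forall>n. (good (p n) \<and> (n = 0 \<longrightarrow> p n = (T, x, u))) \<and> (ext (p n) (p (Suc n)) \<and> (fst (p n) + Sup (reach (p n))) / 2 \<le> fst (p (Suc n)))"
    proof (rule dependent_nat_choice)
      show "\<exists>q. good q \<and> (0 = (0::nat) \<longrightarrow> q = (T, x, u))" using good0 by blast
      show "\<exists>r. (good r \<and> (Suc n = 0 \<longrightarrow> r = (T, x, u))) \<and> (ext q r \<and> (fst q + Sup (reach q)) / 2 \<le> fst r)"
        if "good q \<and> (n = 0 \<longrightarrow> q = (T, x, u))" for q n
        using next_ex[of q] that by auto
    qed
    then show ?thesis using that by blast
  qed
  define S where "S n = fst (p n)" for n
  define y where "y n = fst (snd (p n))" for n
  define v where "v n = snd (snd (p n))" for n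
  have pn: "p n = (S n, y n, v n)" for n by (simp add: S_def y_def v_def)
  have solS: "?sol (S n) (y n) (v n)" for n using pg[of n] unfolding pn good_def by simp
  have SS: "S n < S (Suc n)" and step: "\<And>t. t \<in> {t0..<S n} \<Longrightarrow> y (Suc n) t = y n t \<and> v (Suc n) t = v n t" for n
    using pS[of n] unfolding pn ext_def by auto
  have half: "(S n + Sup (reach (p n))) / 2 \<le> S (Suc n)" for n using pS[of n] by (simp add: S_def)
  have mono: "S n \<le> S m" if "n \<le> m" for n m by (rule lift_Suc_mono_le[of S, OF _ that]) (rule less_imp_le[OF SS])
  have agree: "y m t = y n t \<and> v m t = v n t" if "n \<le> m" "t \<in> {t0..<S n}" for n m t
    using that(1)
  proof (induction m rule: dec_induct)
    case (step k)
    have "t \<in> {t0..<S k}" using that(2) mono[OF step(1)] by auto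
    then show ?case using \<open>\<And>n t. t \<in> {t0..<S n} \<Longrightarrow> y (Suc n) t = y n t \<and> v (Suc n) t = v n t\<close> step by simp
  qed simp
  \<comment> \<open>the glued solution takes its value at \<open>t\<close> from the first stage that is defined there\<close>
  define k where "k t = (LEAST n. t < S n)" for t
  define Y where "Y t = y (k t) t" for t
  define V where "V t = v (k t) t" for t
  have YV: "Y t = y n t \<and> V t = v n t" if t: "t \<in> {t0..<S n}" for n t
  proof -
    have "t < S (k t)" unfolding k_def by (rule LeastI[of _ n]) (use t in auto)
    moreover have "k t \<le> n" unfolding k_def by (rule Least_le) (use t in auto)
    ultimately show ?thesis using agree[of "k t" n t] t by (simp add: Y_def V_def)
  qed
  have at: "lure_at N A B C D \<Phi> t0 Y V t" if t: "t \<in> {t0..<S n}" for n t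
  proof (rule lure_at_cong)
    show "t0 \<le> t" using t by simp
    show "y n \<tau> = Y \<tau> \<and> v n \<tau> = V \<tau>" if "\<tau> \<in> {t0..t}" for \<tau> using YV[of \<tau> n] that t by auto
    show "lure_at N A B C D \<Phi> t0 (y n) (v n) t" using solS[of n] t by blast
  qed
  have unbounded: "\<exists>n. t < S n" for t
  proof (rule ccontr)
    assume "\<not> (\<exists>n. t < S n)"
    then have le: "S n \<le> t" for n by (simp add: not_less)
    then have bdd: "bdd_above (range S)" by (intro bdd_aboveI2)
    define L where "L = Sup (range S)"
    have SL: "S n < L" for n
      using SS[of n] cSup_upper[OF _ bdd, of "S (Suc n)"] by (simp add: L_def)
    have solL: "?sol L Y V"
    proof
      show "t0 < L" using solS[of 0] SL[of 0] by simp
      show "\<forall>t\<in>{t0..<L}. lure_at N A B C D \<Phi> t0 Y V t"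
      proof
        fix t assume t: "t \<in> {t0..<L}"
        then obtain n where "t < S n" unfolding L_def using less_cSup_iff[OF _ bdd] by auto
        then show "lure_at N A B C D \<Phi> t0 Y V t" using at t by auto
      qed
    qed
    obtain h y' v' where h: "h > 0" "?sol (L + h) y' v'" "\<forall>t\<in>{t0..<L}. y' t = Y t \<and> v' t = V t"
      using extend[OF solL] by blast
    \<comment> \<open>\<open>d \<le> 1 / 2\<close> keeps \<open>L + d\<close> below the cut-off of \<open>reach\<close> for stages within \<open>d / 2\<close> of \<open>L\<close>\<close>
    define d where "d = min h (1 / 2)"
    have d: "d > 0" "d \<le> h" "d \<le> 1 / 2" using h by (auto simp: d_def)
    have "L - d / 2 < Sup (range S)" using d by (simp add: L_def)
    then obtain n where n: "L - d / 2 < S n" using less_cSup_iff[OF _ bdd] by auto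
    have "ext (p n) (L + d, y', v')"
      unfolding pn ext_def prod.case
    proof (intro conjI)
      show "S n < L + d" using SL[of n] d by simp
      show "t0 < L + d" "\<forall>t\<in>{t0..<L + d}. lure_at N A B C D \<Phi> t0 y' v' t" using h(2) solL d by auto
      show "\<forall>t\<in>{t0..<S n}. y' t = y n t \<and> v' t = v n t" using h(3) YV SL[of n] by force
    qed
    then have "L + d \<in> reach (p n)" unfolding reach_def using n d by (auto simp: S_def[symmetric])
    then have "L + d \<le> Sup (reach (p n))" by (rule cSup_upper[OF _ reach_bdd])
    then have "L < S (Suc n)" using half[of n] n d by simp
    then show False using SL[of "Suc n"] by simp
  qed
  show ?thesis
  proof (intro exI conjI ballI)
    fix t assume "t \<in> {t0..}"
    then show "lure_at N A B C D \<Phi> t0 Y V t" using unbounded[of t] at by auto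
  next
    fix t assume "t \<in> {t0..<T}"
    moreover have "S 0 = T" "y 0 = x" "v 0 = u" using p0 by (simp_all add: S_def y_def v_def)
    ultimately show "Y t = x t" "V t = u t" using YV[of t 0] by auto
  qed
qed

section \<open>The circle criterion\<close>

text \<open>The sector \<open>[0, k]\<close> as a passivity condition on the shifted output \<open>\<sigma> + u / k\<close>, obtained from
  \<open>\<Phi>\<^sup>2 \<le> k \<sigma> \<Phi>\<close> after cancelling \<open>\<sigma>\<^sup>2\<close>.\<close>

lemma sector_inequality:
  assumes "\<Phi> \<in> sect k" "0 < k" "0 \<le> t" "u = - \<Phi> t \<sigma>"
  shows "u * (\<sigma> + u / k) \<le> 0"
proof -
  have s: "0 \<le> \<sigma> * \<Phi> t \<sigma>" "\<sigma> * \<Phi> t \<sigma> \<le> k * \<sigma>\<^sup>2" "\<Phi> t 0 = 0"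
    using assms(1,3) by (auto simp: sect_def)
  have "(\<Phi> t \<sigma>)\<^sup>2 \<le> k * (\<sigma> * \<Phi> t \<sigma>)"
  proof (cases "\<sigma> = 0")
    case False
    have "(\<sigma> * \<Phi> t \<sigma>) * (\<sigma> * \<Phi> t \<sigma>) \<le> (k * \<sigma>\<^sup>2) * (\<sigma> * \<Phi> t \<sigma>)" using s by (intro mult_right_mono)
    then have "\<sigma>\<^sup>2 * (\<Phi> t \<sigma>)\<^sup>2 \<le> \<sigma>\<^sup>2 * (k * (\<sigma> * \<Phi> t \<sigma>))" by (simp add: power2_eq_square mult_ac)
    then show ?thesis using False by (simp add: mult_le_cancel_left_pos)
  qed (use s in simp)
  then show ?thesis using assms(2,4) by (simp add: field_simps power2_eq_square)
qed

lemma vnorm_nonneg: "0 \<le> vnorm v"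
  by (simp add: vnorm_def scalar_prod_def sum_nonneg)

lemma vnorm_square: "v \<in> carrier_vec N \<Longrightarrow> (vnorm v)\<^sup>2 = (\<Sum>a<N. (vec_index v a)\<^sup>2)"
  by (simp add: vnorm_def scalar_prod_def sum_nonneg power2_eq_square atLeast0LessThan)

lemma matrix_square_bound:
  fixes T :: "nat \<Rightarrow> nat \<Rightarrow> real"
  shows "(\<Sum>a<N. (\<Sum>i<N. T a i * z i)\<^sup>2) \<le> (\<Sum>a<N. \<Sum>i<N. (T a i)\<^sup>2) * (\<Sum>i<N. (z i)\<^sup>2)"
  unfolding sum_distrib_right[of _ "{..<N}" "\<Sum>i<N. (z i)\<^sup>2"]
  by (intro sum_mono) (simp only: Cauchy_Schwarz_ineq_sum flip: sum_distrib_right)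

text \<open>The shifted plant \<open>1 / k + g / f\<close> is strictly positive real, hence strictly passive, and it is in
  feedback with a passive nonlinearity. Besides the decay of the state, the right hand side of the
  differential equation is bounded by the initial state; this is what continuation of solutions requires.
  The constants depend neither on \<open>t0\<close> nor on the solution.\<close>

theorem circle_criterion_estimate:
  assumes min: "minimal_realization N A B C D g f" and st: "stable (cpoly f)" and deg: "degree g \<le> degree f"
    and k: "0 < k" and \<epsilon>: "0 < \<epsilon>"
    and freq: "\<And>\<omega>::real. \<epsilon> \<le> 1 / k + Re (poly (cpoly g) (\<i> * of_real \<omega>) / poly (cpoly f) (\<i> * of_real \<omega>))"
    and \<Phi>: "\<Phi> \<in> sect k"
  shows "\<exists>M a. 0 < M \<and> 0 < a \<and> (\<forall>t0 t1 x u. 0 \<le> t0 \<longrightarrow> t0 \<le> t1 \<longrightarrow>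
    (\<forall>t\<in>{t0..t1}. lure_at N A B C D \<Phi> t0 x u t) \<longrightarrow>
      vnorm (x t1) \<le> M * exp (- a * (t1 - t0)) * vnorm (x t0) \<and>
      (\<forall>i<N. \<bar>lure_field A B x u i t1\<bar> \<le> M * vnorm (x t0)))"
proof -
  obtain c q Z T where c: "degree c = N" "lead_coeff c = 1" "stable (cpoly c)" and q: "degree q \<le> N" "q * f = g * c"
    and rep': "\<forall>x \<in> carrier_vec N. \<forall>a<N. vec_index x a = (\<Sum>i<N. T a i * (\<Sum>b<N. Z i b * vec_index x b))"
    and dyn': "\<forall>x \<in> carrier_vec N. \<forall>u. \<forall>i<N. (\<Sum>b<N. Z i b * vec_index (A *\<^sub>v x + u \<cdot>\<^sub>v B) b)
      = (if Suc i < N then (\<Sum>b<N. Z (Suc i) b * vec_index x b)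
         else u - (\<Sum>j<N. coeff c j * (\<Sum>b<N. Z j b * vec_index x b)))"
    and out': "\<forall>x \<in> carrier_vec N. \<forall>u. scalar_prod C x + D * u = (\<Sum>i<N. coeff q i * (\<Sum>b<N. Z i b * vec_index x b))
      + coeff q N * (u - (\<Sum>j<N. coeff c j * (\<Sum>b<N. Z j b * vec_index x b)))"
    using minimal_companion_coordinates[OF min st deg] by (elim exE conjE) (rule that)
  note rep = rep'[rule_format] and dyn = dyn'[rule_format] and out = out'[rule_format]
  have ss: "A \<in> carrier_mat N N" "B \<in> carrier_vec N"
    using min by (auto simp: minimal_realization_def realizes_def state_space_def)
  \<comment> \<open>the numerator of \<open>1 / k + g / f\<close> over the denominator \<open>c\<close>\<close>
  define h where "h = q + Polynomial.smult (1 / k) c"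
  have "\<epsilon> \<le> Re (poly (cpoly h) (\<i> * of_real \<omega>) / poly (cpoly c) (\<i> * of_real \<omega>))" for \<omega> :: real
  proof -
    let ?s = "\<i> * complex_of_real \<omega>"
    have nz: "poly (cpoly c) ?s \<noteq> 0" "poly (cpoly f) ?s \<noteq> 0"
      using stable_nonzero[OF c(3), of ?s] stable_nonzero[OF st, of ?s] by simp_all
    have "poly (cpoly q) ?s * poly (cpoly f) ?s = poly (cpoly g) ?s * poly (cpoly c) ?s"
      using q(2) by (metis cpoly_simps(4) poly_mult)
    then have "poly (cpoly q) ?s / poly (cpoly c) ?s = poly (cpoly g) ?s / poly (cpoly f) ?s"
      using nz by (simp add: frac_eq_eq)
    moreover have "poly (cpoly h) ?s / poly (cpoly c) ?s = poly (cpoly q) ?s / poly (cpoly c) ?s + of_real (1 / k)"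
      using nz by (simp add: h_def cpoly_simps add_divide_distrib)
    ultimately show ?thesis using freq[of \<omega>] by (simp del: Re_divide)
  qed
  moreover have "degree h \<le> N" unfolding h_def using q(1) c(1) by (intro degree_add_le) (auto intro: order.trans[OF degree_smult_le])
  ultimately have "\<exists>P \<eta>. \<eta> > 0 \<and> (\<forall>i j. P i j = P j i) \<and>
    (\<forall>z. \<eta> * (\<Sum>i<N. (z i)\<^sup>2) \<le> (\<Sum>i<N. \<Sum>j<N. P i j * (z i * z j))) \<and>
    (\<forall>z. 2 * (\<Sum>i<N. \<Sum>j<N. P i j * (z i * z (Suc j)))
       \<le> 2 * (\<Sum>i\<le>N. coeff c i * z i) * (\<Sum>i\<le>N. coeff h i * z i) - \<eta> * (\<Sum>i\<le>N. (z i)\<^sup>2))"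
    by (intro companion_kyp[OF c(3,1,2) _ \<epsilon>])
  then obtain P \<eta> where \<eta>: "\<eta> > 0" and sym: "\<forall>i j. P i j = P j i"
    and pos: "\<forall>z. \<eta> * (\<Sum>i<N. (z i)\<^sup>2) \<le> (\<Sum>i<N. \<Sum>j<N. P i j * (z i * z j))"
    and kyp: "\<forall>z. 2 * (\<Sum>i<N. \<Sum>j<N. P i j * (z i * z (Suc j)))
       \<le> 2 * (\<Sum>i\<le>N. coeff c i * z i) * (\<Sum>i\<le>N. coeff h i * z i) - \<eta> * (\<Sum>i\<le>N. (z i)\<^sup>2)"
    by (elim exE conjE) (rule that)
  define \<zeta> where "\<zeta> x i = (\<Sum>b<N. Z i b * vec_index x b)" for x :: "real Matrix.vec" and i
  \<comment> \<open>the state in companion coordinates, continued by the top derivative for the input value \<open>u\<close>\<close>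
  define zz where "zz x u i = (if i < N then \<zeta> x i else u - (\<Sum>j<N. coeff c j * \<zeta> x j))" for x u i
  have cN: "coeff c N = 1" using c by simp
  have up: "(\<Sum>i\<le>N. r i * zz x u i) = (\<Sum>i<N. r i * \<zeta> x i) + r N * (u - (\<Sum>j<N. coeff c j * \<zeta> x j))" for r :: "nat \<Rightarrow> real" and x u
    by (simp add: lessThan_Suc_atMost[symmetric] zz_def)
  have dis: "2 * (\<Sum>i<N. \<Sum>j<N. P i j * (zz x u i * zz x u (Suc j))) \<le> - \<eta> * (\<Sum>i\<le>N. (zz x u i)\<^sup>2)"
    if x: "x \<in> carrier_vec N" and t: "0 \<le> t" and u: "u = - \<Phi> t (scalar_prod C x + D * u)" for x u t
  proof -
    have 1: "(\<Sum>i\<le>N. coeff c i * zz x u i) = u" unfolding up cN by simp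
    have "(\<Sum>i\<le>N. coeff h i * zz x u i) = (\<Sum>i\<le>N. coeff q i * zz x u i) + (\<Sum>i\<le>N. coeff c i * zz x u i) / k"
      unfolding sum_divide_distrib sum.distrib[symmetric] by (intro sum.cong refl) (simp add: h_def distrib_right)
    also have "(\<Sum>i\<le>N. coeff q i * zz x u i) = scalar_prod C x + D * u"
      unfolding up out[OF x] \<zeta>_def by (rule refl)
    finally have 2: "(\<Sum>i\<le>N. coeff h i * zz x u i) = (scalar_prod C x + D * u) + u / k" unfolding 1 .
    have "u * ((scalar_prod C x + D * u) + u / k) \<le> 0" by (rule sector_inequality[OF \<Phi> k t u])
    then show ?thesis using kyp[rule_format, of "zz x u"] unfolding 1 2 by simp
  qed
  define K where "K = (\<Sum>i<N. \<Sum>j<N. \<bar>P i j\<bar>)"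
  have K: "0 \<le> K" by (simp add: K_def sum_nonneg)
  define MT where "MT = (\<Sum>a<N. \<Sum>i<N. (T a i)\<^sup>2)"
  define MZ where "MZ = (\<Sum>i<N. \<Sum>b<N. (Z i b)\<^sup>2)"
  have MT: "0 \<le> MT" and MZ: "0 \<le> MZ" by (simp_all add: MT_def MZ_def sum_nonneg)
  have norm_z: "(vnorm x)\<^sup>2 \<le> MT * (\<Sum>i<N. (\<zeta> x i)\<^sup>2)" if x: "x \<in> carrier_vec N" for x
  proof -
    have "(vnorm x)\<^sup>2 = (\<Sum>a<N. (\<Sum>i<N. T a i * \<zeta> x i)\<^sup>2)"
      unfolding vnorm_square[OF x] \<zeta>_def by (intro sum.cong refl arg_cong[where f = "\<lambda>r. r\<^sup>2"] rep[OF x]) auto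
    then show ?thesis using matrix_square_bound[where N = N and T = T and z = "\<zeta> x"] by (simp add: MT_def)
  qed
  have z_norm: "(\<Sum>i<N. (\<zeta> x i)\<^sup>2) \<le> MZ * (vnorm x)\<^sup>2" if x: "x \<in> carrier_vec N" for x
    using matrix_square_bound[where N = N and T = Z and z = "vec_index x"] unfolding vnorm_square[OF x] \<zeta>_def MZ_def .
  \<comment> \<open>half of the rate of the quadratic form, since the norm is the square root of a form\<close>
  define a where "a = \<eta> / (K + 1) / 2"
  have a: "0 < a" using \<eta> K by (simp add: a_def)
  define L where "L = (2 * K / \<eta>)\<^sup>2"
  have L: "0 \<le> L" by (simp add: L_def)
  define M1 where "M1 = MT * (K / \<eta>) * MZ"
  define M2 where "M2 = MT * L * (K / \<eta>) * MZ"
  have M12: "0 \<le> M1" "0 \<le> M2" using MT MZ K L \<eta> by (simp_all add: M1_def M2_def)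
  define M where "M = sqrt M1 + sqrt M2 + 1"
  have M: "sqrt M1 \<le> M" "sqrt M2 \<le> M" "0 < M" using M12 by (simp_all add: M_def add_nonneg_pos)
  have main: "vnorm (x t1) \<le> M * exp (- a * (t1 - t0)) * vnorm (x t0) \<and>
      (\<forall>i<N. \<bar>lure_field A B x u i t1\<bar> \<le> M * vnorm (x t0))"
    if t0: "0 \<le> t0" "t0 \<le> t1" and sol: "\<forall>t\<in>{t0..t1}. lure_at N A B C D \<Phi> t0 x u t" for t0 t1 x u
  proof -
    have xc: "x t \<in> carrier_vec N" and ut: "u t = - \<Phi> t (scalar_prod C (x t) + D * u t)" if "t \<in> {t0..t1}" for t
      using sol that by (auto simp: lure_at_def)
    define z where "z i \<tau> = zz (x \<tau>) (u \<tau>) i" for i \<tau>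
    have field: "(\<Sum>b<N. Z i b * lure_field A B x u b \<tau>) = z (Suc i) \<tau>" if "i < N" "\<tau> \<in> {t0..t1}" for i \<tau>
      unfolding lure_field_def dyn[OF xc[OF that(2)] that(1)] z_def zz_def \<zeta>_def by (rule refl)
    have disz: "2 * (\<Sum>i<N. \<Sum>j<N. P i j * (z i \<tau> * z (Suc j) \<tau>)) \<le> - \<eta> * (\<Sum>i\<le>N. (z i \<tau>)\<^sup>2)" if "\<tau> \<in> {t0..t1}" for \<tau>
      unfolding z_def by (rule dis[OF xc[OF that] _ ut[OF that]]) (use that t0 in auto)
    have decay: "(\<Sum>i<N. (z i t1)\<^sup>2) \<le> K / \<eta> * exp (- (\<eta> / (K + 1)) * (t1 - t0)) * (\<Sum>i<N. (z i t0)\<^sup>2)"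
      unfolding K_def
    proof (rule chain_exponential_decay[OF _ \<eta> _ t0(2) _ disz])
      show "P i j = P j i" for i j using sym by blast
      show "\<eta> * (\<Sum>i<N. (z i)\<^sup>2) \<le> (\<Sum>i<N. \<Sum>j<N. P i j * (z i * z j))" for z using pos by blast
      fix i t assume i: "i < N" and t: "t \<in> {t0..t1}"
      have "((\<lambda>\<tau>. \<Sum>b<N. Z i b * lure_field A B x u b \<tau>) has_integral
        (\<Sum>b<N. Z i b * (vec_index (x t) b - vec_index (x t0) b))) {t0..t}"
        using sol t by (intro has_integral_sum has_integral_mult_right) (auto simp: lure_at_def)
      also have "(\<Sum>b<N. Z i b * (vec_index (x t) b - vec_index (x t0) b)) = z i t - z i t0"
        using i by (simp add: z_def zz_def \<zeta>_def right_diff_distrib sum_subtractf)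
      finally show "(z (Suc i) has_integral (z i t - z i t0)) {t0..t}"
        by (rule has_integral_eq[rotated]) (use field i t in auto)
    qed
    have zS: "(\<Sum>i<N. (z i \<tau>)\<^sup>2) = (\<Sum>i<N. (\<zeta> (x \<tau>) i)\<^sup>2)" for \<tau> by (simp add: z_def zz_def)
    have in0: "t0 \<in> {t0..t1}" and in1: "t1 \<in> {t0..t1}" using t0 by auto
    let ?e = "exp (- a * (t1 - t0))"
    have ee: "exp (- (\<eta> / (K + 1)) * (t1 - t0)) = ?e\<^sup>2"
    proof -
      have "\<eta> / (K + 1) = a + a" unfolding a_def by (rule field_sum_of_halves[symmetric])
      then have "- (\<eta> / (K + 1)) * (t1 - t0) = - a * (t1 - t0) + - a * (t1 - t0)"
        by (simp only: minus_add_distrib distrib_right)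
      then show ?thesis by (simp only: power2_eq_square exp_add)
    qed
    have e1: "?e \<le> 1" using a t0 by simp
    have S1: "(\<Sum>i<N. (z i t1)\<^sup>2) \<le> K / \<eta> * ?e\<^sup>2 * (MZ * (vnorm (x t0))\<^sup>2)"
    proof -
      have "K / \<eta> * ?e\<^sup>2 * (\<Sum>i<N. (z i t0)\<^sup>2) \<le> K / \<eta> * ?e\<^sup>2 * (MZ * (vnorm (x t0))\<^sup>2)"
        unfolding zS using z_norm[OF xc[OF in0]] K \<eta> by (intro mult_left_mono) auto
      then show ?thesis using decay unfolding ee by linarith
    qed
    have "(vnorm (x t1))\<^sup>2 \<le> MT * (\<Sum>i<N. (z i t1)\<^sup>2)" unfolding zS by (rule norm_z[OF xc[OF in1]])
    also have "\<dots> \<le> MT * (K / \<eta> * ?e\<^sup>2 * (MZ * (vnorm (x t0))\<^sup>2))" by (rule mult_left_mono[OF S1 MT])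
    also have "\<dots> = (sqrt M1 * ?e * vnorm (x t0))\<^sup>2" using M12 by (simp add: M1_def power_mult_distrib mult_ac)
    finally have "vnorm (x t1) \<le> sqrt M1 * ?e * vnorm (x t0)"
      by (rule power2_le_imp_le) (use M12 vnorm_nonneg in auto)
    also have "\<dots> \<le> M * ?e * vnorm (x t0)" using M vnorm_nonneg by (intro mult_right_mono) auto
    finally have 1: "vnorm (x t1) \<le> M * ?e * vnorm (x t0)" .
    have "\<bar>lure_field A B x u i t1\<bar> \<le> M * vnorm (x t0)" if i: "i < N" for i
    proof -
      let ?w = "A *\<^sub>v x t1 + u t1 \<cdot>\<^sub>v B"
      have wc: "?w \<in> carrier_vec N" using ss xc[OF in1] by auto
      have "(lure_field A B x u i t1)\<^sup>2 \<le> (\<Sum>a<N. (vec_index ?w a)\<^sup>2)"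
        unfolding lure_field_def using i by (intro member_le_sum) auto
      also have "\<dots> = (vnorm ?w)\<^sup>2" using vnorm_square[OF wc] by simp
      also have "\<dots> \<le> MT * (\<Sum>k<N. (\<zeta> ?w k)\<^sup>2)" by (rule norm_z[OF wc])
      also have "(\<Sum>k<N. (\<zeta> ?w k)\<^sup>2) = (\<Sum>k<N. (z (Suc k) t1)\<^sup>2)"
        using field[OF _ in1] by (intro sum.cong refl) (simp add: \<zeta>_def lure_field_def)
      also have "MT * \<dots> \<le> MT * (\<Sum>k\<le>N. (z k t1)\<^sup>2)"
      proof (rule mult_left_mono[OF _ MT])
        have "(\<Sum>k\<le>N. (z k t1)\<^sup>2) = (z 0 t1)\<^sup>2 + (\<Sum>k<N. (z (Suc k) t1)\<^sup>2)"
          unfolding lessThan_Suc_atMost[symmetric] by (rule sum.lessThan_Suc_shift)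
        then show "(\<Sum>k<N. (z (Suc k) t1)\<^sup>2) \<le> (\<Sum>k\<le>N. (z k t1)\<^sup>2)" by simp
      qed
      also have "\<dots> \<le> MT * (L * (\<Sum>k<N. (z k t1)\<^sup>2))"
        unfolding L_def K_def by (intro mult_left_mono[OF _ MT] dissipation_bounds_top_derivative[OF \<eta> disz[OF in1]])
      also have "\<dots> \<le> MT * (L * (K / \<eta> * 1 * (MZ * (vnorm (x t0))\<^sup>2)))"
      proof (intro mult_left_mono MT L order.trans[OF S1] mult_right_mono)
        show "?e\<^sup>2 \<le> 1" using e1 by (simp add: power_le_one)
      qed (use K \<eta> MZ in auto)
      also have "\<dots> = (sqrt M2 * vnorm (x t0))\<^sup>2" using M12 by (simp add: M2_def power_mult_distrib mult_ac)
      finally have "\<bar>lure_field A B x u i t1\<bar>\<^sup>2 \<le> (sqrt M2 * vnorm (x t0))\<^sup>2" by simp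
      then have "\<bar>lure_field A B x u i t1\<bar> \<le> sqrt M2 * vnorm (x t0)"
        by (rule power2_le_imp_le) (use M12 vnorm_nonneg in auto)
      also have "\<dots> \<le> M * vnorm (x t0)" using M vnorm_nonneg by (intro mult_right_mono) auto
      finally show ?thesis .
    qed
    with 1 show ?thesis by blast
  qed
  show ?thesis using main M(3) a by blast
qed

text \<open>Exponential decay with constants that are uniform in the initial time gives a linear
  \<open>\<delta>(\<epsilon>)\<close> and an attraction time that depends only on the radius of the ball and the target.\<close>

theorem circle_criterion:
  assumes min: "minimal_realization N A B C D g f" and st: "stable (cpoly f)" and deg: "degree g \<le> degree f"
    and k: "0 < k" and \<epsilon>: "0 < \<epsilon>"
    and freq: "\<And>\<omega>::real. \<epsilon> \<le> 1 / k + Re (poly (cpoly g) (\<i> * of_real \<omega>) / poly (cpoly f) (\<i> * of_real \<omega>))"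
  shows "absolutely_stable N A B C D k"
  unfolding absolutely_stable_def
proof (intro ballI impI)
  fix \<Phi> assume \<Phi>: "\<Phi> \<in> sect k" and wp: "lure_well_posed N A B C D \<Phi>"
  obtain M a where M: "0 < M" and a: "0 < a" and est: "\<forall>t0 t1 x u. 0 \<le> t0 \<longrightarrow> t0 \<le> t1 \<longrightarrow>
    (\<forall>t\<in>{t0..t1}. lure_at N A B C D \<Phi> t0 x u t) \<longrightarrow>
      vnorm (x t1) \<le> M * exp (- a * (t1 - t0)) * vnorm (x t0) \<and>
      (\<forall>i<N. \<bar>lure_field A B x u i t1\<bar> \<le> M * vnorm (x t0))"
    using circle_criterion_estimate[OF assms \<Phi>] by (elim exE conjE) (rule that)
  have ss: "state_space N A B C" using min by (auto simp: minimal_realization_def realizes_def)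
  have decay: "vnorm (x t) \<le> M * exp (- a * (t - t0)) * vnorm (x t0)"
    if t: "0 \<le> t0" "t0 \<le> t" and x: "lure_solution N A B C D \<Phi> t0 {t0..} x" for t0 t x
  proof -
    obtain u where u: "\<forall>t\<in>{t0..}. lure_at N A B C D \<Phi> t0 x u t" using x unfolding lure_solution_iff by (elim exE)
    have "\<forall>s\<in>{t0..t}. lure_at N A B C D \<Phi> t0 x u s" using u by auto
    then show ?thesis using est t by blast
  qed
  have extend: "\<exists>y. lure_solution N A B C D \<Phi> t0 {t0..} y \<and> (\<forall>t\<in>{t0..<T}. y t = x t)"
    if t0: "0 \<le> t0" "t0 < T" and x: "lure_solution N A B C D \<Phi> t0 {t0..<T} x" for t0 T x
  proof -
    obtain u where u: "\<forall>t\<in>{t0..<T}. lure_at N A B C D \<Phi> t0 x u t" using x unfolding lure_solution_iff by (elim exE)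
    have "\<exists>y v. (\<forall>t\<in>{t0..}. lure_at N A B C D \<Phi> t0 y v t) \<and> (\<forall>t\<in>{t0..<T}. y t = x t \<and> v t = u t)"
    proof (rule lure_extend_to_infinity[OF ss wp t0 u])
      fix T y v assume y: "\<forall>t\<in>{t0..<T}. lure_at N A B C D \<Phi> t0 y v t"
      show "\<exists>R. \<forall>t\<in>{t0..<T}. \<forall>i<N. \<bar>lure_field A B y v i t\<bar> \<le> R"
      proof (intro exI[of _ "M * vnorm (y t0)"] ballI)
        fix t assume t: "t \<in> {t0..<T}"
        then have "\<forall>s\<in>{t0..t}. lure_at N A B C D \<Phi> t0 y v s" using y by auto
        then show "\<forall>i<N. \<bar>lure_field A B y v i t\<bar> \<le> M * vnorm (y t0)" using est t t0(1) by auto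
      qed
    qed
    then show ?thesis unfolding lure_solution_iff by blast
  qed
  have complete: "lure_forward_complete N A B C D \<Phi>"
    unfolding lure_forward_complete_def
  proof (intro conjI allI impI ballI)
    fix t0 :: real and x0 :: "real Matrix.vec" assume t0: "0 \<le> t0" and x0: "x0 \<in> carrier_vec N"
    obtain h x where h: "h > 0" and x: "lure_solution N A B C D \<Phi> t0 {t0..t0 + h} x" "x t0 = x0"
      using wp t0 x0 unfolding lure_well_posed_def by blast
    have "lure_solution N A B C D \<Phi> t0 {t0..<t0 + h} x" using x(1) unfolding lure_solution_iff by force
    then obtain y where y: "lure_solution N A B C D \<Phi> t0 {t0..} y" "\<forall>t\<in>{t0..<t0 + h}. y t = x t"
      using extend[of t0 "t0 + h" x] t0 h by auto
    then show "\<exists>x. lure_solution N A B C D \<Phi> t0 {t0..} x \<and> x t0 = x0" using h x(2) by (intro exI[of _ y]) auto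
  next
    fix t0 T :: real and x assume "0 \<le> t0" "t0 < T" "lure_solution N A B C D \<Phi> t0 {t0..<T} x"
    then show "\<exists>y. lure_solution N A B C D \<Phi> t0 {t0..} y \<and> (\<forall>t\<in>{t0..<T}. y t = x t)" by (rule extend)
  qed
  have stable: "\<exists>\<delta>. filterlim \<delta> at_top at_top \<and> (\<forall>\<epsilon>>0. \<delta> \<epsilon> > (0::real) \<and>
        (\<forall>t0\<ge>0. \<forall>x. lure_solution N A B C D \<Phi> t0 {t0..} x \<and> vnorm (x t0) < \<delta> \<epsilon> \<longrightarrow> (\<forall>t\<ge>t0. vnorm (x t) < \<epsilon>)))"
  proof (intro exI[of _ "\<lambda>\<epsilon>. 1 / M * \<epsilon>"] conjI allI impI)
    show "filterlim (\<lambda>\<epsilon>. 1 / M * \<epsilon>) at_top at_top"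
      using M by (intro filterlim_tendsto_pos_mult_at_top[OF tendsto_const _ filterlim_ident]) simp
    fix \<epsilon> :: real assume "\<epsilon> > 0"
    then show "1 / M * \<epsilon> > 0" using M by simp
    fix t0 t :: real and x assume t0: "t0 \<ge> 0" "t0 \<le> t" and x: "lure_solution N A B C D \<Phi> t0 {t0..} x \<and> vnorm (x t0) < 1 / M * \<epsilon>"
    have "vnorm (x t) \<le> M * exp (- a * (t - t0)) * vnorm (x t0)" using decay t0 x by blast
    also have "\<dots> \<le> M * 1 * vnorm (x t0)"
      using M a t0 vnorm_nonneg by (intro mult_right_mono mult_left_mono) auto
    also have "\<dots> < \<epsilon>" using x M by (simp add: field_simps)
    finally show "vnorm (x t) < \<epsilon>" .
  qed
  have attractive: "\<forall>r>0. \<forall>\<eta>>0. \<exists>T\<ge>0. \<forall>t0\<ge>0. \<forall>x. lure_solution N A B C D \<Phi> t0 {t0..} x \<and> vnorm (x t0) < r \<longrightarrow>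
         (\<forall>t\<ge>t0 + T. vnorm (x t) < \<eta>)"
  proof (intro allI impI)
    fix r \<eta> :: real assume r: "r > 0" and \<eta>: "\<eta> > 0"
    define T where "T = max 0 (ln (M * r / \<eta>) / a)"
    have "ln (M * r / \<eta>) \<le> a * T" using a by (simp add: T_def max_def field_simps)
    then have "exp (ln (M * r / \<eta>)) \<le> exp (a * T)" by simp
    then have MT: "M * exp (- a * T) * r \<le> \<eta>" using M r \<eta> by (simp add: exp_minus field_simps)
    show "\<exists>T\<ge>0. \<forall>t0\<ge>0. \<forall>x. lure_solution N A B C D \<Phi> t0 {t0..} x \<and> vnorm (x t0) < r \<longrightarrow>
         (\<forall>t\<ge>t0 + T. vnorm (x t) < \<eta>)"
    proof (intro exI[of _ T] conjI allI impI)
      show "T \<ge> 0" by (simp add: T_def)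
      fix t0 t :: real and x assume t0: "t0 \<ge> 0" "t0 + T \<le> t" and x: "lure_solution N A B C D \<Phi> t0 {t0..} x \<and> vnorm (x t0) < r"
      have "t0 \<le> t" using t0 \<open>T \<ge> 0\<close> by simp
      then have "vnorm (x t) \<le> M * exp (- a * (t - t0)) * vnorm (x t0)" using decay t0(1) x by blast
      also have "\<dots> \<le> M * exp (- a * T) * vnorm (x t0)"
        using M a t0 vnorm_nonneg by (intro mult_right_mono mult_left_mono) auto
      also have "\<dots> < M * exp (- a * T) * r" using x M by (intro mult_strict_left_mono) auto
      finally show "vnorm (x t) < \<eta>" using MT by linarith
    qed
  qed
  show "lure_guas N A B C D \<Phi>" unfolding lure_guas_def using complete stable attractive by blast
qed

section \<open>Absolute stability of the interval Lur'e system\<close>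

theorem theorem7:
  fixes m n :: nat
    and a_lo a_hi b_lo b_hi :: "nat \<Rightarrow> real"
    and k :: real
  assumes "m \<le> n"
    and "\<And>i. i \<le> m \<Longrightarrow> a_lo i \<le> a_hi i"
    and "\<And>i. i \<le> n \<Longrightarrow> b_lo i \<le> b_hi i"
    and "0 \<notin> {b_lo n..b_hi n}"
    and "\<And>f. f \<in> interval_poly n b_lo b_hi \<Longrightarrow> hurwitz_stable f"
    and "0 < k"
    and "gamma0 m a_lo a_hi n b_lo b_hi < 0 \<Longrightarrow> k < - 1 / gamma0 m a_lo a_hi n b_lo b_hi"
  shows "\<forall>g \<in> interval_poly m a_lo a_hi. \<forall>f \<in> interval_poly n b_lo b_hi.
    \<forall>N A B C D. minimal_realization N A B C D g f \<longrightarrow> absolutely_stable N A B C D k"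
proof (intro ballI allI impI)
  fix g f N A B C D
  assume g: "g \<in> interval_poly m a_lo a_hi" and f: "f \<in> interval_poly n b_lo b_hi"
    and min: "minimal_realization N A B C D g f"
  define \<gamma> where "\<gamma> = min (gamma0 m a_lo a_hi n b_lo b_hi) 0"
  have "0 < 1 / k + \<gamma>"
  proof (cases "gamma0 m a_lo a_hi n b_lo b_hi < 0")
    case True
    then show ?thesis using assms(6,7) by (simp add: \<gamma>_def field_simps)
  next
    case False
    then show ?thesis using assms(6) by (simp add: \<gamma>_def)
  qed
  moreover have "stable (cpoly f)" using assms(5)[OF f] by (simp add: hurwitz_stable_def stable_def)
  moreover have "degree g \<le> degree f"
  proof -
    have "degree g \<le> m" using g unfolding interval_poly_def
      by (auto intro!: degree_sum_le order.trans[OF degree_monom_le])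
    moreover obtain b where b: "f = (\<Sum>i\<le>n. monom (b i) i)" "\<forall>i\<le>n. b i \<in> {b_lo i..b_hi i}"
      using f unfolding interval_poly_def by blast
    then have "coeff f n = b n" "b n \<noteq> 0" using assms(4) by (auto simp: coeff_sum)
    then have "n \<le> degree f" by (simp add: le_degree)
    ultimately show ?thesis using assms(1) by linarith
  qed
  moreover have "1 / k + \<gamma> \<le> 1 / k + Re (poly (cpoly g) (\<i> * of_real \<omega>) / poly (cpoly f) (\<i> * of_real \<omega>))" for \<omega> :: real
    using interval_plant_real_part_bound[OF assms(1-5) g f, of \<omega>] by (simp add: \<gamma>_def del: Re_divide)
  ultimately show "absolutely_stable N A B C D k"
    using circle_criterion[OF min _ _ assms(6)] by blast
qed

end
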